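(* Let $(M_1^{n_1},g_1)$ be a compact, connected Riemannian manifold, $f$ a positive smooth function on $M_1$, and $(M_2^{n_2},F_2)$ a weakly Berwald Finsler manifold. If the Finsler warped product $M=M_1\times_f M_2$ is Einstein with non-positive Ricci scalar function $\lambda$ on $M$, then $f$ is constant, and $M$ is simply a Riemannian product of two Finsler manifolds, which is in fact also a weakly Berwald manifold.
   Context: A Finsler metric on a smooth manifold $M$ is a continuous $F:TM\to[0,\infty)$, smooth on $TM^0=TM\setminus\{0\}$, positively 1-homogeneous on fibers, with $g_{ij}=\frac12\frac{\partial^2F^2}{\partial y^i\partial y^j}$ positive definite on $TM^0$. Spray coefficients: $G^i=\frac14 g^{i\ell}\{[F^2]_{x^ky^\ell}y^k-[F^2]_{x^\ell}\}$. $(M,F)$ is weakly Berwald if $E_{ij}=\frac12\frac{\partial^2}{\partial y^i\partial y^j}\big(\frac{\partial G^s}{\partial y^s}\big)$ vanishes identically. Riemann curvature: $R^i_k=2\frac{\partial G^i}{\partial x^k}-y^j\frac{\partial^2G^i}{\partial x^j\partial y^k}+2G^j\frac{\partial^2G^i}{\partial y^j\partial y^k}-\frac{\partial G^i}{\partial y^j}\frac{\partial G^j}{\partial y^k}$; Ricci curvature: $\operatorname{Ric}=\sum_i R^i_i$, and $\operatorname{Ric}_{ij}=\frac12\frac{\partial^2\operatorname{Ric}}{\partial y^i\partial y^j}$. $(M,F)$ is Einstein with Ricci scalar $\lambda$ if $\operatorname{Ric}(x,y)=\lambda(x)F^2(x,y)$, i.e. $\operatorname{Ric}_{ij}=\lambda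 g_{ij}$, for a function $\lambda=\lambda(x)$ on $M$ (not assumed constant). The Finsler warped product $M=M_1\times_f M_2$ of a base $(M_1,F_1)$ and fiber $(M_2,F_2)$ with warping function $f>0$ smooth on $M_1$ is $M_1\times M_2$ with $F^2(x_1,y_1,x_2,y_2)=F_1^2(x_1,y_1)+f^2(x_1)F_2^2(x_2,y_2)$ on $TM_1^0\times TM_2^0$, with geometric quantities computed there. If $f$ is constant it is called a Riemannian product of two Finsler manifolds. *)

theory Defs
  imports "HOL-Analysis.Analysis"
begin

section \<open>Smooth manifolds and tangent vectors\<close>

text \<open>Only used for open sets \<open>S\<close>.\<close>

primrec Ck_on :: "nat \<Rightarrow> ('e::real_normed_vector \<Rightarrow> 'g::real_normed_vector) \<Rightarrow> 'e set \<Rightarrow> bool" where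
  "Ck_on 0 f S \<longleftrightarrow> continuous_on S f"
| "Ck_on (Suc k) f S \<longleftrightarrow>
     (\<forall>x\<in>S. f differentiable (at x)) \<and> (\<forall>v. Ck_on k (\<lambda>x. frechet_derivative f (at x) v) S)"

definition smooth_on :: "('e::real_normed_vector \<Rightarrow> 'g::real_normed_vector) \<Rightarrow> 'e set \<Rightarrow> bool" where
  "smooth_on f S \<longleftrightarrow> (\<forall>k. Ck_on k f S)"

text \<open>A chart is a pair of a domain and a coordinate map (whose values off the domain are
  irrelevant). The model space \<open>'e\<close> is \<open>\<real>\<^sup>n\<close> with \<open>n = DIM('e) \<ge> 1\<close>, with coordinates
  \<open>x \<bullet> b\<close> for \<open>b \<in> Basis\<close>.\<close>

type_synonym ('a, 'e) chart = "'a set \<times> ('a \<Rightarrow> 'e)"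

definition chart_image :: "('a, 'e) chart \<Rightarrow> 'e set" where
  "chart_image c = snd c ` fst c"

definition chart_inv :: "('a, 'e) chart \<Rightarrow> 'e \<Rightarrow> 'a" where
  "chart_inv c = inv_into (fst c) (snd c)"

definition is_chart :: "('a::topological_space, 'e::euclidean_space) chart \<Rightarrow> bool" where
  "is_chart c \<longleftrightarrow> open (fst c) \<and> open (chart_image c) \<and>
     homeomorphism (fst c) (chart_image c) (snd c) (chart_inv c)"

text \<open>A smooth manifold is a second countable Hausdorff space (a type of the corresponding
  classes) with a smooth atlas; the atlas need not be maximal.\<close>

definition smooth_atlas ::
  "('a::{t2_space, second_countable_topology}, 'e::euclidean_space) chart set \<Rightarrow> bool" where
  "smooth_atlas A \<longleftrightarrow> (\<forall>c\<in>A. is_chart c) \<and> (\<Union>c\<in>A. fst c) = UNIV \<and>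
     (\<forall>c\<in>A. \<forall>d\<in>A. smooth_on (snd d \<circ> chart_inv c) (snd c ` (fst c \<inter> fst d)))"

definition smooth_function :: "('a, 'e::euclidean_space) chart set \<Rightarrow> ('a \<Rightarrow> real) \<Rightarrow> bool" where
  "smooth_function A f \<longleftrightarrow> (\<forall>c\<in>A. smooth_on (f \<circ> chart_inv c) (chart_image c))"

text \<open>A tangent vector is a directional derivative acting on functions. The operator
  \<open>tangent_vec c p y\<close> is \<open>\<Sum>i. y\<^sup>i \<partial>/\<partial>x\<^sup>i\<close> at \<open>p\<close> in the chart \<open>c\<close>, set to \<open>0\<close> on functions that are
  not differentiable at \<open>p\<close>. By the chain rule, different charts yield the same operators.\<close>

type_synonym 'a tangent = "('a \<Rightarrow> real) \<Rightarrow> real"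

definition tangent_vec :: "('a, 'e::euclidean_space) chart \<Rightarrow> 'a \<Rightarrow> 'e \<Rightarrow> 'a tangent" where
  "tangent_vec c p y = (\<lambda>h. if (h \<circ> chart_inv c) differentiable (at (snd c p))
     then frechet_derivative (h \<circ> chart_inv c) (at (snd c p)) y else 0)"

definition tangent_bundle :: "('a, 'e::euclidean_space) chart set \<Rightarrow> ('a \<times> 'a tangent) set" where
  "tangent_bundle A = {(p, tangent_vec c p y) | c p y. c \<in> A \<and> p \<in> fst c}"

definition slit_tangent_bundle :: "('a, 'e::euclidean_space) chart set \<Rightarrow> ('a \<times> 'a tangent) set" where
  "slit_tangent_bundle A = {(p, v) \<in> tangent_bundle A. v \<noteq> (\<lambda>h. 0)}"

definition pushforward :: "('a \<Rightarrow> 'b) \<Rightarrow> 'a tangent \<Rightarrow> 'b tangent" where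
  "pushforward \<Phi> v = (\<lambda>h. v (h \<circ> \<Phi>))"

text \<open>A function on the tangent bundle in the coordinates \<open>(x, y)\<close> induced by the chart \<open>c\<close>.\<close>

definition local_rep ::
  "('a, 'e::euclidean_space) chart \<Rightarrow> ('a \<Rightarrow> 'a tangent \<Rightarrow> real) \<Rightarrow> 'e \<Rightarrow> 'e \<Rightarrow> real" where
  "local_rep c F x y = F (chart_inv c x) (tangent_vec c (chart_inv c x) y)"


section \<open>Finsler geometry in local coordinates\<close>

definition dx :: "'e::real_vector \<Rightarrow> ('e \<Rightarrow> 'e \<Rightarrow> real) \<Rightarrow> 'e \<Rightarrow> 'e \<Rightarrow> real" where
  "dx b A x y = deriv (\<lambda>t. A (x + t *\<^sub>R b) y) 0"

definition dy :: "'e::real_vector \<Rightarrow> ('e \<Rightarrow> 'e \<Rightarrow> real) \<Rightarrow> 'e \<Rightarrow> 'e \<Rightarrow> real" where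
  "dy b A x y = deriv (\<lambda>t. A x (y + t *\<^sub>R b)) 0"

definition fsq :: "('e \<Rightarrow> 'e \<Rightarrow> real) \<Rightarrow> 'e \<Rightarrow> 'e \<Rightarrow> real" where
  "fsq F x y = (F x y)\<^sup>2"

definition fund :: "('e::euclidean_space \<Rightarrow> 'e \<Rightarrow> real) \<Rightarrow> 'e \<Rightarrow> 'e \<Rightarrow> 'e \<Rightarrow> 'e \<Rightarrow> real" where
  "fund F i j x y = 1/2 * dy i (dy j (fsq F)) x y"

text \<open>The entries \<open>g\<^sup>i\<^sup>l\<close> of the inverse matrix of \<open>g\<^sub>i\<^sub>j\<close>, read off from the inverse of the linear
  map with that matrix.\<close>

definition fund_inv :: "('e::euclidean_space \<Rightarrow> 'e \<Rightarrow> real) \<Rightarrow> 'e \<Rightarrow> 'e \<Rightarrow> 'e \<Rightarrow> 'e \<Rightarrow> real" where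
  "fund_inv F i l x y =
     inv (\<lambda>u. \<Sum>a\<in>Basis. (\<Sum>b\<in>Basis. fund F a b x y * (u \<bullet> b)) *\<^sub>R a) l \<bullet> i"

definition spray :: "('e::euclidean_space \<Rightarrow> 'e \<Rightarrow> real) \<Rightarrow> 'e \<Rightarrow> 'e \<Rightarrow> 'e \<Rightarrow> real" where
  "spray F i x y = 1/4 * (\<Sum>l\<in>Basis. fund_inv F i l x y *
     ((\<Sum>k\<in>Basis. dx k (dy l (fsq F)) x y * (y \<bullet> k)) - dx l (fsq F) x y))"

definition E_curv :: "('e::euclidean_space \<Rightarrow> 'e \<Rightarrow> real) \<Rightarrow> 'e \<Rightarrow> 'e \<Rightarrow> 'e \<Rightarrow> 'e \<Rightarrow> real" where
  "E_curv F i j x y = 1/2 * dy i (dy j (\<lambda>x y. \<Sum>s\<in>Basis. dy s (spray F s) x y)) x y"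

definition Riem :: "('e::euclidean_space \<Rightarrow> 'e \<Rightarrow> real) \<Rightarrow> 'e \<Rightarrow> 'e \<Rightarrow> 'e \<Rightarrow> 'e \<Rightarrow> real" where
  "Riem F i k x y = 2 * dx k (spray F i) x y
     - (\<Sum>j\<in>Basis. (y \<bullet> j) * dx j (dy k (spray F i)) x y)
     + 2 * (\<Sum>j\<in>Basis. spray F j x y * dy j (dy k (spray F i)) x y)
     - (\<Sum>j\<in>Basis. dy j (spray F i) x y * dy k (spray F j) x y)"

definition Ricci :: "('e::euclidean_space \<Rightarrow> 'e \<Rightarrow> real) \<Rightarrow> 'e \<Rightarrow> 'e \<Rightarrow> real" where
  "Ricci F x y = (\<Sum>i\<in>Basis. Riem F i i x y)"


section \<open>Finsler and Riemannian metrics on manifolds\<close>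

definition finsler_metric ::
  "('a, 'e::euclidean_space) chart set \<Rightarrow> ('a \<Rightarrow> 'a tangent \<Rightarrow> real) \<Rightarrow> bool" where
  "finsler_metric A F \<longleftrightarrow>
     (\<forall>(p, v) \<in> tangent_bundle A. F p v \<ge> 0 \<and> (\<forall>t>0. F p (\<lambda>h. t * v h) = t * F p v)) \<and>
     (\<forall>c\<in>A.
        continuous_on (chart_image c \<times> UNIV) (\<lambda>(x, y). local_rep c F x y) \<and>
        smooth_on (\<lambda>(x, y). local_rep c F x y) (chart_image c \<times> (- {0})) \<and>
        (\<forall>x\<in>chart_image c. \<forall>y. y \<noteq> 0 \<longrightarrow> (\<forall>u. u \<noteq> 0 \<longrightarrow>
           (\<Sum>i\<in>Basis. \<Sum>j\<in>Basis. fund (local_rep c F) i j x y * (u \<bullet> i) * (u \<bullet> j)) > 0)))"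

definition riemannian_metric ::
  "('a, 'e::euclidean_space) chart set \<Rightarrow> ('a \<Rightarrow> 'a tangent \<Rightarrow> 'a tangent \<Rightarrow> real) \<Rightarrow> bool" where
  "riemannian_metric A g \<longleftrightarrow> (\<forall>c\<in>A.
     (\<forall>p\<in>fst c.
        bilinear (\<lambda>u w. g p (tangent_vec c p u) (tangent_vec c p w)) \<and>
        (\<forall>u w. g p (tangent_vec c p u) (tangent_vec c p w) = g p (tangent_vec c p w) (tangent_vec c p u)) \<and>
        (\<forall>u. u \<noteq> 0 \<longrightarrow> g p (tangent_vec c p u) (tangent_vec c p u) > 0)) \<and>
     (\<forall>i\<in>Basis. \<forall>j\<in>Basis. smooth_on
        (\<lambda>x. g (chart_inv c x) (tangent_vec c (chart_inv c x) i) (tangent_vec c (chart_inv c x) j))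
        (chart_image c)))"

definition riemannian_norm :: "('a \<Rightarrow> 'a tangent \<Rightarrow> 'a tangent \<Rightarrow> real) \<Rightarrow> 'a \<Rightarrow> 'a tangent \<Rightarrow> real" where
  "riemannian_norm g p v = sqrt (g p v v)"

text \<open>The curvature conditions are relative to a set \<open>D\<close> of tangent vectors where the metric
  is smooth: the slit tangent bundle for a Finsler metric, and \<open>TM\<^sub>1\<^sup>0 \<times> TM\<^sub>2\<^sup>0\<close> for a warped
  product. All of them are independent of the choice of charts.\<close>

definition weakly_berwald ::
  "('a, 'e::euclidean_space) chart set \<Rightarrow> ('a \<times> 'a tangent) set \<Rightarrow> ('a \<Rightarrow> 'a tangent \<Rightarrow> real) \<Rightarrow> bool" where
  "weakly_berwald A D F \<longleftrightarrow> (\<forall>c\<in>A. \<forall>p\<in>fst c. \<forall>y. (p, tangent_vec c p y) \<in> D \<longrightarrow>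
     (\<forall>i\<in>Basis. \<forall>j\<in>Basis. E_curv (local_rep c F) i j (snd c p) y = 0))"

definition einstein_with ::
  "('a, 'e::euclidean_space) chart set \<Rightarrow> ('a \<times> 'a tangent) set \<Rightarrow> ('a \<Rightarrow> 'a tangent \<Rightarrow> real)
     \<Rightarrow> ('a \<Rightarrow> real) \<Rightarrow> bool" where
  "einstein_with A D F lam \<longleftrightarrow> (\<forall>c\<in>A. \<forall>p\<in>fst c. \<forall>y. (p, tangent_vec c p y) \<in> D \<longrightarrow>
     Ricci (local_rep c F) (snd c p) y = lam p * (F p (tangent_vec c p y))\<^sup>2)"


section \<open>Warped products\<close>

definition product_atlas ::
  "('a, 'e::euclidean_space) chart set \<Rightarrow> ('b, 'd::euclidean_space) chart set
     \<Rightarrow> ('a \<times> 'b, 'e \<times> 'd) chart set" where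
  "product_atlas A1 A2 = {(fst c1 \<times> fst c2, map_prod (snd c1) (snd c2)) | c1 c2. c1 \<in> A1 \<and> c2 \<in> A2}"

text \<open>\<open>TM\<^sub>1\<^sup>0 \<times> TM\<^sub>2\<^sup>0\<close>, as a subset of the tangent bundle of \<open>M\<^sub>1 \<times> M\<^sub>2\<close>.\<close>

definition product_slit_bundle ::
  "('a, 'e::euclidean_space) chart set \<Rightarrow> ('b, 'd::euclidean_space) chart set
     \<Rightarrow> (('a \<times> 'b) \<times> ('a \<times> 'b) tangent) set" where
  "product_slit_bundle A1 A2 = {(p, v) \<in> tangent_bundle (product_atlas A1 A2).
     (fst p, pushforward fst v) \<in> slit_tangent_bundle A1 \<and>
     (snd p, pushforward snd v) \<in> slit_tangent_bundle A2}"

definition warped_product ::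
  "('a \<Rightarrow> 'a tangent \<Rightarrow> real) \<Rightarrow> ('a \<Rightarrow> real) \<Rightarrow> ('b \<Rightarrow> 'b tangent \<Rightarrow> real)
     \<Rightarrow> 'a \<times> 'b \<Rightarrow> ('a \<times> 'b) tangent \<Rightarrow> real" where
  "warped_product F1 f F2 p v =
     sqrt ((F1 (fst p) (pushforward fst v))\<^sup>2 + (f (fst p))\<^sup>2 * (F2 (snd p) (pushforward snd v))\<^sup>2)"

text \<open>A metric on \<open>M\<^sub>1 \<times> M\<^sub>2\<close> is a Riemannian product of Finsler metrics if it is a warped
  product with constant warping function.\<close>

definition riemannian_product ::
  "('a, 'e::euclidean_space) chart set \<Rightarrow> ('b, 'd::euclidean_space) chart set
     \<Rightarrow> ('a \<times> 'b \<Rightarrow> ('a \<times> 'b) tangent \<Rightarrow> real) \<Rightarrow> bool" where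
  "riemannian_product A1 A2 F \<longleftrightarrow> (\<exists>F1 F2 k. finsler_metric A1 F1 \<and> finsler_metric A2 F2 \<and> k > 0 \<and>
     (\<forall>(p, v) \<in> product_slit_bundle A1 A2. F p v = warped_product F1 (\<lambda>_. k) F2 p v))"

end

theory Submission
  imports Defs
begin

text \<open>
  Write \<open>\<phi>\<close> for the warping function in a chart. In product coordinates the spray of \<open>F\<close> is
  \<open>(G\<^sub>1 - \<phi> P \<nabla>\<phi> / 2, G\<^sub>2 + (d\<phi>(u) / \<phi>) v)\<close> with \<open>P = F\<^sub>2\<^sup>2\<close>, hence
  \<open>Ric = Ric\<^sub>1(u, u) - (n\<^sub>2 / \<phi>) Hess \<phi> (u, u) + Ric\<^sub>2(v) - (\<phi> \<Delta>\<phi> + (n\<^sub>2 - 1) |\<nabla>\<phi>|\<^sup>2) P(v)\<close>.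
  Comparing \<open>(u, v)\<close> with \<open>(2u, v)\<close> splits the Einstein condition into
  \<open>Ric\<^sub>1 - (n\<^sub>2 / \<phi>) Hess \<phi> = \<lambda> g\<^sub>1\<close>, so that \<open>\<lambda>\<close> depends on the base point only, and
  \<open>\<phi> \<Delta>\<phi> + (n\<^sub>2 - 1) |\<nabla>\<phi>|\<^sup>2 + \<lambda> \<phi>\<^sup>2 = \<mu>\<close> with a constant \<open>\<mu>\<close>.
  By the contracted second Bianchi identity the two equations imply \<open>(n\<^sub>1 + n\<^sub>2 - 2) d\<lambda> = 0\<close>.
  If \<open>n\<^sub>1 + n\<^sub>2 > 2\<close>, then \<open>\<lambda>\<close> is constant, a minimum point of \<open>\<phi>\<close> shows \<open>\<mu> - \<lambda> \<phi>\<^sup>2 \<ge> 0\<close> there and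
  therefore everywhere (as \<open>\<lambda> \<le> 0\<close>), and the strong maximum principle applies to
  \<open>\<phi> \<Delta>\<phi> + (n\<^sub>2 - 1) |\<nabla>\<phi>|\<^sup>2 \<ge> 0\<close>. If \<open>n\<^sub>1 = n\<^sub>2 = 1\<close>, then \<open>Ric\<^sub>1 = 0\<close> and
  \<open>\<Delta>\<phi> = - \<lambda> \<phi> \<ge> 0\<close>.
\<close>

section \<open>Smooth functions\<close>

text \<open>The Einstein condition is available only where both components of the tangent vector are
  nonzero, so neither equation can be read off by setting \<open>u\<close> or \<open>v\<close> to
  zero; but every term is either quadratic in \<open>u\<close> or free of \<open>u\<close>, and
  scaling separates the two kinds. The constant \<mu> is the fiber Ricci curvature divided by
  \<open>P\<close> at one fixed fiber vector, a number that does not see the base point. The Bianchi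
  identity produces the divergence of the Hessian, which the Bochner formula trades for
  d\<Delta>\<phi> and Ric(\<nabla>\<phi>); the derivative of the second equation supplies exactly
  the combination left over, so that only d\<lambda> remains. In total dimension 2 its coefficient
  vanishes. The squared gradient makes the final inequality nonlinear; with one factor
  \<nabla>\<phi> treated as a given coefficient field it is linear, and Hopf's argument applies.
  Tensors are functions linear in each slot, evaluated on vectors constant in the chart, and metric
  traces are sums of T(b, \<open>sharp\<close> b) over the fixed basis, so no orthonormal frames
  occur.\<close>

abbreviation FD :: "('e::real_normed_vector \<Rightarrow> 'g::real_normed_vector) \<Rightarrow> 'e \<Rightarrow> 'e \<Rightarrow> 'g" where
  "FD f x v \<equiv> frechet_derivative f (at x) v"

lemma FD_eqI: "(f has_derivative f') (at x) \<Longrightarrow> FD f x v = f' v"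
  by (metis frechet_derivative_at)

lemma FD_cong_open:
  assumes "open S" "x \<in> S" "\<And>y. y \<in> S \<Longrightarrow> f y = g y"
  shows "FD f x = FD g x"
proof (cases "f differentiable (at x)")
  case True
  then show ?thesis
    by (rule frechet_derivative_transform_within_open) (use assms in auto)
next
  case False
  \<comment> \<open>Without a derivative, \<open>frechet_derivative\<close> is an arbitrary choice;
    since \<open>f\<close> and \<open>g\<close> have the same candidates at \<open>x\<close>, the
    choices coincide.\<close>
  have "(f has_derivative f') (at x) \<longleftrightarrow> (g has_derivative f') (at x)" for f'
    using assms by (metis has_derivative_transform_within_open)
  then show ?thesis
    by (simp add: frechet_derivative_def)
qed

lemma differentiable_cong_open:
  assumes "open S" "x \<in> S" "\<And>y. y \<in> S \<Longrightarrow> f y = g y" "f differentiable (at x)"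
  shows "g differentiable (at x)"
  using assms by (meson differentiable_def has_derivative_transform_within_open)

lemma differentiable_cong_iff:
  assumes "open S" "x \<in> S" "\<And>y. y \<in> S \<Longrightarrow> f y = g y"
  shows "f differentiable (at x) \<longleftrightarrow> g differentiable (at x)"
  using differentiable_cong_open[OF assms(1,2), of f g] differentiable_cong_open[OF assms(1,2), of g f] assms(3)
  by auto

lemma Ck_on_cong:
  assumes "open S" "\<And>y. y \<in> S \<Longrightarrow> f y = g y" "Ck_on k f S"
  shows "Ck_on k g S"
  using assms(2,3)
proof (induction k arbitrary: f g)
  case 0
  then show ?case by (simp cong: continuous_on_cong)
next
  case (Suc k)
  have "g differentiable (at x)" if "x \<in> S" for x
    using differentiable_cong_open[OF \<open>open S\<close> that, of f g] Suc.prems that by auto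
  moreover have "Ck_on k (\<lambda>x. FD g x v) S" for v
    using Suc.IH[of "\<lambda>x. FD f x v" "\<lambda>x. FD g x v"] FD_cong_open[OF \<open>open S\<close>, of _ f g] Suc.prems
    by auto
  ultimately show ?case by simp
qed

text \<open>Lets a smoothness proof work with an explicit derivative formula in place of the chosen
  \<open>frechet_derivative\<close>; the inductions on the order below rely on it.\<close>

lemma Ck_onI:
  assumes "open S" "\<And>x. x \<in> S \<Longrightarrow> (f has_derivative f' x) (at x)" "\<And>v. Ck_on k (\<lambda>x. f' x v) S"
  shows "Ck_on (Suc k) f S"
  unfolding Ck_on.simps
proof (intro conjI ballI allI)
  show "f differentiable (at x)" if "x \<in> S" for x
    using assms(2)[OF that] by (rule differentiableI)
  show "Ck_on k (\<lambda>x. FD f x v) S" for v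
    by (rule Ck_on_cong[OF assms(1) _ assms(3)[of v]]) (simp add: FD_eqI[OF assms(2)])
qed

lemma Ck_on_has_derivative:
  assumes "Ck_on (Suc k) f S" "x \<in> S"
  shows "(f has_derivative FD f x) (at x)"
  using assms by (simp add: frechet_derivative_works)

lemma Ck_on_FD: "Ck_on (Suc k) f S \<Longrightarrow> Ck_on k (\<lambda>x. FD f x v) S"
  by simp

lemma Ck_on_Suc_imp: "Ck_on (Suc k) f S \<Longrightarrow> Ck_on k f S"
proof (induction k arbitrary: f)
  case 0
  then show ?case
    by (auto intro!: continuous_at_imp_continuous_on differentiable_imp_continuous_within)
next
  case (Suc k)
  then show ?case unfolding Ck_on.simps(2)[of "Suc k"] unfolding Ck_on.simps(2)[of k] by blast
qed

lemma Ck_on_const: "open S \<Longrightarrow> Ck_on k (\<lambda>x. c) S"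
  by (induction k arbitrary: c) auto

lemma Ck_on_bounded_linear:
  assumes "open S" "bounded_linear L"
  shows "Ck_on k L S"
proof (cases k)
  case 0
  then show ?thesis using assms by (simp add: linear_continuous_on)
next
  case (Suc j)
  show ?thesis unfolding Suc
    by (rule Ck_onI[where f' = "\<lambda>x. L"])
      (use assms in \<open>auto intro: Ck_on_const bounded_linear_imp_has_derivative\<close>)
qed

lemma Ck_on_bounded_linear_comp:
  assumes "open S" "bounded_linear L" "Ck_on k f S"
  shows "Ck_on k (\<lambda>x. L (f x)) S"
  using assms(3)
proof (induction k arbitrary: f)
  case 0
  then show ?case using assms by (auto intro: bounded_linear.continuous_on)
next
  case (Suc k)
  show ?case
    by (rule Ck_onI[where f' = "\<lambda>x v. L (FD f x v)"])
      (use assms Suc Ck_on_has_derivative[OF Suc.prems] in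
        \<open>auto intro: bounded_linear.has_derivative\<close>)
qed

lemma Ck_on_add:
  assumes "open S" "Ck_on k f S" "Ck_on k g S"
  shows "Ck_on k (\<lambda>x. f x + g x) S"
  using assms(2,3)
proof (induction k arbitrary: f g)
  case 0
  then show ?case by (auto intro: continuous_on_add)
next
  case (Suc k)
  show ?case
    by (rule Ck_onI[where f' = "\<lambda>x v. FD f x v + FD g x v"])
      (use assms Suc Ck_on_has_derivative[OF Suc.prems(1)] Ck_on_has_derivative[OF Suc.prems(2)] in
        \<open>auto intro: has_derivative_add\<close>)
qed

lemma Ck_on_bilinear:
  assumes "open S" "bounded_bilinear B" "Ck_on k f S" "Ck_on k g S"
  shows "Ck_on k (\<lambda>x. B (f x) (g x)) S"
  using assms(3,4)
proof (induction k arbitrary: f g)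
  case 0
  then show ?case using assms by (auto intro: bounded_bilinear.continuous_on)
next
  case (Suc k)
  show ?case
    by (rule Ck_onI[where f' = "\<lambda>x v. B (f x) (FD g x v) + B (FD f x v) (g x)"])
      (use assms Suc Ck_on_Suc_imp[OF Suc.prems(1)] Ck_on_Suc_imp[OF Suc.prems(2)]
        Ck_on_has_derivative[OF Suc.prems(1)] Ck_on_has_derivative[OF Suc.prems(2)] in
        \<open>auto intro!: Ck_on_add bounded_bilinear.FDERIV[OF assms(2)]\<close>)
qed

lemma Ck_on_affine_comp:
  assumes "open T" "bounded_linear L" "Ck_on k f S" "\<And>x. x \<in> T \<Longrightarrow> a + L x \<in> S"
  shows "Ck_on k (\<lambda>x. f (a + L x)) T"
  using assms(3)
proof (induction k arbitrary: f)
  case 0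
  have "continuous_on T (\<lambda>x. a + L x)"
    by (intro continuous_intros linear_continuous_on assms)
  then show ?case
    using 0 assms(4) by (auto intro!: continuous_on_compose2[where f = "\<lambda>x. a + L x" and g = f])
next
  case (Suc k)
  have "((\<lambda>x. f (a + L x)) has_derivative (\<lambda>v. FD f (a + L x) (L v))) (at x)" if "x \<in> T" for x
  proof -
    have "((\<lambda>x. a + L x) has_derivative L) (at x)"
      using assms(2) by (auto intro!: derivative_eq_intros bounded_linear_imp_has_derivative)
    from has_derivative_compose[OF this Ck_on_has_derivative[OF Suc.prems assms(4)[OF that]]]
    show ?thesis by simp
  qed
  then show ?case
    by (rule Ck_onI[OF \<open>open T\<close>]) (use Suc in auto)
qed

text \<open>The derivative of \<open>1 / f\<close> is a product of that of \<open>f\<close> with two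
  copies of \<open>1 / f\<close>, up to sign, so the induction on the order closes without a
  composition rule.\<close>

lemma Ck_on_inverse:
  fixes f :: "_ \<Rightarrow> real"
  assumes "open S" "Ck_on k f S" "\<And>x. x \<in> S \<Longrightarrow> f x \<noteq> 0"
  shows "Ck_on k (\<lambda>x. inverse (f x)) S"
  using assms(2)
proof (induction k)
  case 0
  then show ?case using assms by (auto intro: continuous_on_inverse)
next
  case (Suc k)
  show ?case
  proof (rule Ck_onI[OF \<open>open S\<close>])
    show "((\<lambda>x. inverse (f x)) has_derivative
        (\<lambda>v. (- 1 *\<^sub>R FD f x v) * (inverse (f x) * inverse (f x)))) (at x)" if "x \<in> S" for x
      using Deriv.has_derivative_inverse[OF assms(3)[OF that] Ck_on_has_derivative[OF Suc.prems that]]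
      by (simp add: mult_ac)
    show "Ck_on k (\<lambda>x. (- 1 *\<^sub>R FD f x v) * (inverse (f x) * inverse (f x))) S" for v
      by (intro Ck_on_bilinear[OF _ bounded_bilinear_mult]
          Ck_on_bounded_linear_comp[OF _ bounded_linear_scaleR_right] Suc.IH
          Ck_on_Suc_imp[OF Suc.prems] Ck_on_FD[OF Suc.prems] assms(1))
  qed
qed

text \<open>Closes like the inverse: the derivative is built from that of \<open>f\<close> and from
  \<open>1 / sqrt f\<close>.\<close>

lemma Ck_on_sqrt:
  assumes "open S" "Ck_on k f S" "\<And>x. x \<in> S \<Longrightarrow> f x > 0"
  shows "Ck_on k (\<lambda>x. sqrt (f x)) S"
  using assms(2)
proof (induction k)
  case 0
  then show ?case by (auto intro: continuous_on_real_sqrt)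
next
  case (Suc k)
  have IH: "Ck_on k (\<lambda>x. sqrt (f x)) S"
    using Suc Ck_on_Suc_imp by blast
  show ?case
  proof (rule Ck_onI[OF \<open>open S\<close>])
    show "((\<lambda>x. sqrt (f x)) has_derivative (\<lambda>v. (1/2) *\<^sub>R (FD f x v * inverse (sqrt (f x))))) (at x)"
      if "x \<in> S" for x
    proof -
      have "(sqrt has_derivative (*) (inverse (sqrt (f x)) / 2)) (at (f x))"
        using DERIV_real_sqrt[OF assms(3)[OF that]] by (simp add: has_field_derivative_def)
      from has_derivative_compose[OF Ck_on_has_derivative[OF Suc.prems that] this]
      show ?thesis by (simp add: mult_ac)
    qed
    show "Ck_on k (\<lambda>x. (1/2) *\<^sub>R (FD f x v * inverse (sqrt (f x)))) S" for v
      by (intro Ck_on_bilinear[OF _ bounded_bilinear_mult] IH Ck_on_inverse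
          Ck_on_bounded_linear_comp[OF _ bounded_linear_scaleR_right]
          Ck_on_FD[OF Suc.prems] assms(1)) (use assms(3) in fastforce)
  qed
qed

named_theorems smooth_intros

lemma smooth_on_cong:
  "open S \<Longrightarrow> (\<And>y. y \<in> S \<Longrightarrow> f y = g y) \<Longrightarrow> smooth_on f S \<Longrightarrow> smooth_on g S"
  using Ck_on_cong unfolding smooth_on_def by metis

lemma smooth_on_const [smooth_intros]: "open S \<Longrightarrow> smooth_on (\<lambda>x. c) S"
  by (simp add: smooth_on_def Ck_on_const)

lemma smooth_on_bounded_linear: "open S \<Longrightarrow> bounded_linear L \<Longrightarrow> smooth_on L S"
  by (simp add: smooth_on_def Ck_on_bounded_linear)

lemma smooth_on_ident [smooth_intros]: "open S \<Longrightarrow> smooth_on (\<lambda>x. x) S"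
  by (simp add: smooth_on_bounded_linear)

lemma smooth_on_bounded_linear_comp:
  "open S \<Longrightarrow> bounded_linear L \<Longrightarrow> smooth_on f S \<Longrightarrow> smooth_on (\<lambda>x. L (f x)) S"
  by (simp add: smooth_on_def Ck_on_bounded_linear_comp)

lemma smooth_on_bilinear:
  "open S \<Longrightarrow> bounded_bilinear B \<Longrightarrow> smooth_on f S \<Longrightarrow> smooth_on g S \<Longrightarrow> smooth_on (\<lambda>x. B (f x) (g x)) S"
  by (simp add: smooth_on_def Ck_on_bilinear)

lemma smooth_on_add [smooth_intros]:
  "open S \<Longrightarrow> smooth_on f S \<Longrightarrow> smooth_on g S \<Longrightarrow> smooth_on (\<lambda>x. f x + g x) S"
  by (simp add: smooth_on_def Ck_on_add)

lemma smooth_on_mult [smooth_intros]: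
  fixes f :: "_ \<Rightarrow> real"
  shows "open S \<Longrightarrow> smooth_on f S \<Longrightarrow> smooth_on g S \<Longrightarrow> smooth_on (\<lambda>x. f x * g x) S"
  by (rule smooth_on_bilinear[OF _ bounded_bilinear_mult])

lemma smooth_on_scaleR [smooth_intros]:
  "open S \<Longrightarrow> smooth_on f S \<Longrightarrow> smooth_on g S \<Longrightarrow> smooth_on (\<lambda>x. f x *\<^sub>R g x) S"
  by (rule smooth_on_bilinear[OF _ bounded_bilinear_scaleR])

lemma smooth_on_inner [smooth_intros]:
  "open S \<Longrightarrow> smooth_on f S \<Longrightarrow> smooth_on g S \<Longrightarrow> smooth_on (\<lambda>x. f x \<bullet> g x) S"
  by (rule smooth_on_bilinear[OF _ bounded_bilinear_inner])

lemma smooth_on_minus [smooth_intros]: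
  "open S \<Longrightarrow> smooth_on f S \<Longrightarrow> smooth_on (\<lambda>x. - f x) S"
  by (rule smooth_on_bounded_linear_comp[OF _ bounded_linear_minus[OF bounded_linear_ident]])

lemma smooth_on_diff [smooth_intros]:
  "open S \<Longrightarrow> smooth_on f S \<Longrightarrow> smooth_on g S \<Longrightarrow> smooth_on (\<lambda>x. f x - g x) S"
  using smooth_on_add[of S f "\<lambda>x. - g x"] smooth_on_minus[of S g] by simp

lemma smooth_on_sum [smooth_intros]:
  "open S \<Longrightarrow> (\<And>i. i \<in> I \<Longrightarrow> smooth_on (f i) S) \<Longrightarrow> smooth_on (\<lambda>x. \<Sum>i\<in>I. f i x) S"
  by (induction I rule: infinite_finite_induct) (auto intro!: smooth_on_const smooth_on_add)

lemma smooth_on_affine_comp: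
  assumes "smooth_on f S" "open T" "bounded_linear L" "\<And>x. x \<in> T \<Longrightarrow> a + L x \<in> S"
  shows "smooth_on (\<lambda>x. f (a + L x)) T"
  using assms by (auto simp: smooth_on_def intro!: Ck_on_affine_comp[where S = S])

lemma smooth_on_inverse [smooth_intros]:
  fixes f :: "_ \<Rightarrow> real"
  shows "open S \<Longrightarrow> smooth_on f S \<Longrightarrow> (\<And>x. x \<in> S \<Longrightarrow> f x \<noteq> 0) \<Longrightarrow> smooth_on (\<lambda>x. inverse (f x)) S"
  by (simp add: smooth_on_def Ck_on_inverse)

lemma smooth_on_divide [smooth_intros]:
  fixes f :: "_ \<Rightarrow> real"
  shows "open S \<Longrightarrow> smooth_on f S \<Longrightarrow> smooth_on g S \<Longrightarrow> (\<And>x. x \<in> S \<Longrightarrow> g x \<noteq> 0)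
    \<Longrightarrow> smooth_on (\<lambda>x. f x / g x) S"
  unfolding divide_inverse by (intro smooth_intros)

lemma smooth_on_power [smooth_intros]:
  fixes f :: "_ \<Rightarrow> real"
  shows "open S \<Longrightarrow> smooth_on f S \<Longrightarrow> smooth_on (\<lambda>x. f x ^ n) S"
  by (induction n) (auto intro!: smooth_intros)

lemma smooth_on_sqrt:
  "open S \<Longrightarrow> smooth_on f S \<Longrightarrow> (\<And>x. x \<in> S \<Longrightarrow> f x > 0) \<Longrightarrow> smooth_on (\<lambda>x. sqrt (f x)) S"
  by (simp add: smooth_on_def Ck_on_sqrt)

lemma smooth_on_FD [smooth_intros]: "smooth_on f S \<Longrightarrow> smooth_on (\<lambda>x. FD f x v) S"
  unfolding smooth_on_def using Ck_on_FD by blast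

lemma smooth_on_has_derivative:
  "smooth_on f S \<Longrightarrow> x \<in> S \<Longrightarrow> (f has_derivative FD f x) (at x)"
  using Ck_on_has_derivative unfolding smooth_on_def by blast

lemma smooth_on_differentiable:
  "smooth_on f S \<Longrightarrow> x \<in> S \<Longrightarrow> f differentiable (at x)"
  using smooth_on_has_derivative differentiableI by blast

lemma smooth_on_continuous_on: "smooth_on f S \<Longrightarrow> continuous_on S f"
  unfolding smooth_on_def using Ck_on.simps(1) by blast

lemma smooth_on_linear_FD:
  "smooth_on f S \<Longrightarrow> x \<in> S \<Longrightarrow> linear (FD f x)"
  using linear_frechet_derivative smooth_on_differentiable by blast

section \<open>Derivatives along lines and the symmetry of second derivatives\<close>

lemma has_derivative_line:
  assumes "(f has_derivative f') (at (x + t *\<^sub>R v))"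
  shows "((\<lambda>s. f (x + s *\<^sub>R v)) has_vector_derivative f' v) (at t)"
proof -
  have "((\<lambda>s. x + s *\<^sub>R v) has_derivative (\<lambda>s. s *\<^sub>R v)) (at t)"
    by (auto intro!: derivative_eq_intros)
  from has_derivative_compose[OF this assms]
  have "((\<lambda>s. f (x + s *\<^sub>R v)) has_derivative (\<lambda>s. f' (s *\<^sub>R v))) (at t)" .
  moreover have "linear f'"
    using assms has_derivative_linear by blast
  ultimately show ?thesis
    by (simp add: has_vector_derivative_def linear_scale)
qed

lemma has_derivative_line_real:
  fixes f :: "_ \<Rightarrow> real"
  assumes "(f has_derivative f') (at (x + t *\<^sub>R v))"
  shows "((\<lambda>s. f (x + s *\<^sub>R v)) has_real_derivative f' v) (at t)"
  using has_derivative_line[OF assms] by (simp add: has_real_derivative_iff_has_vector_derivative)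

text \<open>The mean value theorem is applied twice: in direction \<open>u\<close> to the difference
  of \<open>f\<close> along two parallel segments, then in direction \<open>w\<close> to the
  derivative found. The second difference is symmetric in \<open>u\<close> and \<open>w\<close>,
  which is what Schwarz's theorem exploits.\<close>

lemma second_difference_mvt:
  fixes f :: "'e::real_normed_vector \<Rightarrow> real"
  assumes "s > 0" and S: "\<And>a b. 0 \<le> a \<Longrightarrow> a \<le> s \<Longrightarrow> 0 \<le> b \<Longrightarrow> b \<le> s \<Longrightarrow> x + a *\<^sub>R u + b *\<^sub>R w \<in> S"
    and f: "smooth_on f S"
  obtains a b where "0 \<le> a" "a \<le> s" "0 \<le> b" "b \<le> s"
    "f (x + s *\<^sub>R u + s *\<^sub>R w) - f (x + s *\<^sub>R u) - f (x + s *\<^sub>R w) + f x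
       = s\<^sup>2 * FD (\<lambda>y. FD f y u) (x + a *\<^sub>R u + b *\<^sub>R w) w"
proof -
  define g where "g = (\<lambda>a. f ((x + s *\<^sub>R w) + a *\<^sub>R u) - f (x + a *\<^sub>R u))"
  define g' where "g' = (\<lambda>a. FD f ((x + s *\<^sub>R w) + a *\<^sub>R u) u - FD f (x + a *\<^sub>R u) u)"
  have "(g has_real_derivative g' a) (at a)" if "0 \<le> a" "a \<le> s" for a
    unfolding g_def g'_def
    by (intro DERIV_diff has_derivative_line_real smooth_on_has_derivative[OF f])
      (use S[of a s] S[of a 0] that \<open>s > 0\<close> in \<open>auto simp: algebra_simps\<close>)
  from MVT2[OF \<open>s > 0\<close> this] obtain a where a: "0 < a" "a < s" "g s - g 0 = s * g' a"
    by auto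
  have "((\<lambda>b. FD f (x + a *\<^sub>R u + b *\<^sub>R w) u) has_real_derivative
      FD (\<lambda>y. FD f y u) (x + a *\<^sub>R u + b *\<^sub>R w) w) (at b)" if "0 \<le> b" "b \<le> s" for b
    by (intro has_derivative_line_real smooth_on_has_derivative[OF smooth_on_FD[OF f]])
      (use S[of a b] that a in auto)
  from MVT2[OF \<open>s > 0\<close> this] obtain b where b: "0 < b" "b < s"
    "FD f (x + a *\<^sub>R u + s *\<^sub>R w) u - FD f (x + a *\<^sub>R u + 0 *\<^sub>R w) u
      = s * FD (\<lambda>y. FD f y u) (x + a *\<^sub>R u + b *\<^sub>R w) w"
    by auto
  have "g' a = s * FD (\<lambda>y. FD f y u) (x + a *\<^sub>R u + b *\<^sub>R w) w"
    using b(3) by (simp add: g'_def add_ac)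
  with a(3) have "g s - g 0 = s\<^sup>2 * FD (\<lambda>y. FD f y u) (x + a *\<^sub>R u + b *\<^sub>R w) w"
    by (simp add: power2_eq_square)
  then have "f (x + s *\<^sub>R u + s *\<^sub>R w) - f (x + s *\<^sub>R u) - f (x + s *\<^sub>R w) + f x
       = s\<^sup>2 * FD (\<lambda>y. FD f y u) (x + a *\<^sub>R u + b *\<^sub>R w) w"
    by (simp add: g_def algebra_simps)
  then show thesis
    using that[of a b] a b by auto
qed

text \<open>Schwarz's theorem. Each mixed derivative, at some point near \<open>x\<close>, equals
  the same second difference divided by s^2; continuity carries the equality to
  \<open>x\<close>.\<close>

lemma FD_symmetric_real:
  fixes f :: "'e::real_normed_vector \<Rightarrow> real"
  assumes "open S" "x \<in> S" and f: "smooth_on f S"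
  shows "FD (\<lambda>y. FD f y u) x w = FD (\<lambda>y. FD f y w) x u"
proof (rule ccontr)
  define A where "A = (\<lambda>y. FD (\<lambda>y. FD f y u) y w)"
  define B where "B = (\<lambda>y. FD (\<lambda>y. FD f y w) y u)"
  assume "\<not> ?thesis"
  then have ne: "A x \<noteq> B x" by (simp add: A_def B_def)
  \<comment> \<open>Half the gap: a value within \<open>e\<close> of \<open>A x\<close> and a value
    within \<open>e\<close> of \<open>B x\<close> cannot coincide.\<close>
  define e where "e = \<bar>A x - B x\<bar> / 2"
  have e: "e > 0" using ne by (simp add: e_def)
  have "continuous_on S A" "continuous_on S B"
    unfolding A_def B_def by (intro smooth_on_continuous_on smooth_intros f)+
  then have "isCont A x" "isCont B x"
    using assms continuous_on_eq_continuous_at by blast+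
  then have "\<forall>\<^sub>F y in nhds x. dist (A y) (A x) < e \<and> dist (B y) (B x) < e \<and> y \<in> S"
    using e assms(1,2) unfolding isCont_def tendsto_at_iff_tendsto_nhds
    by (intro eventually_conj tendstoD) (auto intro: eventually_nhds_in_open)
  then obtain d where d: "d > 0" "\<And>y. dist y x < d \<Longrightarrow> dist (A y) (A x) < e \<and> dist (B y) (B x) < e \<and> y \<in> S"
    unfolding eventually_nhds_metric by auto
  \<comment> \<open>Keeps the whole parallelogram with sides \<open>s u\<close> and
    \<open>s w\<close> within \<open>d / 2\<close> of \<open>x\<close>; the summand 1 covers
    \<open>u = w = 0\<close>.\<close>
  define s where "s = d / (2 * (norm u + norm w + 1))"
  have N: "norm u + norm w + 1 > 0" by (smt (verit) norm_ge_zero)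
  have s: "s > 0" unfolding s_def using d(1) N by simp
  have near: "dist (x + a *\<^sub>R p + b *\<^sub>R q) x < d"
    if "0 \<le> a" "a \<le> s" "0 \<le> b" "b \<le> s" "norm p + norm q = norm u + norm w" for a b p q
  proof -
    have "dist (x + a *\<^sub>R p + b *\<^sub>R q) x \<le> a * norm p + b * norm q"
      using norm_triangle_ineq[of "a *\<^sub>R p" "b *\<^sub>R q"] that by (simp add: dist_norm add.assoc)
    also have "\<dots> \<le> s * norm p + s * norm q"
      using that by (intro add_mono mult_right_mono) auto
    also have "\<dots> = s * (norm u + norm w)" using that(5) by (metis distrib_left)
    also have "\<dots> \<le> s * (norm u + norm w + 1)" using s by (simp add: mult_left_mono)
    also have "\<dots> = d / 2" unfolding s_def using N by (simp add: field_simps)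
    finally show ?thesis using d(1) by linarith
  qed
  obtain a b where ab: "0 \<le> a" "a \<le> s" "0 \<le> b" "b \<le> s"
    "f (x + s *\<^sub>R u + s *\<^sub>R w) - f (x + s *\<^sub>R u) - f (x + s *\<^sub>R w) + f x
       = s\<^sup>2 * A (x + a *\<^sub>R u + b *\<^sub>R w)"
    unfolding A_def by (rule second_difference_mvt[OF s _ f, of x u w]) (use near d in auto)
  obtain a' b' where ab': "0 \<le> a'" "a' \<le> s" "0 \<le> b'" "b' \<le> s"
    "f (x + s *\<^sub>R w + s *\<^sub>R u) - f (x + s *\<^sub>R w) - f (x + s *\<^sub>R u) + f x
       = s\<^sup>2 * B (x + a' *\<^sub>R w + b' *\<^sub>R u)"
    unfolding B_def by (rule second_difference_mvt[OF s _ f, of x w u]) (use near d in \<open>auto simp: add.commute\<close>)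
  have "s\<^sup>2 * A (x + a *\<^sub>R u + b *\<^sub>R w) = s\<^sup>2 * B (x + a' *\<^sub>R w + b' *\<^sub>R u)"
    using ab(5) ab'(5) by (simp add: algebra_simps)
  then have "A (x + a *\<^sub>R u + b *\<^sub>R w) = B (x + a' *\<^sub>R w + b' *\<^sub>R u)"
    using s by simp
  moreover have "dist (A (x + a *\<^sub>R u + b *\<^sub>R w)) (A x) < e" "dist (B (x + a' *\<^sub>R w + b' *\<^sub>R u)) (B x) < e"
    using d(2) near ab ab' by (auto simp: add.commute)
  ultimately show False
    unfolding e_def dist_real_def by (smt (verit) field_sum_of_halves)
qed

lemma FD_inner_right:
  assumes "f differentiable (at x)"
  shows "FD (\<lambda>y. f y \<bullet> c) x v = FD f x v \<bullet> c"
  by (rule FD_eqI) (use assms[unfolded frechet_derivative_works] in \<open>auto intro!: derivative_eq_intros\<close>)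

lemma FD_symmetric:
  fixes f :: "'e::real_normed_vector \<Rightarrow> 'g::euclidean_space"
  assumes "open S" "x \<in> S" and f: "smooth_on f S"
  shows "FD (\<lambda>y. FD f y u) x w = FD (\<lambda>y. FD f y w) x u"
proof (rule euclidean_eqI)
  fix b :: 'g assume "b \<in> Basis"
  have fb: "smooth_on (\<lambda>y. f y \<bullet> b) S"
    by (intro smooth_intros f assms)
  have *: "FD (\<lambda>y. FD f y p) x q \<bullet> b = FD (\<lambda>y. FD (\<lambda>y. f y \<bullet> b) y p) x q" for p q
  proof -
    have "FD (\<lambda>y. FD f y p) x q \<bullet> b = FD (\<lambda>y. FD f y p \<bullet> b) x q"
      by (intro FD_inner_right[symmetric] smooth_on_differentiable[OF _ assms(2)] smooth_intros f)
    also have "\<dots> = FD (\<lambda>y. FD (\<lambda>y. f y \<bullet> b) y p) x q"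
      by (rule fun_cong[OF FD_cong_open[OF assms(1,2)]])
        (simp add: FD_inner_right smooth_on_differentiable[OF f])
    finally show ?thesis .
  qed
  show "FD (\<lambda>y. FD f y u) x w \<bullet> b = FD (\<lambda>y. FD f y w) x u \<bullet> b"
    unfolding * by (rule FD_symmetric_real[OF assms(1,2) fb])
qed

section \<open>Fields of linear maps\<close>

lemma linear_sum_Basis:
  fixes T :: "'e::euclidean_space \<Rightarrow> 'g::real_vector"
  assumes "linear T"
  shows "T u = (\<Sum>b\<in>Basis. (u \<bullet> b) *\<^sub>R T b)"
proof -
  have "T u = T (\<Sum>b\<in>Basis. (u \<bullet> b) *\<^sub>R b)"
    by (simp add: euclidean_representation)
  also have "\<dots> = (\<Sum>b\<in>Basis. (u \<bullet> b) *\<^sub>R T b)"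
    by (simp add: linear_sum[OF assms] linear_scale[OF assms])
  finally show ?thesis .
qed

text \<open>Leibniz rule for a linear map applied to a vector, both depending on the point.
  Expanding the vector in the basis first means that \<open>T\<close> has to be differentiated on
  basis vectors only.\<close>

lemma has_derivative_linear_field:
  fixes T :: "'z::real_normed_vector \<Rightarrow> 'e::euclidean_space \<Rightarrow> 'g::real_normed_vector"
  assumes "open S" "x \<in> S" and lin: "\<And>y. y \<in> S \<Longrightarrow> linear (T y)"
    and T: "\<And>b. b \<in> Basis \<Longrightarrow> (\<lambda>y. T y b) differentiable (at x)"
    and a: "(a has_derivative a') (at x)"
  shows "((\<lambda>y. T y (a y)) has_derivative (\<lambda>v. FD (\<lambda>y. T y (a x)) x v + T x (a' v))) (at x)"
proof -
  have eq: "(\<lambda>y. \<Sum>b\<in>Basis. (c y \<bullet> b) *\<^sub>R T y b) y = T y (c y)" if "y \<in> S" for y c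
    using linear_sum_Basis[OF lin[OF that], of "c y"] by simp
  have T': "((\<lambda>y. T y b) has_derivative FD (\<lambda>y. T y b) x) (at x)" if "b \<in> Basis" for b
    using T[OF that] by (simp add: frechet_derivative_works)
  \<comment> \<open>Used twice: for \<open>a\<close> itself, and for the constant field
    \<open>a x\<close>, which identifies the first summand of the claim.\<close>
  have gen: "((\<lambda>y. T y (c y)) has_derivative
      (\<lambda>v. \<Sum>b\<in>Basis. (c x \<bullet> b) *\<^sub>R FD (\<lambda>y. T y b) x v + (c' v \<bullet> b) *\<^sub>R T x b)) (at x)"
    if "(c has_derivative c') (at x)" for c c'
    by (rule has_derivative_transform_within_open[OF _ \<open>open S\<close> \<open>x \<in> S\<close> eq])
      (auto intro!: derivative_eq_intros T' that)
  have "FD (\<lambda>y. T y (a x)) x v = (\<Sum>b\<in>Basis. (a x \<bullet> b) *\<^sub>R FD (\<lambda>y. T y b) x v)" for v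
    by (subst FD_eqI[OF gen[of "\<lambda>_. a x" "\<lambda>_. 0"]]) (auto simp: has_derivative_const)
  moreover have "T x (a' v) = (\<Sum>b\<in>Basis. (a' v \<bullet> b) *\<^sub>R T x b)" for v
    by (rule linear_sum_Basis[OF lin[OF assms(2)]])
  ultimately show ?thesis
    using gen[OF a] by (simp add: sum.distrib)
qed

lemma FD_linear_field:
  fixes T :: "'z::real_normed_vector \<Rightarrow> 'e::euclidean_space \<Rightarrow> 'g::real_normed_vector"
  assumes "open S" "x \<in> S" "\<And>y. y \<in> S \<Longrightarrow> linear (T y)"
    and "\<And>b. b \<in> Basis \<Longrightarrow> smooth_on (\<lambda>y. T y b) S" "smooth_on a S"
  shows "FD (\<lambda>y. T y (a y)) x v = FD (\<lambda>y. T y (a x)) x v + T x (FD a x v)"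
  by (rule FD_eqI[OF has_derivative_linear_field[OF assms(1-3)]])
    (use assms in \<open>auto intro: smooth_on_differentiable smooth_on_has_derivative\<close>)

lemma smooth_on_linear_field:
  fixes T :: "'z::real_normed_vector \<Rightarrow> 'e::euclidean_space \<Rightarrow> 'g::real_normed_vector"
  assumes "open S" "\<And>y. y \<in> S \<Longrightarrow> linear (T y)"
    and "\<And>b. b \<in> Basis \<Longrightarrow> smooth_on (\<lambda>y. T y b) S" "smooth_on a S"
  shows "smooth_on (\<lambda>y. T y (a y)) S"
proof (rule smooth_on_cong[OF \<open>open S\<close>])
  show "smooth_on (\<lambda>y. \<Sum>b\<in>Basis. (a y \<bullet> b) *\<^sub>R T y b) S"
    by (intro smooth_intros assms)
  show "(\<Sum>b\<in>Basis. (a y \<bullet> b) *\<^sub>R T y b) = T y (a y)" if "y \<in> S" for y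
    using linear_sum_Basis[OF assms(2)[OF that], of "a y"] by simp
qed

lemma linear_FD_param:
  fixes T :: "'z::real_normed_vector \<Rightarrow> 'e::real_normed_vector \<Rightarrow> 'g::real_normed_vector"
  assumes "open S" "x \<in> S" "\<And>y. y \<in> S \<Longrightarrow> linear (T y)" "\<And>u. smooth_on (\<lambda>y. T y u) S"
  shows "linear (\<lambda>u. FD (\<lambda>y. T y u) x v)"
proof (rule linearI)
  have T: "((\<lambda>y. T y b) has_derivative FD (\<lambda>y. T y b) x) (at x)" for b
    by (rule smooth_on_has_derivative[OF assms(4,2)])
  fix u w r
  have "FD (\<lambda>y. T y (u + w)) x v = FD (\<lambda>y. T y u + T y w) x v"
    by (rule fun_cong[OF FD_cong_open[OF assms(1,2)]]) (simp add: linear_add[OF assms(3)])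
  also have "\<dots> = FD (\<lambda>y. T y u) x v + FD (\<lambda>y. T y w) x v"
    by (rule FD_eqI) (intro has_derivative_add T)
  finally show "FD (\<lambda>y. T y (u + w)) x v = FD (\<lambda>y. T y u) x v + FD (\<lambda>y. T y w) x v" .
  have "FD (\<lambda>y. T y (r *\<^sub>R u)) x v = FD (\<lambda>y. r *\<^sub>R T y u) x v"
    by (rule fun_cong[OF FD_cong_open[OF assms(1,2)]]) (simp add: linear_scale[OF assms(3)])
  also have "\<dots> = r *\<^sub>R FD (\<lambda>y. T y u) x v"
    by (rule FD_eqI) (intro has_derivative_scaleR_right T)
  finally show "FD (\<lambda>y. T y (r *\<^sub>R u)) x v = r *\<^sub>R FD (\<lambda>y. T y u) x v" .
qed

text \<open>The factor \<open>c\<close> is merely continuous; differentiability at \<open>x\<close>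
  survives because \<open>r\<close> vanishes there. This breaks the circle in differentiating an
  inverse, where the inverse itself occurs as a factor.\<close>

lemma has_derivative_scaleR_vanishing:
  fixes c :: "'z::real_normed_vector \<Rightarrow> real" and r :: "'z \<Rightarrow> 'g::real_normed_vector"
  assumes "isCont c x" "(r has_derivative r') (at x)" "r x = 0"
  shows "((\<lambda>y. c y *\<^sub>R r y) has_derivative (\<lambda>v. c x *\<^sub>R r' v)) (at x)"
proof -
  have bl: "bounded_linear r'"
    using assms(2) has_derivative_bounded_linear by blast
  obtain K where K: "\<And>v. norm (r' v) \<le> norm v * K"
    using bounded_linear.bounded[OF bl] by blast
  have lim: "((\<lambda>y. norm (r y - r' (y - x)) / norm (y - x)) \<longlongrightarrow> 0) (at x)"
    using assms(2) unfolding has_derivative_iff_norm assms(3) by simp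
  have c: "((\<lambda>y. norm (c y)) \<longlongrightarrow> norm (c x)) (at x)" "((\<lambda>y. \<bar>c y - c x\<bar> * K) \<longlongrightarrow> 0) (at x)"
    using assms(1) by (auto simp: isCont_def intro!: tendsto_eq_intros)
  have "((\<lambda>y. norm (c y) * (norm (r y - r' (y - x)) / norm (y - x)) + \<bar>c y - c x\<bar> * K) \<longlongrightarrow> 0) (at x)"
    using tendsto_add[OF tendsto_mult[OF c(1) lim] c(2)] by simp
  moreover have "norm (c y *\<^sub>R r y - c x *\<^sub>R r x - c x *\<^sub>R r' (y - x)) / norm (y - x)
      \<le> norm (c y) * (norm (r y - r' (y - x)) / norm (y - x)) + \<bar>c y - c x\<bar> * K" if "y \<noteq> x" for y
  proof -
    have "c y *\<^sub>R r y - c x *\<^sub>R r x - c x *\<^sub>R r' (y - x)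
        = c y *\<^sub>R (r y - r' (y - x)) + (c y - c x) *\<^sub>R r' (y - x)"
      by (simp add: assms(3) algebra_simps)
    then have "norm (c y *\<^sub>R r y - c x *\<^sub>R r x - c x *\<^sub>R r' (y - x))
        \<le> norm (c y) * norm (r y - r' (y - x)) + \<bar>c y - c x\<bar> * norm (r' (y - x))"
      using norm_triangle_ineq by (metis norm_scaleR real_norm_def)
    also have "\<dots> \<le> norm (c y) * norm (r y - r' (y - x)) + \<bar>c y - c x\<bar> * (norm (y - x) * K)"
      using K by (intro add_left_mono mult_left_mono) auto
    finally show ?thesis
      using that divide_right_mono[of _ _ "norm (y - x)"] by (fastforce simp: add_divide_distrib)
  qed
  ultimately have "((\<lambda>y. norm (c y *\<^sub>R r y - c x *\<^sub>R r x - c x *\<^sub>R r' (y - x)) / norm (y - x)) \<longlongrightarrow> 0) (at x)"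
    by - (rule tendsto_sandwich[OF _ _ tendsto_const], auto simp: eventually_at_filter)
  then show ?thesis
    unfolding has_derivative_iff_norm
    using bounded_linear_compose[OF bounded_linear_scaleR_right bl] by simp
qed

section \<open>Inverses of smoothly varying positive definite maps\<close>

lemma pos_def_inv:
  fixes A :: "'e::euclidean_space \<Rightarrow> 'e"
  assumes "linear A" "\<And>w. w \<noteq> 0 \<Longrightarrow> A w \<bullet> w > 0"
  shows pos_def_inj: "inj A" and pos_def_right_inv: "A (inv A l) = l"
    and pos_def_left_inv: "inv A (A w) = w" and pos_def_inv_linear: "linear (inv A)"
proof -
  show inj: "inj A"
    unfolding linear_injective_0[OF assms(1)] using assms(2) by force
  then have "surj A"
    using assms(1) linear_injective_imp_surjective by blast
  then show "A (inv A l) = l"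
    by (rule surj_f_inv_f)
  show "inv A (A w) = w"
    using inj by simp
  show "linear (inv A)"
    by (rule inj_linear_imp_inv_linear[OF assms(1) inj])
qed

text \<open>With \<open>h z = inv (A z) l\<close>, the identity
  \<open>A z0 (h z0 - h z) = A z (h z) - A z0 (h z)\<close> writes \<open>h\<close> as a constant
  minus \<open>inv (A z0)\<close> of products of components of \<open>h\<close> with factors
  vanishing at \<open>z0\<close>. Continuity of \<open>h\<close> is thus enough, and has to come
  first.\<close>

lemma has_derivative_inv_field:
  fixes A :: "'z::real_normed_vector \<Rightarrow> 'e::euclidean_space \<Rightarrow> 'e"
  assumes "open S" "z0 \<in> S" and lin: "\<And>z. z \<in> S \<Longrightarrow> linear (A z)"
    and pos: "\<And>z w. z \<in> S \<Longrightarrow> w \<noteq> 0 \<Longrightarrow> A z w \<bullet> w > 0"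
    and diff: "\<And>b. b \<in> Basis \<Longrightarrow> (\<lambda>z. A z b) differentiable (at z0)"
  shows "((\<lambda>z. inv (A z) l) has_derivative
    (\<lambda>v. - inv (A z0) (\<Sum>b\<in>Basis. (inv (A z0) l \<bullet> b) *\<^sub>R FD (\<lambda>z. A z b) z0 v))) (at z0)"
proof -
  note inv = pos_def_inv[OF lin pos]
  define h where "h = (\<lambda>z. inv (A z) l)"
  have Ah: "A z (h z) = l" if "z \<in> S" for z
    unfolding h_def by (rule inv(2)[OF that that])
  define \<delta> where "\<delta> = (\<lambda>z. \<Sum>b\<in>Basis. norm (A z b - A z0 b))"
  have \<delta>0: "\<delta> \<midarrow>z0\<rightarrow> 0"
  proof -
    have "(\<lambda>z. A z b) \<midarrow>z0\<rightarrow> A z0 b" if "b \<in> Basis" for b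
      using differentiable_imp_continuous_within[OF diff[OF that]] by (simp add: isCont_def continuous_within)
    then have "(\<lambda>z. \<Sum>b\<in>Basis. norm (A z b - A z0 b)) \<midarrow>z0\<rightarrow> (\<Sum>b\<in>Basis. norm (A z0 b - A z0 b))"
      by (intro tendsto_intros) auto
    then show ?thesis by (simp add: \<delta>_def)
  qed
  have bound: "norm (A z w - A z0 w) \<le> \<delta> z * norm w" if "z \<in> S" for z w
  proof -
    have "A z w - A z0 w = (\<Sum>b\<in>Basis. (w \<bullet> b) *\<^sub>R (A z b - A z0 b))"
      using linear_sum_Basis[OF lin[OF that], of w] linear_sum_Basis[OF lin[OF \<open>z0 \<in> S\<close>], of w]
      by (simp add: sum_subtractf scaleR_diff_right)
    also have "norm \<dots> \<le> (\<Sum>b\<in>Basis. norm w * norm (A z b - A z0 b))"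
      by (rule sum_norm_le) (auto intro!: mult_right_mono Basis_le_norm)
    finally show ?thesis by (simp add: \<delta>_def sum_distrib_left sum_distrib_right mult_ac)
  qed
  \<comment> \<open>While \<delta> is below \<open>c / 2\<close>, the map \<open>A z\<close> is
    still bounded below by \<open>c / 2\<close>; this bounds \<open>h\<close> near
    \<open>z0\<close>, and a second use of \<open>c\<close> gives continuity.\<close>
  obtain c where c: "c > 0" "\<And>w. norm (A z0 w) \<ge> c * norm w"
    using linear_inj_bounded_below_pos[OF lin[OF assms(2)] inv(1)[OF assms(2) assms(2)]] 
    by (metis mult.commute)
  have ev: "\<forall>\<^sub>F z in at z0. z \<in> S \<and> \<delta> z < c / 2"
    using order_tendstoD(2)[OF \<delta>0, of "c / 2"] c(1) assms(1,2)
    by (auto intro!: eventually_conj eventually_at_in_open')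
  have close: "norm (h z - h z0) \<le> \<delta> z * (2 * norm l / c) / c" if z: "z \<in> S" "\<delta> z < c / 2" for z
  proof -
    have "c * norm (h z) \<le> norm (A z0 (h z))" by (rule c)
    also have "\<dots> \<le> norm (A z (h z)) + norm (A z (h z) - A z0 (h z))"
      by (metis norm_minus_commute norm_triangle_sub)
    also have "\<dots> \<le> norm l + c / 2 * norm (h z)"
      using bound[OF z(1), of "h z"] z(2) mult_right_mono[of "\<delta> z" "c/2" "norm (h z)"] Ah[OF z(1)] by simp
    finally have hz: "norm (h z) \<le> 2 * norm l / c"
      using c(1) by (simp add: field_simps)
    have "c * norm (h z - h z0) \<le> norm (A z0 (h z - h z0))" by (rule c)
    also have "A z0 (h z - h z0) = A z0 (h z) - A z (h z)"
      using Ah z(1) assms(2) by (simp add: linear_diff[OF lin[OF assms(2)]])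
    also have "norm \<dots> \<le> \<delta> z * norm (h z)"
      using bound[OF z(1)] by (simp add: norm_minus_commute)
    also have "\<dots> \<le> \<delta> z * (2 * norm l / c)"
      using hz by (intro mult_left_mono) (auto simp: \<delta>_def sum_nonneg)
    finally show ?thesis using c(1) by (simp add: field_simps)
  qed
  have "(\<lambda>z. \<delta> z * (2 * norm l / c) / c) \<midarrow>z0\<rightarrow> 0 * (2 * norm l / c) / c"
    by (intro tendsto_intros \<delta>0) (use c in auto)
  then have lim: "(\<lambda>z. \<delta> z * (2 * norm l / c) / c) \<midarrow>z0\<rightarrow> 0" by simp
  have "(\<lambda>z. norm (h z - h z0)) \<midarrow>z0\<rightarrow> 0"
    by (rule tendsto_sandwich[OF _ _ tendsto_const lim])
      (use close in \<open>auto intro!: eventually_mono[OF ev]\<close>)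
  then have "isCont h z0"
    by (simp add: isCont_def Lim_null[of h] tendsto_norm_zero_iff)
  then have hb: "isCont (\<lambda>z. h z \<bullet> b) z0" for b
    by (intro continuous_intros)
  have D: "((\<lambda>z. (h z \<bullet> b) *\<^sub>R (A z b - A z0 b)) has_derivative
      (\<lambda>v. (h z0 \<bullet> b) *\<^sub>R FD (\<lambda>z. A z b) z0 v)) (at z0)" if "b \<in> Basis" for b
    by (rule has_derivative_scaleR_vanishing[OF hb])
      (use diff[OF that] in \<open>auto simp: frechet_derivative_works intro!: derivative_eq_intros\<close>)
  have bl: "bounded_linear (inv (A z0))"
    using inv(4)[OF assms(2) assms(2)] linear_conv_bounded_linear by blast
  have "((\<lambda>z. h z0 - inv (A z0) (\<Sum>b\<in>Basis. (h z \<bullet> b) *\<^sub>R (A z b - A z0 b))) has_derivative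
      (\<lambda>v. 0 - inv (A z0) (\<Sum>b\<in>Basis. (h z0 \<bullet> b) *\<^sub>R FD (\<lambda>z. A z b) z0 v))) (at z0)"
    by (intro has_derivative_diff has_derivative_const bounded_linear.has_derivative[OF bl]
        has_derivative_sum D)
  moreover have "h z0 - inv (A z0) (\<Sum>b\<in>Basis. (h z \<bullet> b) *\<^sub>R (A z b - A z0 b)) = h z" if "z \<in> S" for z
  proof -
    have "(\<Sum>b\<in>Basis. (h z \<bullet> b) *\<^sub>R (A z b - A z0 b)) = A z (h z) - A z0 (h z)"
      using linear_sum_Basis[OF lin[OF that], of "h z"] linear_sum_Basis[OF lin[OF \<open>z0 \<in> S\<close>], of "h z"]
      by (simp add: sum_subtractf scaleR_diff_right)
    also have "\<dots> = A z0 (h z0 - h z)"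
      using Ah that assms(2) by (simp add: linear_diff[OF lin[OF assms(2)]])
    finally show ?thesis using inv(3)[OF assms(2) assms(2)] by simp
  qed
  ultimately have "(h has_derivative
      (\<lambda>v. 0 - inv (A z0) (\<Sum>b\<in>Basis. (h z0 \<bullet> b) *\<^sub>R FD (\<lambda>z. A z b) z0 v))) (at z0)"
    by (rule has_derivative_transform_within_open[OF _ assms(1,2)])
  then show ?thesis by (simp add: h_def)
qed

text \<open>The derivative of the inverse is expressed through the inverse, so induction on the
  order closes; \<open>l\<close> is generalized because the inverse is then applied to other
  vectors.\<close>

lemma smooth_on_inv_field:
  fixes A :: "'z::real_normed_vector \<Rightarrow> 'e::euclidean_space \<Rightarrow> 'e"
  assumes "open S" and lin: "\<And>z. z \<in> S \<Longrightarrow> linear (A z)"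
    and pos: "\<And>z w. z \<in> S \<Longrightarrow> w \<noteq> 0 \<Longrightarrow> A z w \<bullet> w > 0"
    and smooth: "\<And>b. b \<in> Basis \<Longrightarrow> smooth_on (\<lambda>z. A z b) S"
  shows "smooth_on (\<lambda>z. inv (A z) l) S"
  unfolding smooth_on_def
proof
  note D = has_derivative_inv_field[OF assms(1) _ lin pos smooth_on_differentiable[OF smooth]]
  show "Ck_on k (\<lambda>z. inv (A z) l) S" for k
  proof (induction k arbitrary: l)
    case 0
    have "continuous (at z) (\<lambda>z. inv (A z) l)" if "z \<in> S" for z
      by (rule has_derivative_continuous[OF D]) (use that in auto)
    then show ?case by (simp add: continuous_at_imp_continuous_on)
  next
    case (Suc k)
    show ?case
    proof (rule Ck_onI[OF assms(1) D])
      fix v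
      let ?a = "\<lambda>z. - (\<Sum>b\<in>Basis. (inv (A z) l \<bullet> b) *\<^sub>R FD (\<lambda>z. A z b) z v)"
      have sm: "Ck_on k f S \<Longrightarrow> Ck_on k g S \<Longrightarrow> Ck_on k (\<lambda>z. f z + g z) S" for f g :: "'z \<Rightarrow> 'e"
        by (rule Ck_on_add[OF assms(1)])
      have sum: "Ck_on k (\<lambda>z. \<Sum>b\<in>B. f b z) S" if "\<And>b. b \<in> B \<Longrightarrow> Ck_on k (f b) S"
        for f :: "'e \<Rightarrow> 'z \<Rightarrow> 'e" and B
        using that by (induction B rule: infinite_finite_induct) (auto intro: sm Ck_on_const assms(1))
      have inn: "Ck_on k (\<lambda>z. f z \<bullet> b) S" if "Ck_on k f S" for f :: "'z \<Rightarrow> 'e" and b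
        by (rule Ck_on_bounded_linear_comp[OF assms(1) bounded_linear_inner_left that])
      have "Ck_on k ?a S"
        by (intro Ck_on_bounded_linear_comp[OF assms(1) bounded_linear_minus[OF bounded_linear_ident]]
            sum Ck_on_bilinear[OF assms(1) bounded_bilinear_scaleR] inn Suc.IH)
          (use smooth_on_FD[OF smooth] in \<open>auto simp: smooth_on_def\<close>)
      \<comment> \<open>The argument of the inverse varies with \<open>z\<close>; expanding it in
        the basis reduces to the induction hypothesis for fixed vectors.\<close>
      then have "Ck_on k (\<lambda>z. \<Sum>c\<in>Basis. (?a z \<bullet> c) *\<^sub>R inv (A z) c) S"
        by (intro sum Ck_on_bilinear[OF assms(1) bounded_bilinear_scaleR] inn Suc.IH)
      then show "Ck_on k (\<lambda>z. - inv (A z) (\<Sum>b\<in>Basis. (inv (A z) l \<bullet> b) *\<^sub>R FD (\<lambda>z. A z b) z v)) S"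
      proof (rule Ck_on_cong[OF assms(1), rotated])
        fix z assume z: "z \<in> S"
        note L = pos_def_inv_linear[OF lin[OF z] pos[OF z]]
        show "(\<Sum>c\<in>Basis. (?a z \<bullet> c) *\<^sub>R inv (A z) c)
            = - inv (A z) (\<Sum>b\<in>Basis. (inv (A z) l \<bullet> b) *\<^sub>R FD (\<lambda>z. A z b) z v)"
          using linear_sum_Basis[OF L, of "?a z"] linear_neg[OF L] by simp
      qed
    qed auto
  qed
qed


section \<open>The strong maximum principle\<close>

lemma bilinear_simps:
  assumes "bilinear B"
  shows "B (u + v) w = B u w + B v w" "B w (u + v) = B w u + B w v"
    "B (u - v) w = B u w - B v w" "B w (u - v) = B w u - B w v"
    "B (r *\<^sub>R u) w = r *\<^sub>R B u w" "B w (r *\<^sub>R u) = r *\<^sub>R B w u"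
    "B (- u) w = - B u w" "B w (- u) = - B w u" "B 0 w = 0" "B w 0 = 0"
  using assms by (simp_all add: bilinear_ladd bilinear_radd bilinear_lsub bilinear_rsub
      bilinear_lmul bilinear_rmul bilinear_lneg bilinear_rneg bilinear_lzero bilinear_rzero)

text \<open>The proof removes one basis vector after the other from the support of \<open>B\<close> by Lagrange's
  reduction of a quadratic form to a sum of squares.\<close>

lemma psd_trace_nonneg:
  fixes B H :: "'e::euclidean_space \<Rightarrow> 'e \<Rightarrow> real"
  assumes "bilinear B" "\<And>u w. B u w = B w u" "\<And>u. B u u \<ge> 0"
    and H: "bilinear H" "\<And>u. H u u \<ge> 0"
  shows "(\<Sum>b\<in>Basis. \<Sum>c\<in>Basis. B b c * H b c) \<ge> 0"
proof -
  have "(\<Sum>b\<in>Basis. \<Sum>c\<in>Basis. B b c * H b c) \<ge> 0"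
    if "finite S" "bilinear B" "\<And>u w. B u w = B w u" "\<And>u. B u u \<ge> 0"
      "\<And>b u. b \<in> Basis - S \<Longrightarrow> B b u = 0" for B S
    using that
  proof (induction S arbitrary: B rule: finite_induct)
    case empty
    then show ?case by simp
  next
    case (insert s S)
    note bs = bilinear_simps[OF insert.prems(1)]
    have CS: "0 \<le> B u u - 2 * t * B s u + t\<^sup>2 * B s s" for u t
      using insert.prems(3)[of "u - t *\<^sub>R s"] insert.prems(2)[of u s]
      by (simp add: bs algebra_simps power2_eq_square)
    show ?case
    proof (cases "B s s = 0")
      case True
      \<comment> \<open>If \<open>B s s = 0\<close>, the form on the line \<open>u - t s\<close> is
        affine in \<open>t\<close>, so nonnegativity forces the slope to vanish; the
        \<open>t\<close> chosen would give the value -1.\<close>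
      have "B s u = 0" for u
      proof (rule ccontr)
        assume "B s u \<noteq> 0"
        then show False using CS[of u "(B u u + 1) / (2 * B s u)"] True by simp
      qed
      then have "B b u = 0" if "b \<in> Basis - S" for b u
        using insert.prems(4) that by (cases "b = s") auto
      then show ?thesis using insert.IH[OF insert.prems(1-3)] by blast
    next
      case False
      then have pos: "B s s > 0" using insert.prems(3)[of s] by simp
      \<comment> \<open>Completing the square in direction \<open>s\<close>: \<open>B'\<close> no
        longer has \<open>s\<close> in its support, and the removed square contributes
        \<open>H w w / B s s\<close> to the trace, where \<open>w\<close> represents
        \<open>B s\<close>.\<close>
      define B' where "B' = (\<lambda>u w. B u w - B s u * B s w / B s s)"
      define w where "w = (\<Sum>b\<in>Basis. B s b *\<^sub>R b)"
      have "0 \<le> (\<Sum>b\<in>Basis. \<Sum>c\<in>Basis. B' b c * H b c)"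
      proof (rule insert.IH)
        show "bilinear B'"
          unfolding bilinear_def B'_def
          by (auto intro!: linearI simp: bs algebra_simps add_divide_distrib)
        show "B' u w = B' w u" for u w
          using insert.prems(2)[of u w] by (simp add: B'_def)
        show "0 \<le> B' u u" for u
          using CS[of u "B s u / B s s"] pos by (simp add: B'_def power2_eq_square field_simps)
        show "B' b u = 0" if "b \<in> Basis - S" for b u
        proof (cases "b = s")
          case True
          then show ?thesis using pos by (simp add: B'_def)
        next
          case False
          then show ?thesis using that insert.prems(4)[of b] insert.prems(2)[of s b]
            by (simp add: B'_def)
        qed
      qed
      also have "\<dots> = (\<Sum>b\<in>Basis. \<Sum>c\<in>Basis. B b c * H b c) - H w w / B s s"
      proof -
        have "H w w = (\<Sum>b\<in>Basis. \<Sum>c\<in>Basis. B s b * B s c * H b c)"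
          unfolding w_def bilinear_sum[OF H(1)]
          by (simp add: sum.cartesian_product bilinear_simps[OF H(1)] mult_ac)
        then show ?thesis
          by (simp add: B'_def left_diff_distrib sum_subtractf sum_divide_distrib)
      qed
      finally show ?thesis
        using H(2)[of w] pos by (smt (verit) divide_nonneg_pos)
    qed
  qed
  from this[of Basis B] assms show ?thesis by auto
qed

text \<open>Restriction to the line through \<open>x\<close> in direction \<open>v\<close>. If the
  second derivative were positive, the first would be positive just after 0, and the mean value
  theorem would produce a larger value.\<close>

lemma second_derivative_at_max:
  fixes \<phi> :: "'e::real_normed_vector \<Rightarrow> real"
  assumes "open S" "x \<in> S" "\<And>y. y \<in> S \<Longrightarrow> (\<phi> has_derivative \<phi>' y) (at y)"
    and "((\<lambda>y. \<phi>' y v) has_derivative D2) (at x)" "\<And>y. y \<in> S \<Longrightarrow> \<phi> y \<le> \<phi> x"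
  shows "\<phi>' x v = 0" "D2 v \<le> 0"
proof -
  have "\<forall>\<^sub>F t in nhds 0. x + t *\<^sub>R v \<in> S"
  proof -
    have "((\<lambda>t. x + t *\<^sub>R v) \<longlongrightarrow> x + 0 *\<^sub>R v) (nhds 0)"
      by (intro tendsto_intros) (auto simp: filterlim_ident)
    then show ?thesis using assms(1,2) by (auto intro: topological_tendstoD)
  qed
  then obtain d where d: "d > 0" "\<And>t. \<bar>t\<bar> < d \<Longrightarrow> x + t *\<^sub>R v \<in> S"
    unfolding eventually_nhds_metric by (auto simp: dist_real_def)
  define p where "p = (\<lambda>t. \<phi> (x + t *\<^sub>R v))"
  define q where "q = (\<lambda>t. \<phi>' (x + t *\<^sub>R v) v)"
  have p: "(p has_real_derivative q t) (at t)" if "\<bar>t\<bar> < d" for t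
    unfolding p_def q_def by (intro has_derivative_line_real assms(3) d(2) that)
  have max: "p t \<le> p 0" if "\<bar>t\<bar> < d" for t
    using assms(5)[OF d(2)[OF that]] by (simp add: p_def)
  have "q 0 = 0"
    by (rule DERIV_local_max[OF p d(1)]) (use max d(1) in auto)
  then show "\<phi>' x v = 0" by (simp add: q_def)
  show "D2 v \<le> 0"
  proof (rule ccontr)
    assume "\<not> D2 v \<le> 0"
    moreover have "(q has_real_derivative D2 v) (at 0)"
      unfolding q_def by (rule has_derivative_line_real) (use assms(4) in simp)
    ultimately obtain e where e: "e > 0" "\<And>h. 0 < h \<Longrightarrow> h < e \<Longrightarrow> q 0 < q h"
      using DERIV_pos_inc_right[of q "D2 v" 0] by auto
    define s where "s = min d e / 2"
    have s: "0 < s" "s < d" "s < e" using d(1) e(1) by (auto simp: s_def)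
    obtain t where "0 < t" "t < s" "p s - p 0 = (s - 0) * q t"
      using MVT2[of 0 s p q] p s by auto
    moreover from this have "q t > 0" using e(2)[of t] s \<open>q 0 = 0\<close> by auto
    ultimately have "p s > p 0" using s by (simp add: algebra_simps)
    then show False using max[of s] s by simp
  qed
qed

text \<open>Minus the second derivative is positive semidefinite because it is so along every line
  through \<open>x\<close>; the trace of its product with the positive semidefinite \<open>H\<close>
  is then nonnegative.\<close>

lemma elliptic_at_max:
  fixes \<phi> :: "'e::euclidean_space \<Rightarrow> real" and H :: "'e \<Rightarrow> 'e"
  assumes S: "open S" "x \<in> S" "\<And>y. y \<in> S \<Longrightarrow> (\<phi> has_derivative \<phi>' y) (at y)"
    and D2: "\<And>b. b \<in> Basis \<Longrightarrow> ((\<lambda>y. \<phi>' y b) has_derivative D2 b) (at x)"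
    and max: "\<And>y. y \<in> S \<Longrightarrow> \<phi> y \<le> \<phi> x"
    and H: "linear H" "\<And>u w. H u \<bullet> w = u \<bullet> H w" "\<And>u. H u \<bullet> u \<ge> 0"
  shows "\<phi>' x v = 0" "(\<Sum>b\<in>Basis. D2 b (H b)) \<le> 0"
proof -
  have lin: "linear (\<phi>' y)" if "y \<in> S" for y
    using S(3)[OF that] has_derivative_linear by blast
  have linD2: "linear (D2 b)" if "b \<in> Basis" for b
    using D2[OF that] has_derivative_linear by blast
  have D: "((\<lambda>y. \<phi>' y u) has_derivative (\<lambda>w. \<Sum>b\<in>Basis. (u \<bullet> b) *\<^sub>R D2 b w)) (at x)" for u
  proof (rule has_derivative_transform_within_open[OF _ S(1,2)])
    show "((\<lambda>y. \<Sum>b\<in>Basis. (u \<bullet> b) *\<^sub>R \<phi>' y b) has_derivative (\<lambda>w. \<Sum>b\<in>Basis. (u \<bullet> b) *\<^sub>R D2 b w)) (at x)"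
      by (intro has_derivative_sum has_derivative_scaleR_right D2)
    show "(\<Sum>b\<in>Basis. (u \<bullet> b) *\<^sub>R \<phi>' y b) = \<phi>' y u" if "y \<in> S" for y
      using linear_sum_Basis[OF lin[OF that], of u] by simp
  qed
  note M = second_derivative_at_max[OF S D max]
  show "\<phi>' x v = 0" by (rule M(1))
  define Q where "Q = (\<lambda>u w. \<Sum>b\<in>Basis. (u \<bullet> b) *\<^sub>R D2 b w)"
  \<comment> \<open>\<open>psd_trace_nonneg\<close> wants a symmetric form, so \<open>Q\<close> is
    symmetrized; the trace against the symmetric \<open>H\<close> does not notice the
    difference.\<close>
  define B where "B = (\<lambda>u w. - (Q u w + Q w u) / 2)"
  have Q1: "linear (\<lambda>u. Q u w)" for w
    by (rule linearI) (simp_all add: Q_def inner_add_left algebra_simps sum.distrib sum_distrib_left)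
  have Q2: "linear (\<lambda>w. Q u w)" for u
    by (rule linearI) (simp_all add: Q_def algebra_simps sum.distrib sum_distrib_left
        linear_add[OF linD2] linear_scale[OF linD2])
  have "0 \<le> (\<Sum>b\<in>Basis. \<Sum>c\<in>Basis. B b c * (H b \<bullet> c))"
  proof (rule psd_trace_nonneg)
    show "bilinear B"
      unfolding bilinear_def B_def
      by (auto intro!: linearI simp: linear_add[OF Q1] linear_add[OF Q2] linear_scale[OF Q1]
          linear_scale[OF Q2] field_simps)
    show "bilinear (\<lambda>u w. H u \<bullet> w)"
      unfolding bilinear_def
      by (auto intro!: linearI simp: linear_add[OF H(1)] linear_scale[OF H(1)] inner_simps)
    show "0 \<le> B u u" for u
      using M(2)[of u] by (simp add: B_def Q_def)
  qed (auto simp: B_def H(3))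
  also have "\<dots> = - (\<Sum>b\<in>Basis. \<Sum>c\<in>Basis. Q b c * (H b \<bullet> c))"
  proof -
    have "(\<Sum>b\<in>Basis. \<Sum>c\<in>Basis. Q c b * (H b \<bullet> c)) = (\<Sum>b\<in>Basis. \<Sum>c\<in>Basis. Q b c * (H b \<bullet> c))"
      by (subst sum.swap, rule sum.cong[OF refl], rule sum.cong[OF refl]) (metis H(2) inner_commute)
    then show ?thesis
      by (simp add: B_def algebra_simps sum.distrib sum_negf diff_divide_distrib sum_subtractf 
          sum_divide_distrib[symmetric])
  qed
  also have "(\<Sum>b\<in>Basis. \<Sum>c\<in>Basis. Q b c * (H b \<bullet> c)) = (\<Sum>b\<in>Basis. D2 b (H b))"
  proof (rule sum.cong[OF refl])
    fix b :: 'e assume b: "b \<in> Basis"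
    have "Q b (H b) = (\<Sum>c\<in>Basis. if c = b then D2 b (H b) else 0)"
      unfolding Q_def by (rule sum.cong) (use b in \<open>auto simp: inner_Basis\<close>)
    then show "(\<Sum>c\<in>Basis. Q b c * (H b \<bullet> c)) = D2 b (H b)"
      using b linear_sum_Basis[OF Q2, of b "H b"] by (simp add: mult.commute)
  qed
  finally show "(\<Sum>b\<in>Basis. D2 b (H b)) \<le> 0" by simp
qed

text \<open>Equality case of the triangle inequality, in effect the parallelogram law. It shows that
  a ball internally tangent to another one meets its boundary only in the point of contact.\<close>

lemma norm_add_eq_double:
  fixes p q :: "'e::real_inner"
  assumes "norm p \<le> norm q" "norm (p + q) \<ge> 2 * norm q"
  shows "p = q"
proof -
  have "(2 * norm q)\<^sup>2 \<le> (norm (p + q))\<^sup>2"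
    by (rule power_mono) (use assms in auto)
  then have "4 * (q \<bullet> q) \<le> p \<bullet> p + 2 * (p \<bullet> q) + q \<bullet> q"
    by (simp add: power_mult_distrib power2_norm_eq_inner inner_simps inner_commute)
  moreover have "p \<bullet> p \<le> q \<bullet> q"
    using assms(1) by (simp add: norm_le)
  ultimately have "(p - q) \<bullet> (p - q) \<le> 0"
    by (simp add: inner_simps inner_commute)
  then show ?thesis
    by (metis eq_iff_diff_eq_0 inner_eq_zero_iff inner_ge_zero order_antisym)
qed

text \<open>Hopf's comparison argument: near a boundary point \<open>k\<close> of the set where the maximum is
  attained, adding a small multiple of \<open>exp (- \<alpha> |x - z|\<^sup>2) - exp (- \<alpha> r\<^sup>2)\<close> produces an interior
  maximum at which the operator is positive.\<close>

lemma strong_maximum_principle: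
  fixes h :: "'e::euclidean_space \<Rightarrow> real" and H :: "'e \<Rightarrow> 'e \<Rightarrow> 'e"
  assumes "open U" and h: "smooth_on h U"
    and H: "\<And>x. x \<in> U \<Longrightarrow> linear (H x)" "\<And>x u w. x \<in> U \<Longrightarrow> H x u \<bullet> w = u \<bullet> H x w"
      "\<And>x u. x \<in> U \<Longrightarrow> u \<noteq> 0 \<Longrightarrow> H x u \<bullet> u > 0"
      "\<And>b. b \<in> Basis \<Longrightarrow> continuous_on U (\<lambda>x. H x b)"
    and \<beta>: "continuous_on U \<beta>"
    and sub: "\<And>x. x \<in> U \<Longrightarrow> (\<Sum>b\<in>Basis. FD (\<lambda>y. FD h y b) x (H x b)) + FD h x (\<beta> x) \<ge> 0"
    and x0: "x0 \<in> U" and max: "\<And>x. x \<in> U \<Longrightarrow> h x \<le> h x0"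
  shows "\<exists>e>0. ball x0 e \<subseteq> U \<and> (\<forall>x\<in>ball x0 e. h x = h x0)"
proof -
  obtain R where R: "R > 0" "cball x0 R \<subseteq> U"
    using \<open>open U\<close> x0 open_contains_cball by blast
  have "h y = h x0" if y: "y \<in> ball x0 (R/2)" for y
  proof (rule ccontr)
    assume "h y \<noteq> h x0"
    \<comment> \<open>\<open>K\<close> is the set of maximum points near \<open>x0\<close>, and
      \<open>k\<close> its point nearest to \<open>y\<close>. The open ball of radius
      \<open>r0\<close> about \<open>y\<close> avoids \<open>K\<close>, and
      \<open>r0 < R / 2\<close> keeps it inside the ball of radius \<open>R\<close>.\<close>
    define K where "K = {x \<in> cball x0 R. h x = h x0}"
    have hc: "continuous_on U h" using h by (rule smooth_on_continuous_on)
    have "closed K"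
      unfolding K_def
      by (rule continuous_closed_preimage_constant) (use R hc continuous_on_subset in auto)
    moreover have "x0 \<in> K" using R by (simp add: K_def)
    ultimately obtain k where k: "k \<in> K" "\<And>x. x \<in> K \<Longrightarrow> dist y k \<le> dist y x"
      using distance_attains_inf[of K y] by auto
    define r0 where "r0 = dist y k"
    have "y \<noteq> k" using k(1) \<open>h y \<noteq> h x0\<close> by (auto simp: K_def)
    then have r0: "r0 > 0" by (simp add: r0_def)
    have r0R: "r0 < R / 2"
      using k(2)[OF \<open>x0 \<in> K\<close>] y by (simp add: r0_def dist_commute)
    have kR: "dist x0 k < R"
      using r0R y dist_triangle[of x0 k y] by (simp add: r0_def)
    have less: "h x < h x0" if "dist y x < r0" for x
    proof -
      have "dist x0 x < R"
        using that y r0R dist_triangle[of x0 x y] by simp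
      moreover have "x \<notin> K" using k(2)[of x] that by (auto simp: r0_def)
      ultimately show ?thesis
        using max[of x] R by (auto simp: K_def less_le)
    qed
    \<comment> \<open>A ball of half the radius, tangent to the previous one at \<open>k\<close>
      from inside: even its closure meets the maximum set only in \<open>k\<close>.\<close>
    define z where "z = (1/2) *\<^sub>R (y + k)"
    define r where "r = r0 / 2"
    have r: "r > 0" using r0 by (simp add: r_def)
    have zk: "norm (k - z) = r" "z - y = k - z"
    proof -
      have "k - z = (1 - 1/2) *\<^sub>R k - (1/2) *\<^sub>R y"
        unfolding z_def scaleR_add_right scaleR_diff_left by simp
      then have "k - z = (1/2) *\<^sub>R (k - y)" by (simp add: scaleR_diff_right)
      then show "norm (k - z) = r" by (simp add: r_def r0_def dist_norm norm_minus_commute)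
      have "z + z = y + k" by (simp add: z_def scaleR_left.add[symmetric] scaleR_2[symmetric])
      then show "z - y = k - z" by (simp add: algebra_simps)
    qed
    have touch: "h x < h x0" if "norm (x - z) \<le> r" "x \<noteq> k" for x
    proof (rule less, rule ccontr)
      assume "\<not> dist y x < r0"
      then have "2 * norm (k - z) \<le> norm (x - y)"
        using zk(1) by (simp add: r_def dist_norm norm_minus_commute)
      also have "x - y = (x - z) + (k - z)" unfolding zk(2)[symmetric] by simp
      finally have "x - z = k - z" using that zk(1) by (intro norm_add_eq_double) auto
      then show False using that(2) by simp
    qed
    \<comment> \<open>The bound \<open>r / 2\<close> keeps the center \<open>z\<close> away from
      \<open>C\<close>, so that \<open>E\<close> below is positive there; the other bound keeps
      \<open>C\<close> inside \<open>U\<close>.\<close>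
    define \<rho> where "\<rho> = min (r / 2) ((R - dist x0 k) / 2)"
    have \<rho>: "\<rho> > 0" "\<rho> \<le> r / 2" "\<rho> < R - dist x0 k"
      using r kR by (auto simp: \<rho>_def min_def)
    define C where "C = cball k \<rho>"
    have CU: "C \<subseteq> U"
    proof
      fix x assume "x \<in> C"
      then have "dist x0 x \<le> R"
        using \<rho>(3) dist_triangle[of x0 x k] by (simp add: C_def)
      then show "x \<in> U" using R by auto
    qed
    have C: "compact C" "k \<in> C" using \<rho>(1) by (auto simp: C_def)
    have far: "x \<noteq> z" if "x \<in> C" for x
      using that zk(1) r \<rho>(2) by (auto simp: C_def dist_norm)
    have Hcont: "continuous_on C (\<lambda>x. H x b)" if "b \<in> Basis" for b
      using H(4)[OF that] CU continuous_on_subset by blast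
    define E where "E = (\<lambda>x. H x (x - z) \<bullet> (x - z))"
    have "continuous_on C (\<lambda>x. (\<Sum>b\<in>Basis. ((x - z) \<bullet> b) *\<^sub>R H x b) \<bullet> (x - z))"
      by (intro continuous_intros Hcont) auto
    then have Econt: "continuous_on C E"
      by (rule continuous_on_cong[THEN iffD1, rotated 2])
        (use CU in \<open>auto simp: E_def linear_sum_Basis[OF H(1), symmetric]\<close>)
    obtain xe where xe: "xe \<in> C" "\<And>x. x \<in> C \<Longrightarrow> E xe \<le> E x"
      using continuous_attains_inf[OF C(1) _ Econt] C(2) by auto
    define c0 where "c0 = E xe"
    have c0: "c0 > 0"
      using H(3)[of xe "xe - z"] far[OF xe(1)] xe(1) CU by (auto simp: c0_def E_def)
    define P where "P = (\<lambda>x. (\<Sum>b\<in>Basis. H x b \<bullet> b) + (x - z) \<bullet> \<beta> x)"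
    have "continuous_on C P"
      unfolding P_def by (intro continuous_intros Hcont continuous_on_subset[OF \<beta> CU])
    then obtain xp where xp: "xp \<in> C" "\<And>x. x \<in> C \<Longrightarrow> P x \<le> P xp"
      using continuous_attains_sup[OF C(1)] C(2) by (metis empty_iff)
    \<comment> \<open>The operator applied to \<open>v\<close> is \<open>ex\<close> times
      \<open>4 \<alpha>^2 E - 2 \<alpha> P\<close>; this choice makes it positive on all of
      \<open>C\<close>.\<close>
    define \<alpha> where "\<alpha> = (\<bar>P xp\<bar> + 1) / c0"
    have \<alpha>: "\<alpha> > 0" "\<alpha> * c0 = \<bar>P xp\<bar> + 1" using c0 by (auto simp: \<alpha>_def)
    define ex where "ex = (\<lambda>x. exp (- \<alpha> * ((x - z) \<bullet> (x - z))))"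
    define v where "v = (\<lambda>x. ex x - exp (- \<alpha> * r\<^sup>2))"
    have ex': "(ex has_derivative (\<lambda>w. ex x * (- 2 * \<alpha> * ((x - z) \<bullet> w)))) (at x)" for x
      unfolding ex_def by (auto intro!: derivative_eq_intros simp: inner_commute algebra_simps)
    have v': "(v has_derivative (\<lambda>w. ex x * (- 2 * \<alpha> * ((x - z) \<bullet> w)))) (at x)" for x
      unfolding v_def using ex'[of x] by (auto intro!: derivative_eq_intros)
    have v'': "((\<lambda>x. ex x * (- 2 * \<alpha> * ((x - z) \<bullet> b))) has_derivative
       (\<lambda>w. ex x * (4 * \<alpha>\<^sup>2 * ((x - z) \<bullet> b) * ((x - z) \<bullet> w) - 2 * \<alpha> * (b \<bullet> w)))) (at x)" for x b
      using ex'[of x]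
      by (auto intro!: derivative_eq_intros simp: inner_commute algebra_simps power2_eq_square)
    have v1: "v x \<le> 1" for x
    proof -
      have "ex x \<le> 1" unfolding ex_def using \<alpha> by (simp add: mult_nonneg_nonneg)
      then show ?thesis using exp_ge_zero[of "- \<alpha> * r\<^sup>2"] unfolding v_def by linarith
    qed
    have vk: "v k = 0"
      using zk(1) by (simp add: v_def ex_def power2_norm_eq_inner[symmetric])
    have vneg: "v x < 0" if "norm (x - z) > r" for x
    proof -
      have "r\<^sup>2 < (norm (x - z))\<^sup>2" using that r by (intro power_strict_mono) auto
      then show ?thesis using \<alpha>(1) by (simp add: v_def ex_def power2_norm_eq_inner)
    qed
    define T where "T = sphere k \<rho> \<inter> cball z r"
    have T: "compact T" "T \<subseteq> C" unfolding T_def C_def by (auto intro: compact_Int_closed)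
    \<comment> \<open>\<open>v\<close> is negative outside the closed ball about \<open>z\<close>.
      On the compact part \<open>T\<close> of the small sphere inside it, \<open>h\<close> stays
      below the maximum by some \<delta>, and as \<open>v \<le> 1\<close>, adding
      \<open>(\<delta> / 2) v\<close> cannot close this gap.\<close>
    obtain \<delta> where \<delta>: "\<delta> > 0" "\<And>x. x \<in> T \<Longrightarrow> h x \<le> h x0 - \<delta>"
    proof (cases "T = {}")
      case True
      then show ?thesis using that[of 1] by auto
    next
      case False
      obtain t where t: "t \<in> T" "\<And>x. x \<in> T \<Longrightarrow> h x \<le> h t"
        using continuous_attains_sup[OF T(1) False continuous_on_subset[OF hc subset_trans[OF T(2) CU]]]
        by metis
      have "h t < h x0"
        using touch[of t] t(1) \<rho>(1) by (auto simp: T_def dist_norm norm_minus_commute)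
      then show ?thesis using that[of "h x0 - h t"] t by auto
    qed
    define \<phi> where "\<phi> = (\<lambda>x. h x + (\<delta> / 2) * v x)"
    have hv: "h k = h x0" using k(1) by (simp add: K_def)
    have "continuous_on C \<phi>"
    proof -
      have "continuous_on C v"
        using has_derivative_continuous[OF v'] by (blast intro: continuous_at_imp_continuous_on)
      then show ?thesis
        unfolding \<phi>_def using continuous_on_subset[OF hc CU]
        by (intro continuous_on_add continuous_on_mult continuous_on_const)
    qed
    then obtain xs where xs: "xs \<in> C" "\<And>x. x \<in> C \<Longrightarrow> \<phi> x \<le> \<phi> xs"
      using continuous_attains_sup[OF C(1)] C(2) by (metis empty_iff)
    have "h x0 \<le> \<phi> xs" using xs(2)[OF C(2)] hv vk by (simp add: \<phi>_def)
    have sphere: "\<phi> x < h x0" if "x \<in> sphere k \<rho>" for x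
    proof (cases "x \<in> T")
      case True
      then have "\<phi> x \<le> h x0 - \<delta> + (\<delta> / 2) * 1"
        unfolding \<phi>_def using \<delta> v1[of x] by (intro add_mono mult_left_mono) auto
      then show ?thesis using \<delta>(1) by simp
    next
      case False
      then have "v x < 0"
        using that vneg[of x] by (auto simp: T_def dist_norm norm_minus_commute)
      then have "\<delta> / 2 * v x < 0" using \<delta>(1) by (simp add: mult_pos_neg)
      moreover have "h x \<le> h x0" using that CU max[of x] by (auto simp: C_def)
      ultimately show ?thesis by (simp add: \<phi>_def)
    qed
    \<comment> \<open>On the sphere \<phi> is below \<open>h x0\<close>, which is its value at
      \<open>k\<close>, so the maximum over \<open>C\<close> is attained in the interior.\<close>
    have xsb: "xs \<in> ball k \<rho>"
      using sphere[of xs] xs(1) \<open>h x0 \<le> \<phi> xs\<close> by (fastforce simp: C_def)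
    define \<phi>' where "\<phi>' = (\<lambda>x w. FD h x w + (\<delta> / 2) * (ex x * (- 2 * \<alpha> * ((x - z) \<bullet> w))))"
    define D2 where "D2 = (\<lambda>b w. FD (\<lambda>y. FD h y b) xs w
      + (\<delta> / 2) * (ex xs * (4 * \<alpha>\<^sup>2 * ((xs - z) \<bullet> b) * ((xs - z) \<bullet> w) - 2 * \<alpha> * (b \<bullet> w))))"
    have bU: "ball k \<rho> \<subseteq> U" using CU by (auto simp: C_def)
    then have xsU: "xs \<in> U" using xsb by auto
    have d1: "(\<phi> has_derivative \<phi>' y) (at y)" if "y \<in> ball k \<rho>" for y
      unfolding \<phi>_def \<phi>'_def
      by (intro has_derivative_add has_derivative_mult_right v' smooth_on_has_derivative[OF h])
        (use that bU in auto)
    have d2: "((\<lambda>y. \<phi>' y b) has_derivative D2 b) (at xs)" for b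
      unfolding \<phi>'_def D2_def
      by (intro has_derivative_add has_derivative_mult_right v''
          smooth_on_has_derivative[OF smooth_on_FD[OF h] xsU])
    have mx: "\<phi> y \<le> \<phi> xs" if "y \<in> ball k \<rho>" for y
      using xs(2) that by (auto simp: C_def)
    have Hnn: "H xs u \<bullet> u \<ge> 0" for u
      using H(3)[OF xsU, of u] by (cases "u = 0") auto
    have z1: "\<phi>' xs w = 0" for w
      by (rule elliptic_at_max(1)[OF open_ball xsb d1 d2 mx H(1)[OF xsU] H(2)[OF xsU] Hnn])
    have "(\<Sum>b\<in>Basis. D2 b (H xs b)) \<le> 0"
      by (rule elliptic_at_max(2)[OF open_ball xsb d1 d2 mx H(1)[OF xsU] H(2)[OF xsU] Hnn])
    then have "0 \<ge> (\<Sum>b\<in>Basis. D2 b (H xs b)) + \<phi>' xs (\<beta> xs)" using z1 by simp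
    also have "(\<Sum>b\<in>Basis. D2 b (H xs b)) + \<phi>' xs (\<beta> xs)
      = (\<Sum>b\<in>Basis. FD (\<lambda>y. FD h y b) xs (H xs b)) + FD h xs (\<beta> xs)
        + (\<delta> / 2) * ex xs * (4 * \<alpha>\<^sup>2 * E xs - 2 * \<alpha> * P xs)"
    proof -
      define q where "q = xs - z"
      have E: "E xs = (\<Sum>b\<in>Basis. (q \<bullet> b) * (q \<bullet> H xs b))"
        unfolding E_def q_def[symmetric]
        by (subst linear_sum_Basis[OF H(1)[OF xsU], of q])
          (simp add: inner_sum_left inner_sum_right inner_commute)
      have P: "P xs = (\<Sum>b\<in>Basis. b \<bullet> H xs b) + q \<bullet> \<beta> xs"
        by (simp add: P_def q_def inner_commute)
      have "(\<Sum>b\<in>Basis. D2 b (H xs b)) = (\<Sum>b\<in>Basis. FD (\<lambda>y. FD h y b) xs (H xs b))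
         + (\<delta> / 2) * ex xs * (4 * \<alpha>\<^sup>2 * E xs - 2 * \<alpha> * (\<Sum>b\<in>Basis. b \<bullet> H xs b))"
        unfolding D2_def q_def[symmetric] E
        by (simp add: sum.distrib sum_distrib_left sum_subtractf right_diff_distrib mult_ac)
      then show ?thesis
        unfolding \<phi>'_def q_def[symmetric] P by (simp add: algebra_simps)
    qed
    also have "\<dots> \<ge> (\<delta> / 2) * ex xs * (4 * \<alpha>\<^sup>2 * E xs - 2 * \<alpha> * P xs)"
      using sub[OF xsU] by simp
    finally have le: "(\<delta> / 2) * ex xs * (4 * \<alpha>\<^sup>2 * E xs - 2 * \<alpha> * P xs) \<le> 0" .
    have "\<alpha> * E xs \<ge> \<alpha> * c0"
      using xe(2)[OF xs(1)] \<alpha>(1) by (simp add: c0_def)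
    then have "2 * (\<alpha> * E xs) - P xs > 0"
      using \<alpha>(2) xp(2)[OF xs(1)] by linarith
    then have "2 * \<alpha> * (2 * (\<alpha> * E xs) - P xs) > 0" using \<alpha>(1) by simp
    then have "4 * \<alpha>\<^sup>2 * E xs - 2 * \<alpha> * P xs > 0" by (simp add: algebra_simps power2_eq_square)
    then have "(\<delta> / 2) * ex xs * (4 * \<alpha>\<^sup>2 * E xs - 2 * \<alpha> * P xs) > 0"
      using \<delta>(1) by (simp add: ex_def)
    with le show False by simp
  qed
  moreover have "ball x0 (R/2) \<subseteq> cball x0 R"
    using R(1) by auto
  then have "ball x0 (R/2) \<subseteq> U"
    using R(2) by (rule order_trans)
  moreover have "R / 2 > 0" using R(1) by simp
  ultimately show ?thesis by blast
qed

section \<open>Riemannian metrics in a chart\<close>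

text \<open>The metric is required to be an inner product at all points, including those outside \<open>U\<close>,
  so that its linear algebra needs no side conditions.\<close>

locale riem_chart =
  fixes U :: "'e::euclidean_space set" and g :: "'e \<Rightarrow> 'e \<Rightarrow> 'e \<Rightarrow> real"
  assumes open_U: "open U"
    and bil: "bilinear (g x)"
    and sym: "g x u w = g x w u"
    and pos: "u \<noteq> 0 \<Longrightarrow> g x u u > 0"
    and smooth_g: "smooth_on (\<lambda>x. g x u w) U"
begin

lemmas g_simps = bilinear_simps[OF bil]

lemma linear_g1: "linear (\<lambda>u. g x u w)" and linear_g2: "linear (\<lambda>w. g x u w)"
  using bil by (auto simp: bilinear_def)

lemma g_nonneg: "g x u u \<ge> 0"
  using pos[of u x] by (cases "u = 0") (auto simp: g_simps less_imp_le)

lemma g_eqI: "(\<And>w. g x a w = g x b w) \<Longrightarrow> a = b"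
proof (rule ccontr)
  assume "\<And>w. g x a w = g x b w" "a \<noteq> b"
  then show False using pos[of "a - b" x] by (simp add: g_simps)
qed

section \<open>Lowering and raising indices\<close>

definition flat :: "'e \<Rightarrow> 'e \<Rightarrow> 'e" where
  "flat x u = (\<Sum>b\<in>Basis. g x u b *\<^sub>R b)"

text \<open>The vector \<open>a\<close> stands for the covector
  \<open>w \<mapsto> a \<bullet> w\<close>. So \<open>sharp x b\<close> for basis vectors
  \<open>b\<close> are the columns of the inverse metric, and
  \<open>\<Sum>b\<in>Basis. T b (sharp x b)\<close> is the metric trace of \<open>T\<close>.\<close>

definition sharp :: "'e \<Rightarrow> 'e \<Rightarrow> 'e" where
  "sharp x = inv (flat x)"

lemma flat_inner: "flat x u \<bullet> w = g x u w"
  using linear_sum_Basis[OF linear_g2, of x u w]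
  by (simp add: flat_def inner_sum_left inner_sum_right inner_commute mult.commute)

lemma linear_flat: "linear (flat x)"
  by (rule linearI) (simp_all add: flat_def g_simps scaleR_add_left sum.distrib scaleR_sum_right)

lemma flat_pos: "u \<noteq> 0 \<Longrightarrow> flat x u \<bullet> u > 0"
  by (simp add: flat_inner pos)

lemma linear_sharp: "linear (sharp x)"
  unfolding sharp_def by (rule pos_def_inv_linear[OF linear_flat flat_pos])

lemma g_sharp [simp]: "g x (sharp x a) w = a \<bullet> w"
  using pos_def_right_inv[OF linear_flat flat_pos, of x a] by (metis flat_inner sharp_def)

lemma g_sharp' [simp]: "g x w (sharp x a) = a \<bullet> w"
  by (simp add: sym[of x w])

lemma sharp_sym: "sharp x a \<bullet> b = a \<bullet> sharp x b"
  by (metis g_sharp g_sharp' inner_commute)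

lemma sharp_pos: "a \<noteq> 0 \<Longrightarrow> sharp x a \<bullet> a > 0"
proof -
  assume "a \<noteq> 0"
  then have "sharp x a \<noteq> 0" by (metis g_sharp g_simps(9) inner_eq_zero_iff)
  then show ?thesis using pos[of "sharp x a" x] by (simp add: inner_commute)
qed

lemma smooth_sharp: "smooth_on (\<lambda>x. sharp x a) U"
  unfolding sharp_def
  by (rule smooth_on_inv_field[OF open_U linear_flat flat_pos])
    (auto simp: flat_def intro!: smooth_intros open_U smooth_g)

section \<open>The Levi-Civita connection\<close>

definition dg :: "'e \<Rightarrow> 'e \<Rightarrow> 'e \<Rightarrow> 'e \<Rightarrow> real" where
  "dg x m u w = FD (\<lambda>y. g y u w) x m"

lemma dg_sym: "dg x m u w = dg x m w u"
  by (simp add: dg_def sym[of _ u w])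

lemma linear_dg1: "x \<in> U \<Longrightarrow> linear (\<lambda>m. dg x m u w)"
  unfolding dg_def using smooth_on_linear_FD[OF smooth_g] .

lemma smooth_dg: "smooth_on (\<lambda>x. dg x m u w) U"
  unfolding dg_def by (intro smooth_intros smooth_g)

lemma linear_dg2: "x \<in> U \<Longrightarrow> linear (\<lambda>u. dg x m u w)"
  unfolding dg_def by (rule linear_FD_param[OF open_U _ linear_g1 smooth_g])

lemma linear_dg3: "x \<in> U \<Longrightarrow> linear (\<lambda>w. dg x m u w)"
  unfolding dg_def by (rule linear_FD_param[OF open_U _ linear_g2 smooth_g])

text \<open>The Christoffel symbols contracted with \<open>u\<close> and \<open>w\<close>: the
  Koszul formula for fields with constant coefficients, with its free index raised.\<close>

definition Gam :: "'e \<Rightarrow> 'e \<Rightarrow> 'e \<Rightarrow> 'e" where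
  "Gam x u w = sharp x (\<Sum>b\<in>Basis. ((dg x u w b + dg x w u b - dg x b u w) / 2) *\<^sub>R b)"

lemma Gam_sym: "Gam x u w = Gam x w u"
  unfolding Gam_def by (simp add: add.commute dg_sym[of x _ u w])

lemma koszul:
  assumes "x \<in> U"
  shows "g x (Gam x u w) z = (dg x u w z + dg x w u z - dg x z u w) / 2"
proof -
  have "linear (\<lambda>z. (dg x u w z + dg x w u z - dg x z u w) / 2)"
    by (rule linearI)
      (simp_all add: linear_add[OF linear_dg1[OF assms]] linear_scale[OF linear_dg1[OF assms]]
        linear_add[OF linear_dg3[OF assms]] linear_scale[OF linear_dg3[OF assms]] field_simps)
  from linear_sum_Basis[OF this, of z] show ?thesis
    by (simp add: Gam_def inner_sum_left inner_sum_right inner_commute mult.commute)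
qed

text \<open>In the sum of the two Koszul formulas the parts antisymmetric in \<open>u\<close> and
  \<open>w\<close> cancel.\<close>

lemma metric_compat: "x \<in> U \<Longrightarrow> dg x m u w = g x (Gam x m u) w + g x u (Gam x m w)"
  by (simp add: sym[of x u] koszul dg_sym[of x _ u m] dg_sym[of x _ w m] dg_sym[of x m w u] field_simps)

lemma linear_Gam1:
  assumes "x \<in> U" shows "linear (\<lambda>u. Gam x u w)"
proof (rule linearI)
  note l = linear_add[OF linear_dg1[OF assms]] linear_add[OF linear_dg2[OF assms]]
    linear_add[OF linear_dg3[OF assms]] linear_scale[OF linear_dg1[OF assms]]
    linear_scale[OF linear_dg2[OF assms]] linear_scale[OF linear_dg3[OF assms]]
  show "Gam x (u + v) w = Gam x u w + Gam x v w" for u v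
    by (rule g_eqI[of x]) (simp add: g_simps koszul[OF assms] l field_simps)
  show "Gam x (r *\<^sub>R u) w = r *\<^sub>R Gam x u w" for r u
    by (rule g_eqI[of x]) (simp add: g_simps koszul[OF assms] l field_simps)
qed

lemma linear_Gam2: "x \<in> U \<Longrightarrow> linear (\<lambda>w. Gam x u w)"
  using linear_Gam1[of x u] by (simp add: Gam_sym[of x u])

lemma smooth_Gam: "smooth_on (\<lambda>x. Gam x u w) U"
  unfolding Gam_def
  by (rule smooth_on_linear_field[OF open_U linear_sharp smooth_sharp])
    (intro smooth_intros smooth_dg open_U; simp)

section \<open>The curvature tensor and the Bianchi identities\<close>

abbreviation dGam :: "'e \<Rightarrow> 'e \<Rightarrow> 'e \<Rightarrow> 'e \<Rightarrow> 'e" where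
  "dGam x m u w \<equiv> FD (\<lambda>y. Gam y u w) x m"

lemma dGam_sym: "dGam x m u w = dGam x m w u"
  by (simp add: Gam_sym[of _ u w])

lemma linear_dGam1: "x \<in> U \<Longrightarrow> linear (\<lambda>m. dGam x m u w)"
  using smooth_on_linear_FD[OF smooth_Gam] .

lemma linear_dGam2: "x \<in> U \<Longrightarrow> linear (\<lambda>u. dGam x m u w)"
  by (rule linear_FD_param[OF open_U _ linear_Gam1 smooth_Gam])

lemma linear_dGam3: "x \<in> U \<Longrightarrow> linear (\<lambda>w. dGam x m u w)"
  by (rule linear_FD_param[OF open_U _ linear_Gam2 smooth_Gam])

lemmas Gam_lin =
  linear_add[OF linear_Gam1] linear_add[OF linear_Gam2] linear_diff[OF linear_Gam1]
  linear_diff[OF linear_Gam2] linear_scale[OF linear_Gam1] linear_scale[OF linear_Gam2]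
  linear_neg[OF linear_Gam1] linear_neg[OF linear_Gam2]
  linear_0[OF linear_Gam1] linear_0[OF linear_Gam2]

lemmas dGam_lin =
  linear_add[OF linear_dGam1] linear_add[OF linear_dGam2] linear_add[OF linear_dGam3]
  linear_diff[OF linear_dGam1] linear_diff[OF linear_dGam2] linear_diff[OF linear_dGam3]
  linear_scale[OF linear_dGam1] linear_scale[OF linear_dGam2] linear_scale[OF linear_dGam3]

lemma FD_g:
  assumes "x \<in> U" "smooth_on a U" "smooth_on c U"
  shows "FD (\<lambda>y. g y (a y) (c y)) x m
    = dg x m (a x) (c x) + g x (FD a x m) (c x) + g x (a x) (FD c x m)"
proof -
  have s: "smooth_on (\<lambda>y. g y u (c y)) U" for u
    by (rule smooth_on_linear_field[OF open_U linear_g2 smooth_g assms(3)])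
  have "FD (\<lambda>y. g y (a y) (c y)) x m = FD (\<lambda>y. g y (a x) (c y)) x m + g x (FD a x m) (c x)"
    by (rule FD_linear_field[OF open_U assms(1) linear_g1 s assms(2)])
  also have "FD (\<lambda>y. g y (a x) (c y)) x m = dg x m (a x) (c x) + g x (a x) (FD c x m)"
    unfolding dg_def by (rule FD_linear_field[OF open_U assms(1) linear_g2 smooth_g assms(3)])
  finally show ?thesis by simp
qed

lemma FD_Gam:
  assumes "x \<in> U" "smooth_on a U"
  shows "FD (\<lambda>y. Gam y u (a y)) x m = dGam x m u (a x) + Gam x u (FD a x m)"
  by (rule FD_linear_field[OF open_U assms(1) linear_Gam2 smooth_Gam assms(2)])

lemma smooth_Gam': "smooth_on a U \<Longrightarrow> smooth_on (\<lambda>y. Gam y u (a y)) U"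
  by (rule smooth_on_linear_field[OF open_U linear_Gam2 smooth_Gam])

text \<open>The commutator of the covariant derivatives in directions \<open>k\<close> and
  \<open>l\<close>, applied to \<open>z\<close>, for fields with constant coefficients, whose
  brackets vanish.\<close>

definition Rm :: "'e \<Rightarrow> 'e \<Rightarrow> 'e \<Rightarrow> 'e \<Rightarrow> 'e" where
  "Rm x k l z = dGam x k l z - dGam x l k z + Gam x k (Gam x l z) - Gam x l (Gam x k z)"

lemma Rm_antisym: "Rm x k l z = - Rm x l k z"
  by (simp add: Rm_def)

text \<open>Symmetry of \<open>Gam\<close> and of its derivative in the lower slots makes all terms
  cancel in pairs.\<close>

lemma Rm_bianchi1: "Rm x k l z + Rm x l z k + Rm x z k l = 0"
proof -
  note s = dGam_sym[of k z x l] dGam_sym[of l k x z] dGam_sym[of z l x k] Gam_sym[of x l k] Gam_sym[of x z l] Gam_sym[of x z k]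
  show ?thesis unfolding Rm_def s by simp
qed

lemma smooth_Rm: "smooth_on (\<lambda>x. Rm x k l z) U"
  unfolding Rm_def by (intro smooth_intros smooth_Gam smooth_Gam' open_U)

lemma linear_Rm1: "x \<in> U \<Longrightarrow> linear (\<lambda>k. Rm x k l z)"
  by (rule linearI) (simp_all add: Rm_def Gam_lin dGam_lin algebra_simps)

lemma linear_Rm2: "x \<in> U \<Longrightarrow> linear (\<lambda>l. Rm x k l z)"
  by (rule linearI) (simp_all add: Rm_def Gam_lin dGam_lin algebra_simps)

lemma linear_Rm3: "x \<in> U \<Longrightarrow> linear (\<lambda>z. Rm x k l z)"
  by (rule linearI) (simp_all add: Rm_def Gam_lin dGam_lin algebra_simps)

text \<open>Second derivatives of \<open>g(z, z)\<close> commute.\<close>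

lemma Rm_skew0:
  assumes x: "x \<in> U"
  shows "g x (Rm x k l z) z = 0"
proof -
  have D: "FD (\<lambda>y. dg y u z z) x w
      = 2 * (g x (Gam x w (Gam x u z)) z + g x (Gam x u z) (Gam x w z) + g x (dGam x w u z) z)" for u w
  proof -
    have "dg y u z z = 2 * g y (Gam y u z) z" if "y \<in> U" for y
      using metric_compat[OF that, of u z z] sym[of y z "Gam y u z"] by simp
    then have "FD (\<lambda>y. dg y u z z) x w = FD (\<lambda>y. 2 * g y (Gam y u z) z) x w"
      by (rule fun_cong[OF FD_cong_open[OF open_U x]])
    also have "\<dots> = 2 * FD (\<lambda>y. g y (Gam y u z) z) x w"
      by (intro FD_eqI has_derivative_mult_right smooth_on_has_derivative[OF _ x]
          smooth_on_linear_field[OF open_U linear_g1 smooth_g] smooth_Gam)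
    also have "FD (\<lambda>y. g y (Gam y u z) z) x w
        = dg x w (Gam x u z) z + g x (dGam x w u z) z + g x (Gam x u z) (FD (\<lambda>_. z) x w)"
      by (rule FD_g[OF x smooth_Gam smooth_on_const[OF open_U]])
    finally show ?thesis
      by (simp add: g_simps metric_compat[OF x])
  qed
  have "FD (\<lambda>y. dg y k z z) x l = FD (\<lambda>y. dg y l z z) x k"
    unfolding dg_def by (rule FD_symmetric_real[OF open_U x smooth_g])
  then show ?thesis
    unfolding D by (simp add: Rm_def g_simps sym[of x "Gam x k z"])
qed

lemma skew_polar:
  assumes "linear T" "\<And>z. g x (T z) z = 0"
  shows "g x (T z) w = - g x (T w) z"
  using assms(2)[of "z + w"] assms(2)[of z] assms(2)[of w]
  by (simp add: linear_add[OF assms(1)] g_simps)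

lemma Rm_skew: "x \<in> U \<Longrightarrow> g x (Rm x k l z) w = - g x (Rm x k l w) z"
  by (rule skew_polar[OF linear_Rm3 Rm_skew0])

text \<open>The covariant derivative of the curvature tensor in direction \<open>m\<close>.\<close>

definition nRm :: "'e \<Rightarrow> 'e \<Rightarrow> 'e \<Rightarrow> 'e \<Rightarrow> 'e \<Rightarrow> 'e" where
  "nRm x m k l z = FD (\<lambda>y. Rm y k l z) x m + Gam x m (Rm x k l z)
     - Rm x (Gam x m k) l z - Rm x k (Gam x m l) z - Rm x k l (Gam x m z)"

lemma FD_Rm:
  assumes "x \<in> U"
  shows "FD (\<lambda>y. Rm y k l z) x m = FD (\<lambda>y. dGam y k l z) x m - FD (\<lambda>y. dGam y l k z) x m
    + (dGam x m k (Gam x l z) + Gam x k (dGam x m l z)) - (dGam x m l (Gam x k z) + Gam x l (dGam x m k z))"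
proof -
  have "FD (\<lambda>y. Rm y k l z) x m = FD (\<lambda>y. dGam y k l z) x m - FD (\<lambda>y. dGam y l k z) x m
    + FD (\<lambda>y. Gam y k (Gam y l z)) x m - FD (\<lambda>y. Gam y l (Gam y k z)) x m"
    unfolding Rm_def
    by (intro FD_eqI has_derivative_add has_derivative_diff smooth_on_has_derivative[OF _ assms]
        smooth_intros smooth_Gam smooth_Gam')
  then show ?thesis by (simp add: FD_Gam[OF assms] smooth_Gam)
qed

lemma nRm_antisym: "x \<in> U \<Longrightarrow> nRm x m k l z = - nRm x m l k z"
  unfolding nRm_def FD_Rm
  by (simp add: Rm_antisym[of x l] Rm_antisym[of x "Gam x m l"] Gam_lin)

text \<open>No normal coordinates are used: in the cyclic sum the corrections in the first two slots
  cancel by symmetry of \<open>Gam\<close> and antisymmetry of \<open>Rm\<close>, the second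
  derivatives of \<open>Gam\<close> cancel by Schwarz's theorem, and the remaining products cancel
  once \<open>Rm\<close> is expanded.\<close>

lemma Rm_bianchi2:
  assumes x: "x \<in> U"
  shows "nRm x m k l z + nRm x k l m z + nRm x l m k z = 0"
proof -
  have s: "FD (\<lambda>y. dGam y u v z) x w = FD (\<lambda>y. dGam y w v z) x u" for u v w
    by (rule FD_symmetric[OF open_U x smooth_Gam])
  have "nRm x m k l z + nRm x k l m z + nRm x l m k z =
     (FD (\<lambda>y. Rm y k l z) x m + Gam x m (Rm x k l z) - Rm x k l (Gam x m z))
   + (FD (\<lambda>y. Rm y l m z) x k + Gam x k (Rm x l m z) - Rm x l m (Gam x k z))
   + (FD (\<lambda>y. Rm y m k z) x l + Gam x l (Rm x m k z) - Rm x m k (Gam x l z))"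
    unfolding nRm_def Gam_sym[of x l m] Gam_sym[of x k m] Gam_sym[of x l k]
    by (simp add: algebra_simps Rm_antisym[of x k "Gam x m l"] Rm_antisym[of x l "Gam x m k"]
        Rm_antisym[of x m "Gam x k l"])
  also have "\<dots> = 0"
    unfolding FD_Rm[OF x] s[of l k m] s[of m l k] s[of k m l]
    unfolding Rm_def by (simp add: Gam_lin[OF x])
  finally show ?thesis .
qed

text \<open>The function \<open>g x (Rm x k l z) z\<close> vanishes identically; in its derivative,
  \<open>metric_compat\<close> replaces the derivative of the metric by the corrections in
  \<open>nRm\<close>.\<close>

lemma nRm_skew0:
  assumes x: "x \<in> U"
  shows "g x (nRm x m k l z) z = 0"
proof -
  have "FD (\<lambda>y. g y (Rm y k l z) z) x m = FD (\<lambda>y. 0) x m"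
    by (rule fun_cong[OF FD_cong_open[OF open_U x]]) (simp add: Rm_skew0)
  then have "dg x m (Rm x k l z) z + g x (FD (\<lambda>y. Rm y k l z) x m) z = 0"
    using FD_g[OF x smooth_Rm smooth_on_const[OF open_U]] by (simp add: g_simps)
  then show ?thesis
    using x by (simp add: metric_compat nRm_def g_simps Rm_skew0 Rm_skew[of x k l "Gam x m z" z]
        sym[of x _ "Gam x m z"])
qed

lemma linear_nRm4: "x \<in> U \<Longrightarrow> linear (\<lambda>z. nRm x m k l z)"
proof -
  assume x: "x \<in> U"
  note F = linear_FD_param[OF open_U x linear_Rm3 smooth_Rm]
  note R = linear_Rm3[OF x]
  show ?thesis
    by (rule linearI)
      (simp_all add: nRm_def linear_add[OF F] linear_scale[OF F] linear_add[OF R] linear_scale[OF R]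
        Gam_lin[OF x] algebra_simps)
qed

lemma nRm_skew: "x \<in> U \<Longrightarrow> g x (nRm x m k l z) w = - g x (nRm x m k l w) z"
  by (rule skew_polar[OF linear_nRm4 nRm_skew0])

section \<open>Traces, Ricci curvature and the contracted Bianchi identity\<close>

lemma trace_comm:
  fixes A B :: "'e \<Rightarrow> 'e"
  assumes "linear A" "linear B"
  shows "(\<Sum>b\<in>Basis. A (B b) \<bullet> b) = (\<Sum>b\<in>Basis. B (A b) \<bullet> b)"
proof -
  have "(\<Sum>b\<in>Basis. A (B b) \<bullet> b) = (\<Sum>b\<in>Basis. \<Sum>c\<in>Basis. (B b \<bullet> c) * (A c \<bullet> b))"
    by (rule sum.cong[OF refl]) (subst linear_sum_Basis[OF assms(1)], simp add: inner_sum_left)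
  also have "\<dots> = (\<Sum>b\<in>Basis. \<Sum>c\<in>Basis. (A b \<bullet> c) * (B c \<bullet> b))"
    by (subst sum.swap) (simp add: mult.commute)
  also have "\<dots> = (\<Sum>b\<in>Basis. B (A b) \<bullet> b)"
    by (rule sum.cong[OF refl], rule HOL.sym) (subst linear_sum_Basis[OF assms(2)], simp add: inner_sum_left)
  finally show ?thesis .
qed

text \<open>The inverse metric is symmetric, so a metric trace may raise either slot.\<close>

lemma trace_sharp_swap:
  fixes B :: "'e \<Rightarrow> 'e \<Rightarrow> real"
  assumes "\<And>u. linear (B u)" "\<And>w. linear (\<lambda>u. B u w)"
  shows "(\<Sum>b\<in>Basis. B (sharp x b) b) = (\<Sum>b\<in>Basis. B b (sharp x b))"
proof -
  have "(\<Sum>b\<in>Basis. B (sharp x b) b) = (\<Sum>b\<in>Basis. \<Sum>c\<in>Basis. (sharp x b \<bullet> c) * B c b)"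
    by (rule sum.cong[OF refl]) (subst linear_sum_Basis[OF assms(2)], simp)
  also have "\<dots> = (\<Sum>b\<in>Basis. \<Sum>c\<in>Basis. (sharp x b \<bullet> c) * B b c)"
    by (subst sum.swap, intro sum.cong refl) (metis sharp_sym inner_commute)
  also have "\<dots> = (\<Sum>b\<in>Basis. B b (sharp x b))"
    by (rule sum.cong[OF refl], rule HOL.sym) (subst linear_sum_Basis[OF assms(1)], simp)
  finally show ?thesis .
qed

definition Ric :: "'e \<Rightarrow> 'e \<Rightarrow> 'e \<Rightarrow> real" where
  "Ric x l z = (\<Sum>b\<in>Basis. Rm x b l z \<bullet> b)"

lemma smooth_Ric: "smooth_on (\<lambda>x. Ric x l z) U"
  unfolding Ric_def by (intro smooth_intros smooth_Rm open_U)

lemma linear_Ric1: "x \<in> U \<Longrightarrow> linear (\<lambda>l. Ric x l z)"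
  by (rule linearI) (simp_all add: Ric_def linear_add[OF linear_Rm2] linear_scale[OF linear_Rm2]
      inner_simps sum.distrib sum_distrib_left)

lemma linear_Ric2: "x \<in> U \<Longrightarrow> linear (\<lambda>z. Ric x l z)"
  by (rule linearI) (simp_all add: Ric_def linear_add[OF linear_Rm3] linear_scale[OF linear_Rm3]
      inner_simps sum.distrib sum_distrib_left)

text \<open>Written as a metric trace, the trace of \<open>T\<close> changes sign when the two slots
  are exchanged.\<close>

lemma trace_skew:
  assumes "linear T" "\<And>z w. g x (T z) w = - g x (T w) z"
  shows "(\<Sum>b\<in>Basis. T b \<bullet> b) = 0"
proof -
  have "(\<Sum>b\<in>Basis. T b \<bullet> b) = (\<Sum>b\<in>Basis. g x (T b) (sharp x b))"
    by (simp add: inner_commute)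
  also have "\<dots> = (\<Sum>b\<in>Basis. - g x (T (sharp x b)) b)"
    by (subst assms(2)) simp
  also have "\<dots> = - (\<Sum>b\<in>Basis. g x (T b) (sharp x b))"
    using trace_sharp_swap[of "\<lambda>u w. g x (T u) w" x]
    by (simp add: sum_negf linear_g2 linear_compose[OF assms(1) linear_g1, unfolded o_def] del: g_sharp g_sharp')
  finally show ?thesis by (simp add: inner_commute)
qed

text \<open>Tracing the first Bianchi identity leaves the trace of the skew map
  \<open>Rm x l z\<close>, which is zero.\<close>

lemma Ric_sym:
  assumes x: "x \<in> U"
  shows "Ric x l z = Ric x z l"
proof -
  have "Rm x b l z = Rm x b z l - Rm x l z b" for b
    using Rm_bianchi1[of x b l z] Rm_antisym[of x z b l] by (simp add: algebra_simps)
  moreover have "(\<Sum>b\<in>Basis. Rm x l z b \<bullet> b) = 0"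
    by (rule trace_skew[OF linear_Rm3[OF x] Rm_skew[OF x]])
  ultimately show ?thesis
    by (simp add: Ric_def inner_simps sum_subtractf)
qed

definition nRic :: "'e \<Rightarrow> 'e \<Rightarrow> 'e \<Rightarrow> 'e \<Rightarrow> real" where
  "nRic x m l z = FD (\<lambda>y. Ric y l z) x m - Ric x (Gam x m l) z - Ric x l (Gam x m z)"

text \<open>Contraction commutes with covariant differentiation: the corrections for the value and
  for the contracted slot have the same trace and cancel.\<close>

lemma trace_nRm:
  assumes x: "x \<in> U"
  shows "(\<Sum>b\<in>Basis. nRm x m b l z \<bullet> b) = nRic x m l z"
proof -
  have "FD (\<lambda>y. Ric y l z) x m = (\<Sum>b\<in>Basis. FD (\<lambda>y. Rm y b l z) x m \<bullet> b)"
    unfolding Ric_def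
    by (intro FD_eqI has_derivative_sum has_derivative_inner_left smooth_on_has_derivative[OF smooth_Rm x])
  moreover have "(\<Sum>b\<in>Basis. Gam x m (Rm x b l z) \<bullet> b) = (\<Sum>b\<in>Basis. Rm x (Gam x m b) l z \<bullet> b)"
    by (rule trace_comm[OF linear_Gam2[OF x] linear_Rm1[OF x]])
  ultimately show ?thesis
    by (simp add: nRm_def nRic_def Ric_def inner_simps sum.distrib sum_subtractf)
qed

text \<open>Two contractions of the second Bianchi identity, first of the value with a slot, then a
  metric trace. Skewness of \<open>nRm\<close> turns the third term into another copy of the
  divergence of \<open>Ric\<close>.\<close>

lemma contracted_bianchi:
  assumes x: "x \<in> U"
  shows "(\<Sum>b\<in>Basis. nRic x m b (sharp x b)) = 2 * (\<Sum>b\<in>Basis. nRic x b m (sharp x b))"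
proof -
  have "nRic x m l z - nRic x l m z + (\<Sum>k\<in>Basis. nRm x k l m z \<bullet> k) = 0" for l z
  proof -
    have "(\<Sum>b\<in>Basis. (nRm x m b l z + nRm x b l m z + nRm x l m b z) \<bullet> b) = 0"
      by (simp add: Rm_bianchi2[OF x])
    then show ?thesis
      using trace_nRm[OF x, of m l z] trace_nRm[OF x, of l m z]
      by (simp add: nRm_antisym[OF x, of l m] inner_simps sum.distrib sum_negf sum_subtractf)
  qed
  from this[of b "sharp x b" for b]
  have "(\<Sum>b\<in>Basis. nRic x m b (sharp x b) - nRic x b m (sharp x b)
      + (\<Sum>k\<in>Basis. nRm x k b m (sharp x b) \<bullet> k)) = 0" by simp
  moreover have "nRm x k b m (sharp x b) \<bullet> k = - (nRm x k b m (sharp x k) \<bullet> b)" for k b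
    using nRm_skew[OF x, of k b m "sharp x b" "sharp x k"] by (simp add: inner_commute)
  then have "(\<Sum>b\<in>Basis. \<Sum>k\<in>Basis. nRm x k b m (sharp x b) \<bullet> k)
      = - (\<Sum>k\<in>Basis. \<Sum>b\<in>Basis. nRm x k b m (sharp x k) \<bullet> b)"
    by (subst sum.swap) (simp add: sum_negf)
  ultimately show ?thesis
    by (simp add: trace_nRm[OF x] sum.distrib sum_subtractf)
qed

text \<open>The inverse metric is parallel: the constant
  \<open>g x (sharp x b) w = b \<bullet> w\<close> is differentiated and
  \<open>metric_compat\<close> applied.\<close>

lemma FD_sharp:
  assumes x: "x \<in> U"
  shows "FD (\<lambda>y. sharp y b) x m = - Gam x m (sharp x b) - (\<Sum>c\<in>Basis. (b \<bullet> Gam x m c) *\<^sub>R sharp x c)"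
proof (rule g_eqI[of x])
  fix w
  have "FD (\<lambda>y. g y (sharp y b) w) x m = 0" by simp
  then have "dg x m (sharp x b) w + g x (FD (\<lambda>y. sharp y b) x m) w = 0"
    using FD_g[OF x smooth_sharp smooth_on_const[OF open_U], of b w m] by (simp add: g_simps)
  moreover have "g x (\<Sum>c\<in>Basis. (b \<bullet> Gam x m c) *\<^sub>R sharp x c) w = b \<bullet> Gam x m w"
  proof -
    have "g x (\<Sum>c\<in>Basis. (b \<bullet> Gam x m c) *\<^sub>R sharp x c) w
        = b \<bullet> (\<Sum>c\<in>Basis. (w \<bullet> c) *\<^sub>R Gam x m c)"
      by (simp add: linear_sum[OF linear_g1] g_simps inner_sum_right inner_commute mult.commute)
    then show ?thesis
      using linear_sum_Basis[OF linear_Gam2[OF x], of m w] by simp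
  qed
  ultimately show "g x (FD (\<lambda>y. sharp y b) x m) w
      = g x (- Gam x m (sharp x b) - (\<Sum>c\<in>Basis. (b \<bullet> Gam x m c) *\<^sub>R sharp x c)) w"
    by (simp add: g_simps metric_compat[OF x] inner_commute)
qed

text \<open>The metric trace commutes with covariant differentiation; the basis sum from
  \<open>FD_sharp\<close> is moved into the first slot of \<open>T\<close>.\<close>

lemma FD_trace:
  fixes T :: "'e \<Rightarrow> 'e \<Rightarrow> 'e \<Rightarrow> real"
  assumes x: "x \<in> U" and T: "\<And>y w. y \<in> U \<Longrightarrow> linear (\<lambda>u. T y u w)" "\<And>y u. y \<in> U \<Longrightarrow> linear (T y u)"
    and sm: "\<And>u w. smooth_on (\<lambda>y. T y u w) U"
  shows "FD (\<lambda>y. \<Sum>b\<in>Basis. T y b (sharp y b)) x m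
    = (\<Sum>b\<in>Basis. FD (\<lambda>y. T y b (sharp x b)) x m - T x (Gam x m b) (sharp x b) - T x b (Gam x m (sharp x b)))"
proof -
  note s = smooth_on_linear_field[OF open_U T(2) sm smooth_sharp]
  have "FD (\<lambda>y. \<Sum>b\<in>Basis. T y b (sharp y b)) x m = (\<Sum>b\<in>Basis. FD (\<lambda>y. T y b (sharp y b)) x m)"
    by (intro FD_eqI has_derivative_sum smooth_on_has_derivative[OF s x])
  also have "\<dots> = (\<Sum>b\<in>Basis. FD (\<lambda>y. T y b (sharp x b)) x m + T x b (FD (\<lambda>y. sharp y b) x m))"
    by (intro sum.cong refl FD_linear_field[OF open_U x T(2) sm smooth_sharp])
  also have "\<dots> = (\<Sum>b\<in>Basis. FD (\<lambda>y. T y b (sharp x b)) x m - T x b (Gam x m (sharp x b))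
      - (\<Sum>c\<in>Basis. (b \<bullet> Gam x m c) * T x b (sharp x c)))"
    unfolding FD_sharp[OF x] linear_diff[OF T(2)[OF x]] linear_neg[OF T(2)[OF x]]
      linear_sum[OF T(2)[OF x]] linear_scale[OF T(2)[OF x]]
    by (simp add: algebra_simps)
  also have "\<dots> = (\<Sum>b\<in>Basis. FD (\<lambda>y. T y b (sharp x b)) x m - T x b (Gam x m (sharp x b)))
      - (\<Sum>c\<in>Basis. \<Sum>b\<in>Basis. (b \<bullet> Gam x m c) * T x b (sharp x c))"
    by (simp add: sum_subtractf sum.swap[of "\<lambda>c b. (b \<bullet> Gam x m c) * T x b (sharp x c)" Basis Basis])
  also have "(\<Sum>c\<in>Basis. \<Sum>b\<in>Basis. (b \<bullet> Gam x m c) * T x b (sharp x c))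
      = (\<Sum>c\<in>Basis. T x (Gam x m c) (sharp x c))"
    by (rule sum.cong[OF refl], subst (2) linear_sum_Basis[OF T(1)[OF x]]) (simp add: inner_commute)
  finally show ?thesis by (simp add: sum_subtractf)
qed

text \<open>All vectors are proportional, and \<open>Rm\<close> is antisymmetric in its first two
  slots.\<close>

lemma Ric_dim1:
  assumes x: "x \<in> U" and "DIM('e) = 1"
  shows "Ric x l z = 0"
proof -
  obtain e :: 'e where e: "Basis = {e}" using assms(2) card_1_singletonE by blast
  have l: "(l \<bullet> e) *\<^sub>R e = l"
    using euclidean_representation[of l] unfolding e by simp
  have "Rm x e e z = 0" using Rm_antisym[of x e e z] by (simp add: eq_neg_iff_add_eq_0 scaleR_2[symmetric])
  then have "Rm x e l z = 0"
    by (subst l[symmetric]) (simp add: linear_scale[OF linear_Rm2[OF x]])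
  then show ?thesis by (simp add: Ric_def e)
qed

end

section \<open>Gradient, Hessian and Laplacian of a function\<close>

locale riem_fun = riem_chart +
  fixes \<phi> :: "'a \<Rightarrow> real"
  assumes smooth_\<phi>: "smooth_on \<phi> U"
begin

definition df :: "'a \<Rightarrow> 'a \<Rightarrow> real" where
  "df x u = FD \<phi> x u"

definition ddf :: "'a \<Rightarrow> 'a \<Rightarrow> 'a \<Rightarrow> real" where
  "ddf x u w = FD (\<lambda>y. df y u) x w"

definition Hess :: "'a \<Rightarrow> 'a \<Rightarrow> 'a \<Rightarrow> real" where
  "Hess x u w = ddf x u w - df x (Gam x u w)"

definition grad :: "'a \<Rightarrow> 'a" where
  "grad x = (\<Sum>b\<in>Basis. df x b *\<^sub>R sharp x b)"

definition Lap :: "'a \<Rightarrow> real" where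
  "Lap x = (\<Sum>b\<in>Basis. Hess x b (sharp x b))"

definition grad2 :: "'a \<Rightarrow> real" where
  "grad2 x = (\<Sum>b\<in>Basis. df x b * df x (sharp x b))"

lemma linear_df: "x \<in> U \<Longrightarrow> linear (df x)"
  unfolding df_def using smooth_on_linear_FD[OF smooth_\<phi>] .

lemma smooth_df: "smooth_on (\<lambda>x. df x u) U"
  unfolding df_def by (intro smooth_intros smooth_\<phi>)

lemma smooth_df': "smooth_on a U \<Longrightarrow> smooth_on (\<lambda>x. df x (a x)) U"
  by (rule smooth_on_linear_field[OF open_U linear_df smooth_df])

lemma FD_df:
  assumes "x \<in> U" "smooth_on a U"
  shows "FD (\<lambda>y. df y (a y)) x m = ddf x (a x) m + df x (FD a x m)"
  unfolding ddf_def by (rule FD_linear_field[OF open_U assms(1) linear_df smooth_df assms(2)])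

lemma linear_ddf2: "x \<in> U \<Longrightarrow> linear (ddf x u)"
  unfolding ddf_def by (rule smooth_on_linear_FD[OF smooth_df])

lemma ddf_sym: "x \<in> U \<Longrightarrow> ddf x u w = ddf x w u"
  unfolding ddf_def df_def by (rule FD_symmetric_real[OF open_U _ smooth_\<phi>])

lemma smooth_ddf: "smooth_on (\<lambda>x. ddf x u w) U"
  unfolding ddf_def by (intro smooth_intros smooth_df)

lemma dddf_sym:
  assumes x: "x \<in> U"
  shows "FD (\<lambda>y. ddf y l z) x m = FD (\<lambda>y. ddf y m z) x l"
proof -
  have "FD (\<lambda>y. ddf y l z) x m = FD (\<lambda>y. ddf y z l) x m" for l m
    by (rule fun_cong[OF FD_cong_open[OF open_U x ddf_sym]])
  moreover have "FD (\<lambda>y. ddf y z l) x m = FD (\<lambda>y. ddf y z m) x l"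
    unfolding ddf_def by (rule FD_symmetric_real[OF open_U x smooth_df])
  ultimately show ?thesis by simp
qed

lemma Hess_sym: "x \<in> U \<Longrightarrow> Hess x u w = Hess x w u"
  by (simp add: Hess_def ddf_sym[of x u w] Gam_sym[of x u w])

lemma linear_Hess2: "x \<in> U \<Longrightarrow> linear (Hess x u)"
  by (rule linearI) (simp_all add: Hess_def Gam_lin linear_add[OF linear_ddf2] linear_scale[OF linear_ddf2]
      linear_add[OF linear_df] linear_scale[OF linear_df] algebra_simps)

lemma linear_Hess1: "x \<in> U \<Longrightarrow> linear (\<lambda>u. Hess x u w)"
  using linear_Hess2[of x w] by (simp add: Hess_sym[of x _ w])

lemma smooth_Hess: "smooth_on (\<lambda>x. Hess x u w) U"
  unfolding Hess_def by (intro smooth_intros smooth_ddf smooth_df' smooth_Gam open_U)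

lemma smooth_grad: "smooth_on grad U"
  unfolding grad_def by (intro smooth_intros smooth_df smooth_sharp open_U)

lemma smooth_Lap: "smooth_on Lap U"
  unfolding Lap_def
  by (intro smooth_intros open_U smooth_on_linear_field[OF open_U linear_Hess2 smooth_Hess smooth_sharp])

lemma smooth_grad2: "smooth_on grad2 U"
  unfolding grad2_def by (intro smooth_intros open_U smooth_df smooth_df' smooth_sharp)

lemma g_grad:
  assumes "x \<in> U" shows "g x (grad x) w = df x w"
  using linear_sum_Basis[OF linear_df[OF assms], of w]
  by (simp add: grad_def linear_sum[OF linear_g1] g_simps inner_commute mult.commute)

lemma grad2_eq: "x \<in> U \<Longrightarrow> grad2 x = df x (grad x)"
  by (simp add: grad2_def grad_def linear_sum[OF linear_df] linear_scale[OF linear_df])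

definition nHess :: "'a \<Rightarrow> 'a \<Rightarrow> 'a \<Rightarrow> 'a \<Rightarrow> real" where
  "nHess x m u w = FD (\<lambda>y. Hess y u w) x m - Hess x (Gam x m u) w - Hess x u (Gam x m w)"

lemma FD_Hess:
  assumes x: "x \<in> U"
  shows "FD (\<lambda>y. Hess y l z) x m
    = FD (\<lambda>y. ddf y l z) x m - (ddf x (Gam x l z) m + df x (dGam x m l z))"
proof -
  have "FD (\<lambda>y. Hess y l z) x m = FD (\<lambda>y. ddf y l z) x m - FD (\<lambda>y. df y (Gam y l z)) x m"
    unfolding Hess_def
    by (intro FD_eqI has_derivative_diff smooth_on_has_derivative[OF _ x] smooth_ddf smooth_df' smooth_Gam)
  then show ?thesis by (simp add: FD_df[OF x smooth_Gam])
qed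

text \<open>Third derivatives of \<phi> are symmetric, so exchanging the first two slots of its
  covariant third derivative leaves only curvature.\<close>

lemma ricci_identity:
  assumes x: "x \<in> U"
  shows "nHess x k l z - nHess x l k z = - df x (Rm x k l z)"
  unfolding nHess_def FD_Hess[OF x] dddf_sym[OF x, of l z k]
  by (simp add: Hess_def Rm_def Gam_sym[of x l k] ddf_sym[OF x, of _ l] ddf_sym[OF x, of _ k]
      linear_add[OF linear_df[OF x]] linear_diff[OF linear_df[OF x]])

lemma trace_nHess:
  assumes x: "x \<in> U"
  shows "(\<Sum>b\<in>Basis. nHess x m b (sharp x b)) = FD Lap x m"
proof -
  have "Lap = (\<lambda>y. \<Sum>b\<in>Basis. Hess y b (sharp y b))" by (simp add: fun_eq_iff Lap_def)
  then show ?thesis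
    using FD_trace[OF x linear_Hess1 linear_Hess2 smooth_Hess, of m] by (simp add: nHess_def)
qed

text \<open>The Bochner formula: the Ricci identity exchanges the first two slots of
  \<open>nHess\<close>, and skewness of \<open>Rm\<close> collects the traced curvature term into
  \<open>Ric\<close>.\<close>

lemma div_Hess:
  assumes x: "x \<in> U"
  shows "(\<Sum>b\<in>Basis. nHess x b m (sharp x b)) = FD Lap x m + Ric x m (grad x)"
proof -
  have "nHess x b m (sharp x b) = nHess x m b (sharp x b) + Rm x b m (grad x) \<bullet> b" for b
  proof -
    have "df x (Rm x b m (sharp x b)) = g x (Rm x b m (sharp x b)) (grad x)"
      by (simp add: g_grad[OF x, symmetric] sym[of x "grad x"])
    also have "\<dots> = - g x (Rm x b m (grad x)) (sharp x b)"
      by (rule Rm_skew[OF x])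
    finally show ?thesis
      using ricci_identity[OF x, of b m "sharp x b"] by (simp add: inner_commute)
  qed
  then show ?thesis
    by (simp add: sum.distrib trace_nHess[OF x] Ric_def)
qed

lemma Hess_grad: "x \<in> U \<Longrightarrow> (\<Sum>b\<in>Basis. df x b * Hess x m (sharp x b)) = Hess x m (grad x)"
  by (simp add: grad_def linear_sum[OF linear_Hess2] linear_scale[OF linear_Hess2])

text \<open>Both terms of the product rule contribute equally after the slots of the metric trace
  are exchanged.\<close>

lemma FD_grad2:
  assumes x: "x \<in> U"
  shows "FD grad2 x m = 2 * Hess x m (grad x)"
proof -
  have s: "smooth_on (\<lambda>y. df y u * df y w) U" for u w
    by (intro smooth_intros open_U smooth_df)
  have l1: "linear (\<lambda>u. df y u * df y w)" and l2: "linear (\<lambda>w. df y u * df y w)" if "y \<in> U" for y u w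
    by (auto intro!: linearI simp: linear_add[OF linear_df[OF that]] linear_scale[OF linear_df[OF that]] algebra_simps)
  have D: "FD (\<lambda>y. df y u * df y w) x m = df x u * ddf x w m + ddf x u m * df x w" for u w
    unfolding ddf_def
    by (rule FD_eqI) (intro has_derivative_mult smooth_on_has_derivative[OF smooth_df x])
  have "grad2 = (\<lambda>y. \<Sum>b\<in>Basis. df y b * df y (sharp y b))" by (simp add: fun_eq_iff grad2_def)
  then have "FD grad2 x m = (\<Sum>b\<in>Basis. Hess x m b * df x (sharp x b) + df x b * Hess x m (sharp x b))"
    using FD_trace[OF x l1 l2 s, of m]
    by (simp add: D Hess_def ddf_sym[OF x, of m] algebra_simps)
  also have "\<dots> = (\<Sum>b\<in>Basis. Hess x m b * df x (sharp x b)) + Hess x m (grad x)"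
    by (simp add: sum.distrib Hess_grad[OF x])
  also have "(\<Sum>b\<in>Basis. Hess x m b * df x (sharp x b)) = (\<Sum>b\<in>Basis. Hess x m (sharp x b) * df x b)"
    using trace_sharp_swap[of "\<lambda>u w. Hess x m w * df x u" x]
    by (auto simp: linear_iff linear_add[OF linear_Hess2[OF x]] linear_scale[OF linear_Hess2[OF x]]
        linear_add[OF linear_df[OF x]] linear_scale[OF linear_df[OF x]] algebra_simps)
  also have "\<dots> = Hess x m (grad x)"
    by (simp add: Hess_grad[OF x, symmetric] mult.commute)
  finally show ?thesis by simp
qed

text \<open>The left side is the covariant divergence of the gradient, the form in which the
  Laplacian turns up in the Ricci curvature of the warped product.\<close>

lemma div_grad:
  assumes x: "x \<in> U"
  shows "(\<Sum>i\<in>Basis. (FD grad x i + Gam x i (grad x)) \<bullet> i) = Lap x"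
proof -
  have H: "g x (FD grad x i + Gam x i (grad x)) z = Hess x i z" for i z
  proof -
    have "FD (\<lambda>y. g y (grad y) z) x i = FD (\<lambda>y. df y z) x i"
      by (rule fun_cong[OF FD_cong_open[OF open_U x g_grad]])
    then have "dg x i (grad x) z + g x (FD grad x i) z = ddf x z i"
      using FD_g[OF x smooth_grad smooth_on_const[OF open_U], of z i] by (simp add: g_simps ddf_def)
    then show ?thesis
      by (simp add: metric_compat[OF x] g_simps g_grad[OF x] Hess_def ddf_sym[OF x, of i])
  qed
  have "(FD grad x i + Gam x i (grad x)) \<bullet> i = Hess x i (sharp x i)" for i
    using H[of i "sharp x i"] by (simp add: inner_commute)
  then show ?thesis by (simp add: Lap_def)
qed

end

section \<open>Schur's lemma for the warped Einstein equations\<close>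

locale warped_einstein_base = riem_fun +
  fixes lam :: "'a \<Rightarrow> real" and n2 :: real and \<mu> :: real
  assumes \<phi>_pos: "x \<in> U \<Longrightarrow> \<phi> x > 0"
    and n2: "n2 > 0"
    and einstein: "x \<in> U \<Longrightarrow> Ric x u u - n2 / \<phi> x * Hess x u u = lam x * g x u u"
    and fiber: "x \<in> U \<Longrightarrow> \<phi> x * Lap x + (n2 - 1) * grad2 x + lam x * (\<phi> x)\<^sup>2 = \<mu>"
begin

lemma einstein_polar:
  assumes x: "x \<in> U"
  shows "Ric x u w = lam x * g x u w + n2 / \<phi> x * Hess x u w"
proof -
  define c where "c = n2 / \<phi> x"
  note E = einstein[OF x, folded c_def]
  show ?thesis
  using E[of "u + w"] E[of u] E[of w] unfolding c_def[symmetric]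
  by (simp add: linear_add[OF linear_Ric1[OF x]] linear_add[OF linear_Ric2[OF x]]
      linear_add[OF linear_Hess1[OF x]] linear_add[OF linear_Hess2[OF x]] g_simps
      Ric_sym[OF x, of w u] Hess_sym[OF x, of w u] sym[of x w u] algebra_simps)
qed

lemma trace_einstein:
  assumes x: "x \<in> U"
  shows "(\<Sum>b\<in>Basis. Ric x b (sharp x b)) = lam x * DIM('a) + n2 / \<phi> x * Lap x"
  unfolding einstein_polar[OF x]
  by (simp add: sum.distrib sum_distrib_left[symmetric] sum_divide_distrib[symmetric] Lap_def mult.commute)

text \<open>At a fixed nonzero vector the base equation can be solved for \<open>lam\<close>, and
  everything else in it is smooth.\<close>

lemma smooth_lam: "smooth_on lam U"
proof -
  obtain u :: 'a where u: "u \<noteq> 0" using nonempty_Basis nonzero_Basis by blast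
  show ?thesis
  proof (rule smooth_on_cong[OF open_U])
    show "smooth_on (\<lambda>x. (Ric x u u - n2 / \<phi> x * Hess x u u) / g x u u) U"
      using \<phi>_pos pos[OF u]
      by (intro smooth_intros smooth_Ric smooth_Hess smooth_g smooth_\<phi> open_U) (auto simp: less_imp_neq[symmetric])
    show "(Ric x u u - n2 / \<phi> x * Hess x u u) / g x u u = lam x" if "x \<in> U" for x
      using einstein[OF that, of u] pos[OF u, of x] by simp
  qed
qed

text \<open>Schur's lemma for the warped product: the contracted second Bianchi identity is compared with
  the derivative of the equation on the fiber.\<close>

lemma schur:
  assumes x: "x \<in> U"
  shows "(DIM('a) + n2 - 2) * FD lam x m = 0"
proof -
  have \<phi>: "\<phi> x > 0" by (rule \<phi>_pos[OF x])
  have D: "(lam has_derivative FD lam x) (at x)" "(\<phi> has_derivative df x) (at x)"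
    using smooth_on_has_derivative[OF smooth_lam x] smooth_on_has_derivative[OF smooth_\<phi> x]
    by (simp_all add: df_def[abs_def])
  \<comment> \<open>Covariant derivative of the polarized base equation; the metric is parallel, so
    only \<open>lam\<close>, \<open>Hess\<close> and the factor \<open>1 / \<phi>\<close> are
    differentiated.\<close>
  have nRic: "nRic x m u w = FD lam x m * g x u w
      + n2 * (nHess x m u w / \<phi> x - df x m * Hess x u w / (\<phi> x)\<^sup>2)" for m u w
  proof -
    have "FD (\<lambda>y. Ric y u w) x m = FD (\<lambda>y. lam y * g y u w + n2 * (Hess y u w / \<phi> y)) x m"
      by (rule fun_cong[OF FD_cong_open[OF open_U x]]) (simp add: einstein_polar)
    also have "\<dots> = lam x * dg x m u w + FD lam x m * g x u w
        + n2 * ((FD (\<lambda>y. Hess y u w) x m * \<phi> x - Hess x u w * df x m) / (\<phi> x * \<phi> x))"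
      unfolding dg_def using \<phi>
      by (intro FD_eqI has_derivative_add has_derivative_mult has_derivative_mult_right
          has_derivative_divide' D smooth_on_has_derivative[OF smooth_Hess x]
          smooth_on_has_derivative[OF smooth_g x]) simp
    also have "(FD (\<lambda>y. Hess y u w) x m * \<phi> x - Hess x u w * df x m) / (\<phi> x * \<phi> x)
        = FD (\<lambda>y. Hess y u w) x m / \<phi> x - df x m * Hess x u w / (\<phi> x)\<^sup>2"
      using \<phi> by (simp add: diff_divide_distrib power2_eq_square mult.commute)
    finally show ?thesis
      by (simp add: nRic_def nHess_def einstein_polar[OF x] metric_compat[OF x] divide_inverse algebra_simps)
  qed
  define H where "H = Hess x m (grad x)"
  have "(\<Sum>b\<in>Basis. nRic x m b (sharp x b))
      = DIM('a) * FD lam x m + n2 * (FD Lap x m / \<phi> x - df x m * Lap x / (\<phi> x)\<^sup>2)"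
    unfolding nRic Lap_def trace_nHess[OF x, symmetric]
    by (simp add: sum.distrib sum_distrib_left sum_divide_distrib sum_subtractf right_diff_distrib)
  moreover have "(\<Sum>b\<in>Basis. nRic x b m (sharp x b))
      = FD lam x m + n2 * ((FD Lap x m + Ric x m (grad x)) / \<phi> x - H / (\<phi> x)\<^sup>2)"
  proof -
    have "(\<Sum>b\<in>Basis. FD lam x b * g x m (sharp x b)) = FD lam x m"
      using linear_sum_Basis[OF smooth_on_linear_FD[OF smooth_lam x], of m]
      by (simp add: inner_commute mult.commute)
    then show ?thesis
      unfolding nRic H_def div_Hess[OF x, symmetric] Hess_grad[OF x, symmetric]
      by (simp add: sum.distrib sum_distrib_left sum_divide_distrib sum_subtractf right_diff_distrib)
  qed
  moreover have "Ric x m (grad x) = lam x * df x m + n2 / \<phi> x * H"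
    by (simp add: einstein_polar[OF x] H_def sym[of x m] g_grad[OF x])
  ultimately have "DIM('a) * FD lam x m + n2 * (FD Lap x m / \<phi> x - df x m * Lap x / (\<phi> x)\<^sup>2)
    = 2 * (FD lam x m + n2 * ((FD Lap x m + (lam x * df x m + n2 / \<phi> x * H)) / \<phi> x - H / (\<phi> x)\<^sup>2))"
    using contracted_bianchi[OF x, of m] by simp
  then have 1: "(real DIM('a) - 2) * FD lam x m * (\<phi> x)\<^sup>2
    = n2 * (df x m * Lap x + \<phi> x * FD Lap x m + 2 * \<phi> x * lam x * df x m + 2 * n2 * H - 2 * H)"
  proof -
    \<comment> \<open>With the reciprocal as a variable subject to \<open>i * \<phi> x = 1\<close>,
      clearing denominators becomes a polynomial identity.\<close>
    define i where "i = inverse (\<phi> x)"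
    have i: "i * \<phi> x = 1" using \<phi> by (simp add: i_def)
    assume "DIM('a) * FD lam x m + n2 * (FD Lap x m / \<phi> x - df x m * Lap x / (\<phi> x)\<^sup>2)
      = 2 * (FD lam x m + n2 * ((FD Lap x m + (lam x * df x m + n2 / \<phi> x * H)) / \<phi> x - H / (\<phi> x)\<^sup>2))"
    then have "DIM('a) * FD lam x m + n2 * (FD Lap x m * i - df x m * Lap x * i\<^sup>2)
      = 2 * (FD lam x m + n2 * ((FD Lap x m + (lam x * df x m + n2 * i * H)) * i - H * i\<^sup>2))"
      by (simp add: i_def divide_inverse power_inverse)
    with i show ?thesis by algebra
  qed
  have "FD (\<lambda>y. \<phi> y * Lap y + (n2 - 1) * grad2 y + lam y * (\<phi> y)\<^sup>2) x m = FD (\<lambda>y. \<mu>) x m"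
    by (rule fun_cong[OF FD_cong_open[OF open_U x fiber]])
  moreover have "FD (\<lambda>y. \<phi> y * Lap y + (n2 - 1) * grad2 y + lam y * (\<phi> y)\<^sup>2) x m
     = (\<phi> x * FD Lap x m + df x m * Lap x) + (n2 - 1) * FD grad2 x m
       + (lam x * (of_nat 2 * df x m * \<phi> x ^ (2 - 1)) + FD lam x m * (\<phi> x)\<^sup>2)"
    by (intro FD_eqI has_derivative_add has_derivative_mult has_derivative_mult_right
        has_derivative_power D smooth_on_has_derivative[OF smooth_Lap x]
        smooth_on_has_derivative[OF smooth_grad2 x])
  \<comment> \<open>The derivative of the fiber equation evaluates precisely the bracket of fact 1;
    it adds \<open>n2\<close> to the coefficient \<open>DIM('a) - 2\<close> of the derivative of
    \<open>lam\<close>.\<close>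
  ultimately have 2: "df x m * Lap x + \<phi> x * FD Lap x m + 2 * \<phi> x * lam x * df x m + 2 * n2 * H - 2 * H
      = - FD lam x m * (\<phi> x)\<^sup>2"
    by (simp add: FD_grad2[OF x] H_def algebra_simps)
  from 1[unfolded 2] have "(DIM('a) + n2 - 2) * FD lam x m * (\<phi> x)\<^sup>2 = 0"
    by (simp add: algebra_simps)
  then show ?thesis using \<phi> by simp
qed

end

section \<open>Sprays\<close>

text \<open>Transfers the line derivatives \<open>deriv\<close> of the coordinate formulas to
  Frechet derivatives of a function \<open>B\<close> that agrees with \<open>A x\<close> only near
  \<open>y\<close>.\<close>

lemma dy_eqI:
  assumes "open Y" "y \<in> Y" "\<And>y'. y' \<in> Y \<Longrightarrow> A x y' = B y'" "(B has_derivative D) (at y)"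
  shows "dy k A x y = D k"
proof -
  have "(A x has_derivative D) (at y)"
    by (rule has_derivative_transform_within_open[OF assms(4,1,2)]) (simp add: assms(3))
  then have "((\<lambda>s. A x (y + s *\<^sub>R k)) has_real_derivative D k) (at 0)"
    by (intro has_derivative_line_real) simp
  then show ?thesis unfolding dy_def by (rule DERIV_imp_deriv)
qed

lemma dx_eqI:
  assumes "open X" "x \<in> X" "\<And>x'. x' \<in> X \<Longrightarrow> A x' y = B x'" "(B has_derivative D) (at x)"
  shows "dx k A x y = D k"
proof -
  have "((\<lambda>x. A x y) has_derivative D) (at x)"
    by (rule has_derivative_transform_within_open[OF assms(4,1,2)]) (simp add: assms(3))
  then have "((\<lambda>s. A (x + s *\<^sub>R k) y) has_real_derivative D k) (at 0)"
    by (intro has_derivative_line_real[where f = "\<lambda>x. A x y"]) simp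
  then show ?thesis unfolding dx_def by (rule DERIV_imp_deriv)
qed

lemma bounded_linear_Pair_0: "bounded_linear (\<lambda>x. (x, 0))" "bounded_linear (\<lambda>y. (0, y))"
  by (auto intro!: bounded_linear_Pair bounded_linear_ident bounded_linear_zero)

text \<open>Slices and partial derivatives in either variable inherit the smoothness, so that the
  mixed derivatives in spray and curvature exist.\<close>

locale joint_smooth =
  fixes A :: "'e::euclidean_space \<Rightarrow> 'd::euclidean_space \<Rightarrow> 'g::real_normed_vector" and X Y
  assumes open_X: "open X" and open_Y: "open Y"
    and joint: "smooth_on (\<lambda>(x, y). A x y) (X \<times> Y)"
begin

lemma slice_y: "x \<in> X \<Longrightarrow> smooth_on (A x) Y"
  using smooth_on_affine_comp[OF joint open_Y bounded_linear_Pair_0(2), of "(x, 0)"] by simp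

lemma slice_x: "y \<in> Y \<Longrightarrow> smooth_on (\<lambda>x. A x y) X"
  using smooth_on_affine_comp[OF joint open_X bounded_linear_Pair_0(1), of "(0, y)"] by simp

text \<open>A partial derivative is the full derivative in direction \<open>(0, w)\<close>, hence
  jointly smooth again.\<close>

lemma joint_FD_y: "joint_smooth (\<lambda>x y. FD (A x) y w) X Y"
proof
  have o: "open (X \<times> Y)" by (intro open_Times open_X open_Y)
  show "smooth_on (\<lambda>(x, y). FD (A x) y w) (X \<times> Y)"
  proof (rule smooth_on_cong[OF o _ smooth_on_FD[OF joint, of "(0, w)"]], clarify)
    fix x y assume xy: "x \<in> X" "y \<in> Y"
    have "((\<lambda>y. (x, y)) has_derivative (\<lambda>w. (0, w))) (at y)"
      by (auto intro!: derivative_eq_intros)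
    moreover have "((\<lambda>(x, y). A x y) has_derivative FD (\<lambda>(x, y). A x y) (x, y)) (at (x, y))"
      by (rule smooth_on_has_derivative[OF joint]) (use xy in auto)
    ultimately have "((\<lambda>y. (\<lambda>(x, y). A x y) (x, y)) has_derivative
        (\<lambda>w. FD (\<lambda>(x, y). A x y) (x, y) (0, w))) (at y)"
      by (rule has_derivative_compose)
    then show "FD (\<lambda>(x, y). A x y) (x, y) (0, w) = FD (A x) y w"
      by (simp add: FD_eqI)
  qed
qed (rule open_X open_Y)+

lemma joint_FD_x: "joint_smooth (\<lambda>x y. FD (\<lambda>x. A x y) x w) X Y"
proof
  have o: "open (X \<times> Y)" by (intro open_Times open_X open_Y)
  show "smooth_on (\<lambda>(x, y). FD (\<lambda>x. A x y) x w) (X \<times> Y)"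
  proof (rule smooth_on_cong[OF o _ smooth_on_FD[OF joint, of "(w, 0)"]], clarify)
    fix x y assume xy: "x \<in> X" "y \<in> Y"
    have "((\<lambda>x. (x, y)) has_derivative (\<lambda>w. (w, 0))) (at x)"
      by (auto intro!: derivative_eq_intros)
    moreover have "((\<lambda>(x, y). A x y) has_derivative FD (\<lambda>(x, y). A x y) (x, y)) (at (x, y))"
      by (rule smooth_on_has_derivative[OF joint]) (use xy in auto)
    ultimately have "((\<lambda>x. (\<lambda>(x, y). A x y) (x, y)) has_derivative
        (\<lambda>w. FD (\<lambda>(x, y). A x y) (x, y) (w, 0))) (at x)"
      by (rule has_derivative_compose)
    then show "FD (\<lambda>(x, y). A x y) (x, y) (w, 0) = FD (\<lambda>x. A x y) x w"
      by (simp add: FD_eqI)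
  qed
qed (rule open_X open_Y)+

lemma deriv_y: "x \<in> X \<Longrightarrow> y \<in> Y \<Longrightarrow> (A x has_derivative FD (A x) y) (at y)"
  by (rule smooth_on_has_derivative[OF slice_y])

lemma deriv_x: "x \<in> X \<Longrightarrow> y \<in> Y \<Longrightarrow> ((\<lambda>x. A x y) has_derivative FD (\<lambda>x. A x y) x) (at x)"
  by (rule smooth_on_has_derivative[OF slice_x])

end

text \<open>Both sides of the homogeneity relation are differentiated in \<open>y\<close>. The
  factor \<open>t\<close> stays on the left, so the exponent \<open>k - 1\<close> is never
  written.\<close>

lemma FD_homogeneous:
  assumes "\<And>t y. t > 0 \<Longrightarrow> y \<in> Y \<Longrightarrow> B (t *\<^sub>R y) = t ^ k *\<^sub>R B y" "open Y" "\<And>t y. t > 0 \<Longrightarrow> y \<in> Y \<Longrightarrow> t *\<^sub>R y \<in> Y"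
    and B: "\<And>y. y \<in> Y \<Longrightarrow> B differentiable (at y)" and "t > 0" "y \<in> Y"
  shows "t *\<^sub>R FD B (t *\<^sub>R y) w = t ^ k *\<^sub>R FD B y w"
proof -
  have D: "(B has_derivative FD B y) (at y)" if "y \<in> Y" for y
    using B[OF that] by (simp add: frechet_derivative_works)
  have "((\<lambda>y. t *\<^sub>R y) has_derivative (\<lambda>w. t *\<^sub>R w)) (at y)"
    by (intro derivative_intros)
  from has_derivative_compose[OF this D[OF assms(3)]] assms(5,6)
  have "((\<lambda>y. B (t *\<^sub>R y)) has_derivative (\<lambda>w. FD B (t *\<^sub>R y) (t *\<^sub>R w))) (at y)" by auto
  moreover have "((\<lambda>y. B (t *\<^sub>R y)) has_derivative (\<lambda>w. t ^ k *\<^sub>R FD B y w)) (at y)"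
    by (rule has_derivative_transform_within_open[OF has_derivative_scaleR_right[OF D] assms(2)])
      (use assms(1,5,6) in auto)
  ultimately have "FD B (t *\<^sub>R y) (t *\<^sub>R w) = t ^ k *\<^sub>R FD B y w"
    using has_derivative_unique by metis
  then show ?thesis
    using linear_scale[OF linear_frechet_derivative[OF B[OF assms(3)[OF assms(5,6)]]]] by simp
qed

lemma euler_homogeneous:
  assumes "\<And>t. t > 0 \<Longrightarrow> B (t *\<^sub>R y) = t ^ k *\<^sub>R B y" and B: "B differentiable (at y)"
  shows "FD B y y = of_nat k *\<^sub>R B y"
proof -
  have "(B has_derivative FD B y) (at (0 + 1 *\<^sub>R y))"
    using B by (simp add: frechet_derivative_works)
  from has_derivative_line[OF this]
  have 1: "((\<lambda>s. B (s *\<^sub>R y)) has_vector_derivative FD B y y) (at 1)" by simp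
  have "((\<lambda>s. s ^ k *\<^sub>R B y) has_vector_derivative (of_nat k * 1 ^ (k - 1) * 1) *\<^sub>R B y) (at 1)"
    by (auto intro!: derivative_eq_intros simp: has_real_derivative_iff_has_vector_derivative[symmetric])
  then have "((\<lambda>s. B (s *\<^sub>R y)) has_vector_derivative (of_nat k * 1 ^ (k - 1) * 1) *\<^sub>R B y) (at (1::real))"
    by (rule has_vector_derivative_transform_within_open[of _ _ _ "{0<..}"]) (use assms(1) in auto)
  with 1 have "FD B y y = (of_nat k * 1 ^ (k - 1) * 1) *\<^sub>R B y"
    by (rule vector_derivative_unique_at)
  then show ?thesis by simp
qed

section \<open>The spray as the solution of a linear system\<close>

definition fund_map :: "('e::euclidean_space \<Rightarrow> 'e \<Rightarrow> real) \<Rightarrow> 'e \<Rightarrow> 'e \<Rightarrow> 'e \<Rightarrow> 'e" where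
  "fund_map F x y u = (\<Sum>a\<in>Basis. (\<Sum>b\<in>Basis. fund F a b x y * (u \<bullet> b)) *\<^sub>R a)"

definition spray_rhs :: "('e::euclidean_space \<Rightarrow> 'e \<Rightarrow> real) \<Rightarrow> 'e \<Rightarrow> 'e \<Rightarrow> 'e \<Rightarrow> real" where
  "spray_rhs F l x y = 1/4 * ((\<Sum>k\<in>Basis. dx k (dy l (fsq F)) x y * (y \<bullet> k)) - dx l (fsq F) x y)"

definition fund_pos :: "('e::euclidean_space \<Rightarrow> 'e \<Rightarrow> real) \<Rightarrow> 'e \<Rightarrow> 'e \<Rightarrow> bool" where
  "fund_pos F x y \<longleftrightarrow> (\<forall>u. u \<noteq> 0 \<longrightarrow> (\<Sum>i\<in>Basis. \<Sum>j\<in>Basis. fund F i j x y * (u \<bullet> i) * (u \<bullet> j)) > 0)"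

definition spray_vec :: "('e::euclidean_space \<Rightarrow> 'e \<Rightarrow> real) \<Rightarrow> 'e \<Rightarrow> 'e \<Rightarrow> 'e" where
  "spray_vec F x y = (\<Sum>i\<in>Basis. spray F i x y *\<^sub>R i)"

lemma spray_vec_inner: "i \<in> Basis \<Longrightarrow> spray_vec F x y \<bullet> i = spray F i x y"
  by (simp add: spray_vec_def)

lemma linear_fund_map: "linear (fund_map F x y)"
  by (rule linearI) (simp_all add: fund_map_def inner_simps distrib_left sum.distrib scaleR_add_left
      scaleR_sum_right sum_distrib_left mult_ac)

lemma fund_map_pos: "fund_pos F x y \<Longrightarrow> u \<noteq> 0 \<Longrightarrow> fund_map F x y u \<bullet> u > 0"
  by (simp add: fund_map_def fund_pos_def inner_sum_left inner_sum_right sum_distrib_right sum_distrib_left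
      inner_commute[of _ u] mult_ac)

lemma spray_inv: "i \<in> Basis \<Longrightarrow> fund_pos F x y \<Longrightarrow>
  spray F i x y = inv (fund_map F x y) (\<Sum>l\<in>Basis. spray_rhs F l x y *\<^sub>R l) \<bullet> i"
proof -
  assume "fund_pos F x y"
  note L = pos_def_inv_linear[OF linear_fund_map fund_map_pos[OF this]]
  have "(\<lambda>u. \<Sum>a\<in>Basis. (\<Sum>b\<in>Basis. fund F a b x y * (u \<bullet> b)) *\<^sub>R a) = fund_map F x y"
    by (simp add: fun_eq_iff fund_map_def)
  then show ?thesis
    by (simp add: spray_def fund_inv_def linear_sum[OF L] linear_scale[OF L] inner_sum_left
        sum_distrib_left spray_rhs_def mult_ac)
qed

lemma spray_vec_inv: "fund_pos F x y \<Longrightarrow>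
  spray_vec F x y = inv (fund_map F x y) (\<Sum>l\<in>Basis. spray_rhs F l x y *\<^sub>R l)"
  by (rule euclidean_eqI) (simp add: spray_vec_inner spray_inv)

text \<open>\<open>fund_map\<close> is injective, so any candidate solving the linear system is the
  spray. Sprays can thus be verified without computing an inverse fundamental tensor.\<close>

lemma spray_vec_eqI:
  assumes "fund_pos F x y"
    and "\<And>l. l \<in> Basis \<Longrightarrow> (\<Sum>b\<in>Basis. fund F l b x y * (G \<bullet> b)) = spray_rhs F l x y"
  shows "spray_vec F x y = G"
proof -
  have "(\<Sum>l\<in>Basis. spray_rhs F l x y *\<^sub>R l) = fund_map F x y G"
    by (simp add: fund_map_def assms(2))
  then show ?thesis
    by (simp add: spray_vec_inv[OF assms(1)] pos_def_left_inv[OF linear_fund_map fund_map_pos[OF assms(1)]])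
qed

lemma spray_vec_solves:
  assumes "fund_pos F x y" "l \<in> Basis"
  shows "(\<Sum>b\<in>Basis. fund F l b x y * (spray_vec F x y \<bullet> b)) = spray_rhs F l x y"
proof -
  have "fund_map F x y (spray_vec F x y) = (\<Sum>l\<in>Basis. spray_rhs F l x y *\<^sub>R l)"
    by (simp add: spray_vec_inv[OF assms(1)] pos_def_right_inv[OF linear_fund_map fund_map_pos[OF assms(1)]])
  then have "fund_map F x y (spray_vec F x y) \<bullet> l = spray_rhs F l x y"
    using assms(2) by simp
  then show ?thesis using assms(2) by (simp add: fund_map_def)
qed


section \<open>Finsler metrics in a chart\<close>

text \<open>Stated for the square of \<open>F2\<close> away from the zero section, which is all that
  spray and curvature depend on.\<close>

locale finsler_chart =
  fixes V :: "'d::euclidean_space set" and F2 :: "'d \<Rightarrow> 'd \<Rightarrow> real"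
  assumes open_V: "open V"
    and joint_P: "smooth_on (\<lambda>(x, y). fsq F2 x y) (V \<times> - {0})"
    and hom_P: "x \<in> V \<Longrightarrow> y \<noteq> 0 \<Longrightarrow> t > 0 \<Longrightarrow> fsq F2 x (t *\<^sub>R y) = t\<^sup>2 * fsq F2 x y"
    and pos_P: "x \<in> V \<Longrightarrow> y \<noteq> 0 \<Longrightarrow> fund_pos F2 x y"
begin

abbreviation P :: "'d \<Rightarrow> 'd \<Rightarrow> real" where "P \<equiv> fsq F2"

sublocale P: joint_smooth P V "- {0}"
  by unfold_locales (auto simp: open_V joint_P)

sublocale DP: joint_smooth "\<lambda>x y. FD (P x) y w" V "- {0}" for w
  by (rule P.joint_FD_y)

sublocale DDP: joint_smooth "\<lambda>x y. FD (\<lambda>y. FD (P x) y w) y w'" V "- {0}" for w w'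
  by (rule DP.joint_FD_y)

sublocale XDP: joint_smooth "\<lambda>x y. FD (\<lambda>x. FD (P x) y w) x w'" V "- {0}" for w w'
  by (rule DP.joint_FD_x)

sublocale XP: joint_smooth "\<lambda>x y. FD (\<lambda>x. P x y) x w'" V "- {0}" for w'
  by (rule P.joint_FD_x)

lemma dy_P: "x \<in> V \<Longrightarrow> y \<noteq> 0 \<Longrightarrow> dy w P x y = FD (P x) y w"
  by (rule dy_eqI[OF open_UNIV]) (auto intro: P.deriv_y)

lemma dydy_P: "x \<in> V \<Longrightarrow> y \<noteq> 0 \<Longrightarrow> dy w' (dy w P) x y = FD (\<lambda>y. FD (P x) y w) y w'"
  by (rule dy_eqI[of "- {0}"]) (auto intro: DP.deriv_y simp: dy_P)

lemma dxdy_P: "x \<in> V \<Longrightarrow> y \<noteq> 0 \<Longrightarrow> dx w' (dy w P) x y = FD (\<lambda>x. FD (P x) y w) x w'"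
  by (rule dx_eqI[OF open_V]) (auto intro: DP.deriv_x simp: dy_P)

lemma dx_P: "x \<in> V \<Longrightarrow> y \<noteq> 0 \<Longrightarrow> dx w P x y = FD (\<lambda>x. P x y) x w"
  by (rule dx_eqI[OF open_V]) (auto intro: P.deriv_x)

lemma fund_F2: "x \<in> V \<Longrightarrow> y \<noteq> 0 \<Longrightarrow> fund F2 a b x y = FD (\<lambda>y. FD (P x) y b) y a / 2"
  by (simp add: fund_def dydy_P)

lemma spray_rhs_F2: "x \<in> V \<Longrightarrow> y \<noteq> 0 \<Longrightarrow>
  spray_rhs F2 l x y = (FD (\<lambda>x. FD (P x) y l) x y - FD (\<lambda>x. P x y) x l) / 4"
  using linear_sum_Basis[OF smooth_on_linear_FD[OF DP.slice_x, of y x l], of y]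
  by (simp add: spray_rhs_def dxdy_P dx_P mult.commute)

lemma linear_DP: "x \<in> V \<Longrightarrow> y \<noteq> 0 \<Longrightarrow> linear (FD (P x) y)"
  by (rule smooth_on_linear_FD[OF P.slice_y]) auto

lemma DDP_sym: "x \<in> V \<Longrightarrow> y \<noteq> 0 \<Longrightarrow> FD (\<lambda>y. FD (P x) y w) y w' = FD (\<lambda>y. FD (P x) y w') y w"
  by (rule FD_symmetric_real[OF P.open_Y _ P.slice_y]) auto

lemma linear_DDP1: "x \<in> V \<Longrightarrow> y \<noteq> 0 \<Longrightarrow> linear (\<lambda>w'. FD (\<lambda>y. FD (P x) y w) y w')"
  by (rule smooth_on_linear_FD[OF DP.slice_y]) auto

lemma linear_DDP2: "x \<in> V \<Longrightarrow> y \<noteq> 0 \<Longrightarrow> linear (\<lambda>w. FD (\<lambda>y. FD (P x) y w) y w')"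
  using linear_DDP1[of x y w'] by (simp add: DDP_sym[of x y _ w'])

lemma euler_P: "x \<in> V \<Longrightarrow> y \<noteq> 0 \<Longrightarrow> FD (P x) y y = 2 * P x y"
  using euler_homogeneous[of "P x" y 2] smooth_on_differentiable[OF P.slice_y[of x], of y] hom_P
  by auto

lemma hom_DP: "x \<in> V \<Longrightarrow> y \<noteq> 0 \<Longrightarrow> t > 0 \<Longrightarrow> FD (P x) (t *\<^sub>R y) w = t * FD (P x) y w"
  using FD_homogeneous[of "- {0}" "P x" 2 t y w] smooth_on_differentiable[OF P.slice_y[of x]] hom_P
  by (auto simp: power2_eq_square)

lemma euler_DP: "x \<in> V \<Longrightarrow> y \<noteq> 0 \<Longrightarrow> FD (\<lambda>y. FD (P x) y w) y y = FD (P x) y w"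
  using euler_homogeneous[of "\<lambda>y. FD (P x) y w" y 1] hom_DP
    smooth_on_differentiable[OF DP.slice_y[of x w], of y]
  by auto

lemma DDP_diag:
  assumes xy: "x \<in> V" "y \<noteq> 0"
  shows "(\<Sum>i\<in>Basis. \<Sum>j\<in>Basis. fund F2 i j x y * (w \<bullet> i) * (w \<bullet> j)) = FD (\<lambda>z. FD (P x) z w) y w / 2"
proof -
  have "(\<Sum>i\<in>Basis. \<Sum>j\<in>Basis. fund F2 i j x y * (w \<bullet> i) * (w \<bullet> j))
      = (\<Sum>i\<in>Basis. (w \<bullet> i) * (\<Sum>j\<in>Basis. (w \<bullet> j) * FD (\<lambda>y. FD (P x) y j) y i)) / 2"
    by (simp add: fund_F2[OF xy] sum_distrib_left sum_divide_distrib mult_ac)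
  also have "\<dots> = (\<Sum>i\<in>Basis. (w \<bullet> i) * FD (\<lambda>z. FD (P x) z w) y i) / 2"
    using linear_sum_Basis[OF linear_DDP2[OF xy], of w] by simp
  also have "\<dots> = FD (\<lambda>z. FD (P x) z w) y w / 2"
    using linear_sum_Basis[OF linear_DDP1[OF xy], of w w] by simp
  finally show ?thesis .
qed

lemma DDP_pos: "x \<in> V \<Longrightarrow> y \<noteq> 0 \<Longrightarrow> w \<noteq> 0 \<Longrightarrow> FD (\<lambda>z. FD (P x) z w) y w > 0"
  using pos_P[of x y] by (simp add: fund_pos_def DDP_diag)

text \<open>By Euler's relation, used twice, \<open>P x y\<close> is half its second derivative in
  direction \<open>y\<close>, that is, the fundamental tensor evaluated at \<open>y\<close>.\<close>

lemma P_pos: "x \<in> V \<Longrightarrow> y \<noteq> 0 \<Longrightarrow> P x y > 0"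
  using DDP_pos[of x y y] euler_DP[of x y y] euler_P[of x y] by simp

abbreviation S :: "'d \<Rightarrow> 'd \<Rightarrow> 'd" where "S \<equiv> spray_vec F2"

lemma S_equation:
  assumes xy: "x \<in> V" "y \<noteq> 0" and l: "l \<in> Basis"
  shows "FD (\<lambda>z. FD (P x) z (S x y)) y l = (FD (\<lambda>x. FD (P x) y l) x y - FD (\<lambda>x. P x y) x l) / 2"
proof -
  have "FD (\<lambda>z. FD (P x) z (S x y)) y l / 2 = (\<Sum>b\<in>Basis. fund F2 l b x y * (S x y \<bullet> b))"
    using linear_sum_Basis[OF linear_DDP2[OF xy], of "S x y" l]
    by (simp add: fund_F2[OF xy] sum_divide_distrib mult.commute)
  then show ?thesis
    using spray_vec_solves[OF pos_P[OF xy] l] by (simp add: spray_rhs_F2[OF xy])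
qed

text \<open>The spray solves a linear system whose matrix is positive definite and whose entries are
  smooth in both variables.\<close>

sublocale S: joint_smooth S V "- {0}"
proof
  have o: "open (V \<times> - {0::'d})" by (intro open_Times open_V P.open_Y)
  define A where "A = (\<lambda>z. fund_map F2 (fst z) (snd z))"
  define R where "R = (\<lambda>l z. ((\<Sum>k\<in>Basis. FD (\<lambda>x. FD (P x) (snd z) l) (fst z) k * (snd z \<bullet> k))
    - FD (\<lambda>x. P x (snd z)) (fst z) l) / 4)"
  have sm_snd: "smooth_on snd (V \<times> - {0::'d})"
    by (intro smooth_on_bounded_linear o bounded_linear_snd)
  have D: "smooth_on (\<lambda>z. FD (\<lambda>y. FD (P (fst z)) y b) (snd z) a) (V \<times> - {0})" for a b
    using DDP.joint[of b a] by (simp add: case_prod_unfold)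
  have X: "smooth_on (\<lambda>z. FD (\<lambda>x. FD (P x) (snd z) l) (fst z) k) (V \<times> - {0})"
    "smooth_on (\<lambda>z. FD (\<lambda>x. P x (snd z)) (fst z) l) (V \<times> - {0})" for k l
    using XDP.joint[of l k] XP.joint[of l] by (simp_all add: case_prod_unfold)
  have R: "smooth_on (R l) (V \<times> - {0})" for l
    unfolding R_def by (intro smooth_intros o X sm_snd) auto
  have sm: "smooth_on (\<lambda>z. \<Sum>a\<in>Basis. (\<Sum>b\<in>Basis. FD (\<lambda>y. FD (P (fst z)) y b) (snd z) a / 2 * (c \<bullet> b)) *\<^sub>R a)
      (V \<times> - {0})" for c :: 'd
    by (intro smooth_intros o D) auto
  have "smooth_on (\<lambda>z. A z c) (V \<times> - {0})" for c
    by (rule smooth_on_cong[OF o _ sm[of c]], elim SigmaE) (simp add: A_def fund_map_def fund_F2)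
  then have "smooth_on (\<lambda>z. inv (A z) l) (V \<times> - {0})" for l
    unfolding A_def by (intro smooth_on_inv_field[OF o linear_fund_map] fund_map_pos pos_P) auto
  then have "smooth_on (\<lambda>z. \<Sum>l\<in>Basis. R l z *\<^sub>R inv (A z) l) (V \<times> - {0})"
    by (intro smooth_intros o R)
  then show "smooth_on (\<lambda>(x, y). S x y) (V \<times> - {0})"
  proof (rule smooth_on_cong[OF o, rotated])
    fix z assume "z \<in> V \<times> - {0::'d}"
    then obtain x y where z: "z = (x, y)" and "x \<in> V" "y \<noteq> 0" by auto
    note L = pos_def_inv_linear[OF linear_fund_map fund_map_pos[OF pos_P[OF \<open>x \<in> V\<close> \<open>y \<noteq> 0\<close>]]]
    have "R l (x, y) = spray_rhs F2 l x y" for l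
      using \<open>x \<in> V\<close> \<open>y \<noteq> 0\<close> by (simp add: R_def spray_rhs_def dxdy_P dx_P)
    then show "(\<Sum>l\<in>Basis. R l z *\<^sub>R inv (A z) l) = (case z of (x, y) \<Rightarrow> S x y)"
      unfolding z using \<open>x \<in> V\<close> \<open>y \<noteq> 0\<close>
      by (simp add: spray_vec_inv pos_P A_def linear_sum[OF L] linear_scale[OF L])
  qed
qed (auto simp: open_V)

sublocale DS: joint_smooth "\<lambda>x y. FD (S x) y w" V "- {0}" for w
  by (rule S.joint_FD_y)

text \<open>The fundamental tensor is homogeneous of degree 0 and the right side of degree 2, so
  \<open>t^2 S x y\<close> solves the system at \<open>t y\<close>.\<close>

lemma hom_S:
  assumes xy: "x \<in> V" "y \<noteq> 0" and t: "t > 0"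
  shows "S x (t *\<^sub>R y) = t\<^sup>2 *\<^sub>R S x y"
proof (rule spray_vec_eqI)
  have ty: "t *\<^sub>R y \<noteq> 0" using xy t by simp
  show "fund_pos F2 x (t *\<^sub>R y)" by (rule pos_P[OF xy(1) ty])
  fix l :: 'd assume l: "l \<in> Basis"
  have "fund F2 l b x (t *\<^sub>R y) = fund F2 l b x y" for b
    using FD_homogeneous[of "- {0}" "\<lambda>y. FD (P x) y b" 1 t y l] hom_DP xy t
      smooth_on_differentiable[OF DP.slice_y[OF xy(1)]]
    by (auto simp: fund_F2[OF xy] fund_F2[OF xy(1) ty])
  then have "(\<Sum>b\<in>Basis. fund F2 l b x (t *\<^sub>R y) * (t\<^sup>2 *\<^sub>R S x y \<bullet> b))
      = t\<^sup>2 * (\<Sum>b\<in>Basis. fund F2 l b x y * (S x y \<bullet> b))"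
    by (simp add: sum_distrib_left mult_ac)
  also have "\<dots> = t\<^sup>2 * spray_rhs F2 l x y"
    by (simp only: spray_vec_solves[OF pos_P[OF xy] l])
  also have "\<dots> = spray_rhs F2 l x (t *\<^sub>R y)"
  proof -
    have y: "y \<in> - {0}" using xy by simp
    have "FD (\<lambda>x. FD (P x) (t *\<^sub>R y) l) x w = FD (\<lambda>x. t * FD (P x) y l) x w" for w
      by (rule fun_cong[OF FD_cong_open[OF open_V xy(1)]]) (use hom_DP xy t in auto)
    also have "\<dots> w = t * FD (\<lambda>x. FD (P x) y l) x w" for w
      by (intro FD_eqI has_derivative_mult_right DP.deriv_x[OF xy(1) y])
    finally have 1: "FD (\<lambda>x. FD (P x) (t *\<^sub>R y) l) x (t *\<^sub>R y) = t * (t * FD (\<lambda>x. FD (P x) y l) x y)"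
      using linear_scale[OF smooth_on_linear_FD[OF DP.slice_x[OF y] xy(1)]] by simp
    have "FD (\<lambda>x. P x (t *\<^sub>R y)) x l = FD (\<lambda>x. t\<^sup>2 * P x y) x l"
      by (rule fun_cong[OF FD_cong_open[OF open_V xy(1)]]) (use hom_P xy t in auto)
    also have "\<dots> = t\<^sup>2 * FD (\<lambda>x. P x y) x l"
      by (intro FD_eqI has_derivative_mult_right P.deriv_x[OF xy(1) y])
    finally show ?thesis
      by (simp add: spray_rhs_F2[OF xy] spray_rhs_F2[OF xy(1) ty] 1 power2_eq_square algebra_simps)
  qed
  finally show "(\<Sum>b\<in>Basis. fund F2 l b x (t *\<^sub>R y) * (t\<^sup>2 *\<^sub>R S x y \<bullet> b)) = spray_rhs F2 l x (t *\<^sub>R y)" .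
qed

lemma hom_DS: "x \<in> V \<Longrightarrow> y \<noteq> 0 \<Longrightarrow> t > 0 \<Longrightarrow> FD (S x) (t *\<^sub>R y) w = t *\<^sub>R FD (S x) y w"
proof -
  assume "x \<in> V" "y \<noteq> 0" "t > 0"
  then have "t *\<^sub>R FD (S x) (t *\<^sub>R y) w = t *\<^sub>R (t *\<^sub>R FD (S x) y w)"
    using FD_homogeneous[of "- {0}" "S x" 2 t y w] smooth_on_differentiable[OF S.slice_y[of x]] hom_S P.open_Y
    by (auto simp: power2_eq_square)
  then show ?thesis using \<open>t > 0\<close> by (simp only: scaleR_cancel_left) simp
qed

lemma euler_DS: "x \<in> V \<Longrightarrow> y \<noteq> 0 \<Longrightarrow> FD (\<lambda>y. FD (S x) y w) y y = FD (S x) y w"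
  using euler_homogeneous[of "\<lambda>y. FD (S x) y w" y 1] hom_DS
    smooth_on_differentiable[OF DS.slice_y[of x w], of y]
  by auto

lemma linear_DS: "x \<in> V \<Longrightarrow> y \<noteq> 0 \<Longrightarrow> linear (FD (S x) y)"
  by (rule smooth_on_linear_FD[OF S.slice_y]) auto

lemma linear_DDS: "x \<in> V \<Longrightarrow> y \<noteq> 0 \<Longrightarrow> linear (FD (\<lambda>y. FD (S x) y w) y)"
  by (rule smooth_on_linear_FD[OF DS.slice_y]) auto

lemma linear_XDS: "x \<in> V \<Longrightarrow> y \<noteq> 0 \<Longrightarrow> linear (FD (\<lambda>x. FD (S x) y w) x)"
  by (rule smooth_on_linear_FD[OF DS.slice_x]) auto

context
  fixes i :: 'd assumes i: "i \<in> Basis"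
begin

lemma dy_S: "x \<in> V \<Longrightarrow> y \<noteq> 0 \<Longrightarrow> dy w (spray F2 i) x y = FD (S x) y w \<bullet> i"
  by (rule dy_eqI[OF P.open_Y _ _ has_derivative_inner_left[OF S.deriv_y]]) (simp_all add: spray_vec_inner[OF i])

lemma dx_S: "x \<in> V \<Longrightarrow> y \<noteq> 0 \<Longrightarrow> dx w (spray F2 i) x y = FD (\<lambda>x. S x y) x w \<bullet> i"
  by (rule dx_eqI[OF open_V _ _ has_derivative_inner_left[OF S.deriv_x]]) (simp_all add: spray_vec_inner[OF i])

lemma dydy_S: "x \<in> V \<Longrightarrow> y \<noteq> 0 \<Longrightarrow>
    dy w' (dy w (spray F2 i)) x y = FD (\<lambda>y. FD (S x) y w) y w' \<bullet> i"
  by (rule dy_eqI[OF P.open_Y _ _ has_derivative_inner_left[OF DS.deriv_y]]) (simp_all add: dy_S)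

lemma dxdy_S: "x \<in> V \<Longrightarrow> y \<noteq> 0 \<Longrightarrow>
    dx w' (dy w (spray F2 i)) x y = FD (\<lambda>x. FD (S x) y w) x w' \<bullet> i"
  by (rule dx_eqI[OF open_V _ _ has_derivative_inner_left[OF DS.deriv_x]]) (simp_all add: dy_S)

end

text \<open>By linearity each sum over \<open>j\<close> is a derivative in the direction of one
  vector: \<open>y\<close>, \<open>S x y\<close> or \<open>FD (S x) y i\<close>.\<close>

lemma Riem_F2:
  assumes xy: "x \<in> V" "y \<noteq> 0" and i: "i \<in> Basis"
  shows "Riem F2 i i x y = (2 *\<^sub>R FD (\<lambda>x. S x y) x i - FD (\<lambda>x. FD (S x) y i) x y
    + 2 *\<^sub>R FD (\<lambda>y. FD (S x) y i) y (S x y) - FD (S x) y (FD (S x) y i)) \<bullet> i"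
proof -
  have "(\<Sum>j\<in>Basis. (y \<bullet> j) * (FD (\<lambda>x. FD (S x) y i) x j \<bullet> i)) = FD (\<lambda>x. FD (S x) y i) x y \<bullet> i"
    by (simp add: linear_sum_Basis[OF linear_XDS[OF xy, of i], of y] inner_sum_left)
  moreover have "(\<Sum>j\<in>Basis. (S x y \<bullet> j) * (FD (\<lambda>y. FD (S x) y i) y j \<bullet> i))
      = FD (\<lambda>y. FD (S x) y i) y (S x y) \<bullet> i"
    by (simp add: linear_sum_Basis[OF linear_DDS[OF xy, of i], of "S x y"] inner_sum_left)
  moreover have "(\<Sum>j\<in>Basis. (FD (S x) y j \<bullet> i) * (FD (S x) y i \<bullet> j)) = FD (S x) y (FD (S x) y i) \<bullet> i"
    by (simp add: linear_sum_Basis[OF linear_DS[OF xy], of "FD (S x) y i"] inner_sum_left mult.commute)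
  ultimately show ?thesis
    by (simp add: Riem_def dx_S dy_S dxdy_S dydy_S i xy inner_simps spray_vec_inner[symmetric])
qed

lemma E_curv_F2:
  assumes xy: "x \<in> V" "y \<noteq> 0"
  shows "E_curv F2 i j x y = FD (\<lambda>y. FD (\<lambda>y. \<Sum>s\<in>Basis. FD (S x) y s \<bullet> s) y j) y i / 2"
proof -
  let ?T = "\<lambda>y. \<Sum>s\<in>Basis. FD (S x) y s \<bullet> s"
  have T: "smooth_on ?T (- {0})"
    by (intro smooth_intros P.open_Y DS.slice_y xy)
  have "dy j (\<lambda>x y. \<Sum>s\<in>Basis. dy s (spray F2 s) x y) x y = FD ?T y j" if "y \<noteq> 0" for y
    by (rule dy_eqI[OF P.open_Y, where B = ?T])
      (use that xy in \<open>auto simp: dy_S intro!: smooth_on_has_derivative[OF T]\<close>)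
  then have "dy i (dy j (\<lambda>x y. \<Sum>s\<in>Basis. dy s (spray F2 s) x y)) x y = FD (\<lambda>y. FD ?T y j) y i"
    by (rule dy_eqI[OF P.open_Y, where B = "\<lambda>y. FD ?T y j", rotated])
      (use xy in \<open>auto intro!: smooth_on_has_derivative[OF smooth_on_FD[OF T]]\<close>)
  then show ?thesis by (simp add: E_curv_def)
qed

end

section \<open>Warped products in a chart\<close>

lemma has_derivative_fst_comp:
  "(B has_derivative D) (at (fst y)) \<Longrightarrow> ((\<lambda>y. B (fst y)) has_derivative (\<lambda>k. D (fst k))) (at y)"
  by (rule has_derivative_compose[OF has_derivative_fst[OF has_derivative_ident]])

lemma has_derivative_snd_comp:
  "(B has_derivative D) (at (snd y)) \<Longrightarrow> ((\<lambda>y. B (snd y)) has_derivative (\<lambda>k. D (snd k))) (at y)"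
  by (rule has_derivative_compose[OF has_derivative_snd[OF has_derivative_ident]])

lemma linear_has_derivative:
  fixes B :: "'e::euclidean_space \<Rightarrow> 'g::real_normed_vector"
  shows "linear B \<Longrightarrow> (B has_derivative B) (at y)"
  by (simp add: bounded_linear_imp_has_derivative linear_conv_bounded_linear)

lemma bilinear_has_derivative:
  fixes B :: "'e::euclidean_space \<Rightarrow> 'e \<Rightarrow> 'g::real_normed_vector"
  assumes "bilinear B"
  shows "((\<lambda>u. B u u) has_derivative (\<lambda>k. B u k + B k u)) (at u)"
  using bounded_bilinear.FDERIV[OF bilinear_conv_bounded_bilinear[THEN iffD1, OF assms]
      has_derivative_ident has_derivative_ident] by simp

locale warped_chart = riem_fun U g \<phi> + finsler_chart V F2
  for U :: "'e::euclidean_space set" and g \<phi> and V :: "'d::euclidean_space set" and F2 +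
  fixes L :: "'e \<times> 'd \<Rightarrow> 'e \<times> 'd \<Rightarrow> real"
  assumes \<phi>_pos: "x \<in> U \<Longrightarrow> \<phi> x > 0"
    and L: "x1 \<in> U \<Longrightarrow> x2 \<in> V \<Longrightarrow> fsq L (x1, x2) (u, v) = g x1 u u + (\<phi> x1)\<^sup>2 * P x2 v"
begin

text \<open>The base metric is Riemannian, so its square is smooth at \<open>u = 0\<close> as well;
  only the fiber component must be nonzero.\<close>

definition Y :: "('e \<times> 'd) set" where "Y = UNIV \<times> (- {0})"

lemma open_Y: "open Y"
  unfolding Y_def by (intro open_Times open_UNIV P.open_Y)

lemma in_Y: "v \<noteq> 0 \<Longrightarrow> (u, v) \<in> Y"
  by (simp add: Y_def)

lemma in_W: "x1 \<in> U \<Longrightarrow> x2 \<in> V \<Longrightarrow> (x1, x2) \<in> U \<times> V"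
  by simp

lemma nonzero: "v \<noteq> 0 \<Longrightarrow> v \<in> - {0 :: 'd}"
  by simp

lemma Y_cases: "y \<in> Y \<Longrightarrow> (\<And>u v. y = (u, v) \<Longrightarrow> v \<noteq> 0 \<Longrightarrow> thesis) \<Longrightarrow> thesis"
  by (auto simp: Y_def)

lemma open_W: "open (U \<times> V)"
  by (intro open_Times open_U open_V)

lemma bilinear_Gam: "x \<in> U \<Longrightarrow> bilinear (Gam x)"
  using linear_Gam1 linear_Gam2 by (auto simp: bilinear_def)

lemma \<phi>_deriv: "x \<in> U \<Longrightarrow> (\<phi> has_derivative df x) (at x)"
  using smooth_on_has_derivative[OF smooth_\<phi>] by (simp add: df_def[abs_def])

lemma g_deriv: "x \<in> U \<Longrightarrow> ((\<lambda>x. g x u w) has_derivative (\<lambda>k. dg x k u w)) (at x)"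
  using smooth_on_has_derivative[OF smooth_g] by (simp add: dg_def)

context
  fixes x1 :: 'e and x2 :: 'd and u :: 'e and v :: 'd
  assumes x1: "x1 \<in> U" and x2: "x2 \<in> V" and v: "v \<noteq> 0"
begin

lemma dy_L: "dy w (fsq L) (x1, x2) (u, v) = 2 * g x1 u (fst w) + (\<phi> x1)\<^sup>2 * FD (P x2) v (snd w)"
proof -
  have D: "((\<lambda>y. g x1 (fst y) (fst y) + (\<phi> x1)\<^sup>2 * P x2 (snd y)) has_derivative
      (\<lambda>k. (g x1 (fst (u, v)) (fst k) + g x1 (fst k) (fst (u, v))) + (\<phi> x1)\<^sup>2 * FD (P x2) (snd (u, v)) (snd k))) (at (u, v))"
    by (intro has_derivative_add has_derivative_mult_right
        has_derivative_fst_comp[of "\<lambda>u. g x1 u u"] has_derivative_snd_comp[of "P x2"]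
        bilinear_has_derivative bil P.deriv_y) (use x2 v in auto)
  show ?thesis
    by (rule trans[OF dy_eqI[OF open_Y in_Y[OF v] _ D]], elim Y_cases)
      (simp_all add: L[OF x1 x2] sym[of x1 _ u])
qed

lemma dx_L: "dx w (fsq L) (x1, x2) (u, v) = dg x1 (fst w) u u
    + 2 * \<phi> x1 * df x1 (fst w) * P x2 v + (\<phi> x1)\<^sup>2 * FD (\<lambda>x. P x v) x2 (snd w)"
proof -
  have D: "((\<lambda>x. g (fst x) u u + (\<phi> (fst x))\<^sup>2 * P (snd x) v) has_derivative
      (\<lambda>k. dg x1 (fst k) u u + ((\<phi> (fst (x1, x2)))\<^sup>2 * FD (\<lambda>x. P x v) x2 (snd k)
        + (of_nat 2 * df x1 (fst k) * \<phi> (fst (x1, x2)) ^ (2 - 1)) * P (snd (x1, x2)) v))) (at (x1, x2))"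
    by (intro has_derivative_add has_derivative_mult has_derivative_power
        has_derivative_fst_comp[of "\<lambda>x. g x u u"] has_derivative_fst_comp[of \<phi>]
        has_derivative_snd_comp[of "\<lambda>x. P x v"])
      (use g_deriv[OF x1] \<phi>_deriv[OF x1] P.deriv_x[OF x2 nonzero[OF v]] in auto)
  show ?thesis
    by (rule trans[OF dx_eqI[OF open_W in_W[OF x1 x2] _ D]], elim SigmaE) (simp_all add: L)
qed

end

context
  fixes x1 :: 'e and x2 :: 'd and u :: 'e and v :: 'd
  assumes x1: "x1 \<in> U" and x2: "x2 \<in> V" and v: "v \<noteq> 0"
begin

lemma dydy_L: "dy w' (dy w (fsq L)) (x1, x2) (u, v)
    = 2 * g x1 (fst w') (fst w) + (\<phi> x1)\<^sup>2 * FD (\<lambda>v. FD (P x2) v (snd w)) v (snd w')"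
proof -
  have D: "((\<lambda>y. 2 * g x1 (fst y) (fst w) + (\<phi> x1)\<^sup>2 * FD (P x2) (snd y) (snd w)) has_derivative
      (\<lambda>k. 2 * g x1 (fst k) (fst w) + (\<phi> x1)\<^sup>2 * FD (\<lambda>v. FD (P x2) v (snd w)) (snd (u, v)) (snd k))) (at (u, v))"
    by (intro has_derivative_add has_derivative_mult_right
        has_derivative_fst_comp[of "\<lambda>u. g x1 u (fst w)"] has_derivative_snd_comp[of "\<lambda>v. FD (P x2) v (snd w)"]
        linear_has_derivative linear_g1 DP.deriv_y) (use x2 v in auto)
  show ?thesis
    by (rule trans[OF dy_eqI[OF open_Y in_Y[OF v] _ D]], elim Y_cases) (simp_all add: dy_L[OF x1 x2])
qed

lemma dxdy_L: "dx w' (dy w (fsq L)) (x1, x2) (u, v) = 2 * dg x1 (fst w') u (fst w)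
    + 2 * \<phi> x1 * df x1 (fst w') * FD (P x2) v (snd w) + (\<phi> x1)\<^sup>2 * FD (\<lambda>x. FD (P x) v (snd w)) x2 (snd w')"
proof -
  have D: "((\<lambda>x. 2 * g (fst x) u (fst w) + (\<phi> (fst x))\<^sup>2 * FD (P (snd x)) v (snd w)) has_derivative
      (\<lambda>k. 2 * dg x1 (fst k) u (fst w) + ((\<phi> (fst (x1, x2)))\<^sup>2 * FD (\<lambda>x. FD (P x) v (snd w)) x2 (snd k)
        + (of_nat 2 * df x1 (fst k) * \<phi> (fst (x1, x2)) ^ (2 - 1)) * FD (P (snd (x1, x2))) v (snd w)))) (at (x1, x2))"
    by (intro has_derivative_add has_derivative_mult has_derivative_mult_right has_derivative_power
        has_derivative_fst_comp[of "\<lambda>x. g x u (fst w)"] has_derivative_fst_comp[of \<phi>]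
        has_derivative_snd_comp[of "\<lambda>x. FD (P x) v (snd w)"])
      (use g_deriv[OF x1] \<phi>_deriv[OF x1] DP.deriv_x[OF x2 nonzero[OF v]] in auto)
  show ?thesis
    by (rule trans[OF dx_eqI[OF open_W in_W[OF x1 x2] _ D]], elim SigmaE) (simp_all add: dy_L v)
qed

lemma fund_L: "fund L a b (x1, x2) (u, v)
    = g x1 (fst a) (fst b) + (\<phi> x1)\<^sup>2 * FD (\<lambda>v. FD (P x2) v (snd b)) v (snd a) / 2"
  by (simp add: fund_def dydy_L)

lemma linear_fund_L:
  "linear (\<lambda>b. fund L a b (x1, x2) (u, v))" "linear (\<lambda>a. fund L a b (x1, x2) (u, v))"
  unfolding fund_L
  by (auto intro!: linearI simp: g_simps linear_add[OF linear_DDP2[OF x2 v]] linear_scale[OF linear_DDP2[OF x2 v]]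
      linear_add[OF linear_DDP1[OF x2 v]] linear_scale[OF linear_DDP1[OF x2 v]] algebra_simps add_divide_distrib)

lemma fund_pos_L: "fund_pos L (x1, x2) (u, v)"
  unfolding fund_pos_def
proof (intro allI impI)
  fix w :: "'e \<times> 'd" assume w: "w \<noteq> 0"
  have "(\<Sum>i\<in>Basis. \<Sum>j\<in>Basis. fund L i j (x1, x2) (u, v) * (w \<bullet> i) * (w \<bullet> j))
      = (\<Sum>i\<in>Basis. (w \<bullet> i) * (\<Sum>j\<in>Basis. (w \<bullet> j) * fund L i j (x1, x2) (u, v)))"
    by (simp add: sum_distrib_left mult_ac)
  also have "\<dots> = (\<Sum>i\<in>Basis. (w \<bullet> i) * fund L i w (x1, x2) (u, v))"
    using linear_sum_Basis[OF linear_fund_L(1), of _ w] by simp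
  also have "\<dots> = fund L w w (x1, x2) (u, v)"
    using linear_sum_Basis[OF linear_fund_L(2), of w w] by simp
  finally have eq: "(\<Sum>i\<in>Basis. \<Sum>j\<in>Basis. fund L i j (x1, x2) (u, v) * (w \<bullet> i) * (w \<bullet> j))
      = g x1 (fst w) (fst w) + (\<phi> x1)\<^sup>2 * FD (\<lambda>v. FD (P x2) v (snd w)) v (snd w) / 2"
    by (simp add: fund_L)
  have z: "FD (\<lambda>v. FD (P x2) v z) v z \<ge> 0" for z
    using DDP_pos[OF x2 v, of z] linear_0[OF linear_DDP1[OF x2 v], of 0] by (cases "z = 0") auto
  show "(\<Sum>i\<in>Basis. \<Sum>j\<in>Basis. fund L i j (x1, x2) (u, v) * (w \<bullet> i) * (w \<bullet> j)) > 0"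
  proof (cases "fst w = 0")
    case True
    then have "snd w \<noteq> 0" using w by (simp add: prod_eq_iff)
    then show ?thesis unfolding eq using DDP_pos[OF x2 v, of "snd w"] \<phi>_pos[OF x1] True by (simp add: g_simps)
  next
    case False
    then show ?thesis unfolding eq using z[of "snd w"] pos[of "fst w" x1]
      by (intro add_pos_nonneg) auto
  qed
qed

lemma spray_rhs_L: "spray_rhs L l (x1, x2) (u, v) = (2 * dg x1 u u (fst l) - dg x1 (fst l) u u
    + 2 * \<phi> x1 * df x1 u * FD (P x2) v (snd l) - 2 * \<phi> x1 * df x1 (fst l) * P x2 v
    + (\<phi> x1)\<^sup>2 * (FD (\<lambda>x. FD (P x) v (snd l)) x2 v - FD (\<lambda>x. P x v) x2 (snd l))) / 4"
proof -
  have "linear (\<lambda>k. dx k (dy l (fsq L)) (x1, x2) (u, v))"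
    unfolding dxdy_L
    using linear_dg1[OF x1, of u "fst l"] linear_df[OF x1]
      smooth_on_linear_FD[OF DP.slice_x[OF nonzero[OF v]] x2, of "snd l"]
    by (auto intro!: linearI simp: linear_iff algebra_simps)
  from linear_sum_Basis[OF this, of "(u, v)"]
  have "(\<Sum>k\<in>Basis. dx k (dy l (fsq L)) (x1, x2) (u, v) * ((u, v) \<bullet> k)) = dx (u, v) (dy l (fsq L)) (x1, x2) (u, v)"
    by (simp add: mult.commute)
  then show ?thesis
    by (simp add: spray_rhs_def dxdy_L dx_L[OF x1 x2 v] algebra_simps)
qed

text \<open>The candidate is checked in the linear system: in base directions by the Koszul formula
  and the defining property of the gradient, in fiber directions by the spray equation of
  \<open>F2\<close> and Euler's relation for the radial vector \<open>v\<close>.\<close>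

lemma spray_vec_L: "spray_vec L (x1, x2) (u, v) =
    ((1/2) *\<^sub>R (Gam x1 u u - (\<phi> x1 * P x2 v) *\<^sub>R grad x1), S x2 v + (df x1 u / \<phi> x1) *\<^sub>R v)"
  (is "_ = (?G1, ?G2)")
proof (rule spray_vec_eqI[OF fund_pos_L])
  fix l :: "'e \<times> 'd" assume l: "l \<in> Basis"
  \<comment> \<open>Basis vectors of the base have \<open>snd l = 0\<close>, where the fiber
    equation degenerates to \<open>0 = 0\<close>.\<close>
  have lsum: "FD (\<lambda>z. FD (P x2) z (S x2 v)) v (snd l)
      = (FD (\<lambda>x. FD (P x) v (snd l)) x2 v - FD (\<lambda>x. P x v) x2 (snd l)) / 2"
  proof (cases "snd l = 0")
    case True
    have "FD (\<lambda>x. FD (P x) v 0) x2 = FD (\<lambda>x. 0) x2"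
      by (rule FD_cong_open[OF open_V x2]) (use linear_0[OF linear_DP[OF _ v]] in auto)
    then show ?thesis
      using True linear_0[OF linear_DDP1[OF x2 v]] linear_0[OF smooth_on_linear_FD[OF P.slice_x[OF nonzero[OF v]] x2]]
      by simp
  next
    case False
    then have "snd l \<in> Basis" using l by (auto simp: Basis_prod_def)
    then show ?thesis by (rule S_equation[OF x2 v])
  qed
  have "(\<Sum>b\<in>Basis. fund L l b (x1, x2) (u, v) * ((?G1, ?G2) \<bullet> b)) = fund L l (?G1, ?G2) (x1, x2) (u, v)"
    using linear_sum_Basis[OF linear_fund_L(1), of l "(?G1, ?G2)"] by (simp add: mult.commute)
  also have "\<dots> = g x1 (fst l) ?G1 + (\<phi> x1)\<^sup>2 * FD (\<lambda>v. FD (P x2) v ?G2) v (snd l) / 2"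
    by (simp add: fund_L)
  also have "g x1 (fst l) ?G1 = (2 * dg x1 u u (fst l) - dg x1 (fst l) u u) / 4 - \<phi> x1 * P x2 v * df x1 (fst l) / 2"
    by (simp add: sym[of x1 "fst l"] g_simps koszul[OF x1] g_grad[OF x1] field_simps)
  also have "FD (\<lambda>z. FD (P x2) z ?G2) v (snd l)
      = FD (\<lambda>z. FD (P x2) z (S x2 v)) v (snd l) + (df x1 u / \<phi> x1) * FD (\<lambda>z. FD (P x2) z v) v (snd l)"
    by (simp add: linear_add[OF linear_DDP2[OF x2 v]] linear_scale[OF linear_DDP2[OF x2 v]])
  also have "FD (\<lambda>z. FD (P x2) z v) v (snd l) = FD (P x2) v (snd l)"
    using DDP_sym[OF x2 v, of v "snd l"] euler_DP[OF x2 v, of "snd l"] by simp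
  finally show "(\<Sum>b\<in>Basis. fund L l b (x1, x2) (u, v) * ((?G1, ?G2) \<bullet> b)) = spray_rhs L l (x1, x2) (u, v)"
  proof -
    define q where "q = df x1 u / \<phi> x1"
    have q: "df x1 u = q * \<phi> x1" using \<phi>_pos[OF x1] by (simp add: q_def)
    assume "(\<Sum>b\<in>Basis. fund L l b (x1, x2) (u, v) * ((?G1, ?G2) \<bullet> b))
      = (2 * dg x1 u u (fst l) - dg x1 (fst l) u u) / 4 - \<phi> x1 * P x2 v * df x1 (fst l) / 2
        + (\<phi> x1)\<^sup>2 * (FD (\<lambda>z. FD (P x2) z (S x2 v)) v (snd l) + (df x1 u / \<phi> x1) * FD (P x2) v (snd l)) / 2"
    then show ?thesis
      unfolding lsum spray_rhs_L q_def[symmetric] unfolding q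
      by (simp add: algebra_simps power2_eq_square add_divide_distrib diff_divide_distrib)
  qed
qed

end

end

lemma sum_Basis_prod:
  "sum f (Basis :: ('a::euclidean_space \<times> 'b::euclidean_space) set)
    = (\<Sum>i\<in>Basis. f (i, 0)) + (\<Sum>i\<in>Basis. f (0, i))"
proof -
  have "inj_on (\<lambda>u. (u::'a, 0::'b)) Basis" "inj_on (\<lambda>u. (0::'a, u::'b)) Basis"
    by (auto intro!: inj_onI Pair_inject)
  then show ?thesis
    unfolding Basis_prod_def by (subst sum.union_disjoint) (auto simp: sum.reindex)
qed

section \<open>Curvature of the warped product\<close>

context warped_chart
begin

text \<open>The derivative of \<open>ln \<phi>\<close> in direction \<open>u\<close>.\<close>

definition q :: "'e \<Rightarrow> 'e \<Rightarrow> real" where "q x u = df x u / \<phi> x"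

lemma linear_q: "x \<in> U \<Longrightarrow> linear (q x)"
  by (rule linearI) (simp_all add: q_def linear_add[OF linear_df] linear_scale[OF linear_df] add_divide_distrib)

lemma q_deriv:
  assumes "x \<in> U"
  shows "((\<lambda>x. q x u) has_derivative (\<lambda>k. ddf x u k / \<phi> x - df x u * df x k / (\<phi> x)\<^sup>2)) (at x)"
proof -
  have "((\<lambda>x. q x u) has_derivative (\<lambda>k. (ddf x u k * \<phi> x - df x u * df x k) / (\<phi> x * \<phi> x))) (at x)"
    unfolding q_def ddf_def using \<phi>_pos[OF assms]
    by (intro has_derivative_divide' \<phi>_deriv assms smooth_on_has_derivative[OF smooth_df]) auto
  moreover have "(ddf x u k * \<phi> x - df x u * df x k) / (\<phi> x * \<phi> x) = ddf x u k / \<phi> x - df x u * df x k / (\<phi> x)\<^sup>2" for k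
    using \<phi>_pos[OF assms] by (simp add: diff_divide_distrib power2_eq_square)
  ultimately show ?thesis by simp
qed

lemma Gam_deriv: "x \<in> U \<Longrightarrow> ((\<lambda>x. Gam x u w) has_derivative (\<lambda>k. dGam x k u w)) (at x)"
  by (rule smooth_on_has_derivative[OF smooth_Gam])

text \<open>Half the gradient of \<open>\<phi>^2\<close>.\<close>

definition pgrad :: "'e \<Rightarrow> 'e" where "pgrad x = \<phi> x *\<^sub>R grad x"

lemma pgrad_deriv:
  assumes "x \<in> U"
  shows "(pgrad has_derivative (\<lambda>k. \<phi> x *\<^sub>R FD grad x k + df x k *\<^sub>R grad x)) (at x)"
  unfolding pgrad_def[abs_def]
  by (intro has_derivative_scaleR \<phi>_deriv assms smooth_on_has_derivative[OF smooth_grad])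

lemma spray_L:
  assumes "x1 \<in> U" "x2 \<in> V" "v \<noteq> 0" "i \<in> Basis"
  shows "spray L i (x1, x2) (u, v)
    = (1/2) * ((Gam x1 u u - P x2 v *\<^sub>R pgrad x1) \<bullet> fst i) + (S x2 v + q x1 u *\<^sub>R v) \<bullet> snd i"
  using spray_vec_inner[OF assms(4), of L "(x1, x2)" "(u, v)"]
  by (simp add: spray_vec_L[OF assms(1-3)] inner_prod_def q_def pgrad_def mult.commute)

context
  fixes x1 :: 'e and x2 :: 'd and u :: 'e and v :: 'd
  assumes x1: "x1 \<in> U" and x2: "x2 \<in> V" and v: "v \<noteq> 0"
begin

lemma dy_spray_L:
  assumes i: "i \<in> Basis"
  shows "dy k (spray L i) (x1, x2) (u, v)
    = (Gam x1 u (fst k) - (FD (P x2) v (snd k) / 2) *\<^sub>R pgrad x1) \<bullet> fst i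
      + (FD (S x2) v (snd k) + q x1 (fst k) *\<^sub>R v + q x1 u *\<^sub>R snd k) \<bullet> snd i"
proof -
  have D: "((\<lambda>y. (1/2) * ((Gam x1 (fst y) (fst y) - P x2 (snd y) *\<^sub>R pgrad x1) \<bullet> fst i)
        + (S x2 (snd y) + q x1 (fst y) *\<^sub>R snd y) \<bullet> snd i) has_derivative
      (\<lambda>k. (1/2) * (((Gam x1 (fst (u, v)) (fst k) + Gam x1 (fst k) (fst (u, v)))
          - FD (P x2) (snd (u, v)) (snd k) *\<^sub>R pgrad x1) \<bullet> fst i)
        + (FD (S x2) (snd (u, v)) (snd k)
          + (q x1 (fst (u, v)) *\<^sub>R snd k + q x1 (fst k) *\<^sub>R snd (u, v))) \<bullet> snd i)) (at (u, v))"
    by (intro has_derivative_add has_derivative_diff has_derivative_mult_right has_derivative_inner_left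
        has_derivative_scaleR has_derivative_scaleR_left
        has_derivative_fst_comp[of "\<lambda>u. Gam x1 u u"] has_derivative_snd_comp[of "P x2"]
        has_derivative_snd_comp[of "S x2"] has_derivative_fst_comp[of "q x1"]
        has_derivative_snd[OF has_derivative_ident]
        bilinear_has_derivative[OF bilinear_Gam[OF x1]] linear_has_derivative[OF linear_q[OF x1]])
      (use P.deriv_y[OF x2 nonzero[OF v]] S.deriv_y[OF x2 nonzero[OF v]] in auto)
  show ?thesis
    by (rule trans[OF dy_eqI[OF open_Y in_Y[OF v] _ D]], elim Y_cases)
      (simp_all add: spray_L[OF x1 x2 _ i] Gam_sym[of x1 _ u] inner_simps algebra_simps)
qed

lemma linear_dy_spray_L: "i \<in> Basis \<Longrightarrow> linear (\<lambda>k. dy k (spray L i) (x1, x2) (u, v))"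
  by (rule linearI)
    (simp_all add: dy_spray_L Gam_lin[OF x1] linear_add[OF linear_DP[OF x2 v]]
      linear_scale[OF linear_DP[OF x2 v]] linear_add[OF linear_DS[OF x2 v]] linear_scale[OF linear_DS[OF x2 v]]
      linear_add[OF linear_q[OF x1]] linear_scale[OF linear_q[OF x1]] inner_simps algebra_simps add_divide_distrib)

end

context
  fixes x1 :: 'e and x2 :: 'd and u :: 'e and v :: 'd
  assumes x1: "x1 \<in> U" and x2: "x2 \<in> V" and v: "v \<noteq> 0"
begin

lemma FD_0: "FD (P x2) v 0 = 0" "FD (S x2) v 0 = 0" "q x1 0 = 0"
  using linear_0[OF linear_DP[OF x2 v]] linear_0[OF linear_DS[OF x2 v]] linear_0[OF linear_q[OF x1]] by auto

lemma Riem_base: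
  assumes a: "a \<in> Basis"
  shows "Riem L (a, 0) (a, 0) (x1, x2) (u, v)
    = (Rm x1 a u u - (\<phi> x1 * P x2 v) *\<^sub>R (FD grad x1 a + Gam x1 a (grad x1))) \<bullet> a"
proof -
  have i: "(a, 0::'d) \<in> Basis" using a by (simp add: Basis_prod_def)
  have "((\<lambda>x. (1/2) * ((Gam (fst x) u u - P (snd x) v *\<^sub>R pgrad (fst x)) \<bullet> a)) has_derivative
      (\<lambda>k. (1/2) * ((dGam x1 (fst k) u u - (P (snd (x1, x2)) v *\<^sub>R (\<phi> x1 *\<^sub>R FD grad x1 (fst k) + df x1 (fst k) *\<^sub>R grad x1)
         + FD (\<lambda>x. P x v) x2 (snd k) *\<^sub>R pgrad (fst (x1, x2)))) \<bullet> a))) (at (x1, x2))"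
    by (intro has_derivative_add has_derivative_diff has_derivative_mult_right has_derivative_inner_left
        has_derivative_scaleR
        has_derivative_fst_comp[of "\<lambda>x. Gam x u u"] has_derivative_snd_comp[of "\<lambda>x. P x v"]
        has_derivative_fst_comp[of pgrad])
      (use Gam_deriv[OF x1] P.deriv_x[OF x2 nonzero[OF v]] pgrad_deriv[OF x1] in auto)
  note D = this
  have 1: "dx (a, 0) (spray L (a, 0)) (x1, x2) (u, v)
      = (1/2) * ((dGam x1 a u u - P x2 v *\<^sub>R (\<phi> x1 *\<^sub>R FD grad x1 a + df x1 a *\<^sub>R grad x1)) \<bullet> a)"
    by (rule trans[OF dx_eqI[OF open_W in_W[OF x1 x2] _ D]], elim SigmaE)
      (simp_all add: spray_L v i linear_0[OF smooth_on_linear_FD[OF P.slice_x[OF nonzero[OF v]] x2]])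
  have dy: "dy (a, 0) (spray L (a, 0)) (y1, y2) (w, z) = Gam y1 w a \<bullet> a"
    if "y1 \<in> U" "y2 \<in> V" "z \<noteq> 0" for y1 y2 w z
    using that by (simp add: dy_spray_L i linear_0[OF linear_DP])
  have D2: "((\<lambda>x. Gam (fst x) u a \<bullet> a) has_derivative (\<lambda>k. dGam x1 (fst k) u a \<bullet> a)) (at (x1, x2))"
    by (intro has_derivative_inner_left has_derivative_fst_comp[of "\<lambda>x. Gam x u a"]) (use Gam_deriv[OF x1] in auto)
  have 2: "dx j (dy (a, 0) (spray L (a, 0))) (x1, x2) (u, v) = dGam x1 (fst j) u a \<bullet> a" for j
    by (rule dx_eqI[OF open_W in_W[OF x1 x2] _ D2], elim SigmaE) (simp_all add: dy v)
  have D3: "((\<lambda>y. Gam x1 (fst y) a \<bullet> a) has_derivative (\<lambda>k. Gam x1 (fst k) a \<bullet> a)) (at (u, v))"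
    by (intro has_derivative_inner_left has_derivative_fst_comp[of "\<lambda>u. Gam x1 u a"]
        linear_has_derivative linear_Gam1 x1)
  have 3: "dy j (dy (a, 0) (spray L (a, 0))) (x1, x2) (u, v) = Gam x1 (fst j) a \<bullet> a" for j
    by (rule dy_eqI[OF open_Y in_Y[OF v] _ D3], elim Y_cases) (simp_all add: dy x1 x2)
  have l2: "linear (\<lambda>j::'e \<times> 'd. dGam x1 (fst j) u a \<bullet> a)"
    by (rule linearI) (simp_all add: dGam_lin[OF x1] inner_simps)
  have l3: "linear (\<lambda>j::'e \<times> 'd. Gam x1 (fst j) a \<bullet> a)"
    by (rule linearI) (simp_all add: Gam_lin[OF x1] inner_simps)
  have s2: "(\<Sum>j\<in>Basis. ((u, v) \<bullet> j) * (dGam x1 (fst j) u a \<bullet> a)) = dGam x1 u u a \<bullet> a"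
    using linear_sum_Basis[OF l2, of "(u, v)"] by simp
  have s3: "(\<Sum>j\<in>Basis. spray L j (x1, x2) (u, v) * (Gam x1 (fst j) a \<bullet> a))
      = Gam x1 (fst (spray_vec L (x1, x2) (u, v))) a \<bullet> a"
    using linear_sum_Basis[OF l3, of "spray_vec L (x1, x2) (u, v)"] by (simp add: spray_vec_inner)
  \<comment> \<open>The vector whose components are \<open>dy (a, 0) (spray L j)\<close>; by
    linearity the last sum in \<open>Riem\<close> becomes a single derivative in direction
    \<open>w\<close>.\<close>
  define w where "w = (Gam x1 u a, q x1 a *\<^sub>R v)"
  have "dy (a, 0) (spray L j) (x1, x2) (u, v) = w \<bullet> j" if "j \<in> Basis" for j
    using that by (simp add: dy_spray_L x1 x2 v w_def FD_0 inner_prod_def)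
  then have "(\<Sum>j\<in>Basis. dy j (spray L (a, 0)) (x1, x2) (u, v) * dy (a, 0) (spray L j) (x1, x2) (u, v))
      = dy w (spray L (a, 0)) (x1, x2) (u, v)"
    using linear_sum_Basis[OF linear_dy_spray_L[OF x1 x2 v i], of w u] by (simp add: mult.commute)
  also have "\<dots> = (Gam x1 u (Gam x1 u a) - (df x1 a * P x2 v) *\<^sub>R grad x1) \<bullet> a"
    using \<phi>_pos[OF x1]
    by (simp add: dy_spray_L x1 x2 v i w_def linear_scale[OF linear_DP[OF x2 v]] euler_P[OF x2 v] pgrad_def q_def)
  \<comment> \<open>The terms with \<open>df x1 a\<close>, one from the derivative of
    \<open>pgrad\<close> and one from the last sum, cancel.\<close>
  finally show ?thesis
    unfolding Riem_def 1 2 3 s2 s3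
    by (simp add: spray_vec_L[OF x1 x2 v] Rm_def Gam_lin[OF x1] Gam_sym[of x1 _ a] dGam_sym[of u a]
        inner_simps algebra_simps)
qed

text \<open>The second derivative of \<phi> and the \<open>Gam\<close> term of the base spray
  combine to \<open>Hess\<close>. The square of \<open>q x1 u\<close> cancels, and so do the mixed
  terms with \<open>FD (S x2) v a\<close>, by homogeneity of the spray.\<close>

lemma Riem_fiber:
  assumes a: "a \<in> Basis"
  shows "Riem L (0, a) (0, a) (x1, x2) (u, v)
    = Riem F2 a a x2 v - Hess x1 u u / \<phi> x1 - P x2 v * grad2 x1
      + (FD (P x2) v a * (v \<bullet> a) / 2) * grad2 x1"
proof -
  have i: "(0::'e, a) \<in> Basis" using a by (simp add: Basis_prod_def)
  have D: "((\<lambda>x. (S (snd x) v + q (fst x) u *\<^sub>R v) \<bullet> a) has_derivative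
      (\<lambda>k. (FD (\<lambda>x. S x v) x2 (snd k) + (ddf x1 u (fst k) / \<phi> x1 - df x1 u * df x1 (fst k) / (\<phi> x1)\<^sup>2) *\<^sub>R v) \<bullet> a))
      (at (x1, x2))"
    by (intro has_derivative_add has_derivative_inner_left has_derivative_scaleR_left
        has_derivative_fst_comp[of "\<lambda>x. q x u"] has_derivative_snd_comp[of "\<lambda>x. S x v"])
      (use q_deriv[OF x1] S.deriv_x[OF x2 nonzero[OF v]] in auto)
  have 1: "dx (0, a) (spray L (0, a)) (x1, x2) (u, v) = FD (\<lambda>x. S x v) x2 a \<bullet> a"
    by (rule trans[OF dx_eqI[OF open_W in_W[OF x1 x2] _ D]], elim SigmaE)
      (simp_all add: spray_L v i linear_0[OF linear_ddf2[OF x1]] linear_0[OF linear_df[OF x1]])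
  have dy: "dy (0, a) (spray L (0, a)) (y1, y2) (w, z) = FD (S y2) z a \<bullet> a + q y1 w"
    if "y1 \<in> U" "y2 \<in> V" "z \<noteq> 0" for y1 y2 w z
    using that a by (simp add: dy_spray_L i linear_0[OF linear_q] inner_simps)
  have D2: "((\<lambda>x. FD (S (snd x)) v a \<bullet> a + q (fst x) u) has_derivative
      (\<lambda>k. FD (\<lambda>x. FD (S x) v a) x2 (snd k) \<bullet> a + (ddf x1 u (fst k) / \<phi> x1 - df x1 u * df x1 (fst k) / (\<phi> x1)\<^sup>2)))
      (at (x1, x2))"
    by (intro has_derivative_add has_derivative_inner_left
        has_derivative_fst_comp[of "\<lambda>x. q x u"] has_derivative_snd_comp[of "\<lambda>x. FD (S x) v a"])
      (use q_deriv[OF x1] DS.deriv_x[OF x2 nonzero[OF v]] in auto)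
  have 2: "dx j (dy (0, a) (spray L (0, a))) (x1, x2) (u, v)
      = FD (\<lambda>x. FD (S x) v a) x2 (snd j) \<bullet> a + (ddf x1 u (fst j) / \<phi> x1 - df x1 u * df x1 (fst j) / (\<phi> x1)\<^sup>2)" for j
    by (rule dx_eqI[OF open_W in_W[OF x1 x2] _ D2], elim SigmaE) (simp_all add: dy v)
  have D3: "((\<lambda>y. FD (S x2) (snd y) a \<bullet> a + q x1 (fst y)) has_derivative
      (\<lambda>k. FD (\<lambda>v. FD (S x2) v a) v (snd k) \<bullet> a + q x1 (fst k))) (at (u, v))"
    by (intro has_derivative_add has_derivative_inner_left
        has_derivative_fst_comp[of "q x1"] has_derivative_snd_comp[of "\<lambda>v. FD (S x2) v a"]
        linear_has_derivative linear_q x1) (use DS.deriv_y[OF x2 nonzero[OF v]] in auto)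
  have 3: "dy j (dy (0, a) (spray L (0, a))) (x1, x2) (u, v)
      = FD (\<lambda>v. FD (S x2) v a) v (snd j) \<bullet> a + q x1 (fst j)" for j
    by (rule dy_eqI[OF open_Y in_Y[OF v] _ D3], elim Y_cases) (simp_all add: dy x1 x2)
  have l2: "linear (\<lambda>j. FD (\<lambda>x. FD (S x) v a) x2 (snd j) \<bullet> a
      + (ddf x1 u (fst j) / \<phi> x1 - df x1 u * df x1 (fst j) / (\<phi> x1)\<^sup>2))"
    by (rule linearI) (simp_all add: linear_add[OF linear_XDS[OF x2 v]] linear_scale[OF linear_XDS[OF x2 v]]
        linear_add[OF linear_ddf2[OF x1]] linear_scale[OF linear_ddf2[OF x1]]
        linear_add[OF linear_df[OF x1]] linear_scale[OF linear_df[OF x1]]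
        inner_simps algebra_simps add_divide_distrib)
  have l3: "linear (\<lambda>j. FD (\<lambda>v. FD (S x2) v a) v (snd j) \<bullet> a + q x1 (fst j))"
    by (rule linearI) (simp_all add: linear_add[OF linear_DDS[OF x2 v]] linear_scale[OF linear_DDS[OF x2 v]]
        linear_add[OF linear_q[OF x1]] linear_scale[OF linear_q[OF x1]] inner_simps algebra_simps)
  have s2: "(\<Sum>j\<in>Basis. ((u, v) \<bullet> j) * (FD (\<lambda>x. FD (S x) v a) x2 (snd j) \<bullet> a
      + (ddf x1 u (fst j) / \<phi> x1 - df x1 u * df x1 (fst j) / (\<phi> x1)\<^sup>2)))
    = FD (\<lambda>x. FD (S x) v a) x2 v \<bullet> a + (ddf x1 u u / \<phi> x1 - df x1 u * df x1 u / (\<phi> x1)\<^sup>2)"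
    using linear_sum_Basis[OF l2, of "(u, v)"] by simp
  have s3: "(\<Sum>j\<in>Basis. spray L j (x1, x2) (u, v) * (FD (\<lambda>v. FD (S x2) v a) v (snd j) \<bullet> a + q x1 (fst j)))
      = FD (\<lambda>v. FD (S x2) v a) v (snd (spray_vec L (x1, x2) (u, v))) \<bullet> a + q x1 (fst (spray_vec L (x1, x2) (u, v)))"
    using linear_sum_Basis[OF l3, of "spray_vec L (x1, x2) (u, v)"] by (simp add: spray_vec_inner)
  define w where "w = (- ((FD (P x2) v a / 2) *\<^sub>R pgrad x1), FD (S x2) v a + q x1 u *\<^sub>R a)"
  have "dy (0, a) (spray L j) (x1, x2) (u, v) = w \<bullet> j" if "j \<in> Basis" for j
    using that by (simp add: dy_spray_L x1 x2 v w_def FD_0 inner_prod_def Gam_lin[OF x1])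
  then have "(\<Sum>j\<in>Basis. dy j (spray L (0, a)) (x1, x2) (u, v) * dy (0, a) (spray L j) (x1, x2) (u, v))
      = dy w (spray L (0, a)) (x1, x2) (u, v)"
    using linear_sum_Basis[OF linear_dy_spray_L[OF x1 x2 v i], of w u] by (simp add: mult.commute)
  also have "\<dots> = (FD (S x2) v (FD (S x2) v a) + (2 * q x1 u) *\<^sub>R FD (S x2) v a) \<bullet> a
      - (FD (P x2) v a / 2) * (v \<bullet> a) * grad2 x1 + (q x1 u)\<^sup>2"
  proof -
    have "q x1 (- ((FD (P x2) v a / 2) *\<^sub>R pgrad x1)) = - (FD (P x2) v a / 2) * grad2 x1"
      using \<phi>_pos[OF x1]
      by (simp add: q_def pgrad_def linear_neg[OF linear_df[OF x1]] linear_scale[OF linear_df[OF x1]] grad2_eq[OF x1])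
    then show ?thesis
      using a by (simp add: dy_spray_L x1 x2 v i w_def linear_add[OF linear_DS[OF x2 v]]
          linear_scale[OF linear_DS[OF x2 v]] inner_simps power2_eq_square algebra_simps)
  qed
  finally have s4: "(\<Sum>j\<in>Basis. dy j (spray L (0, a)) (x1, x2) (u, v) * dy (0, a) (spray L j) (x1, x2) (u, v))
    = (FD (S x2) v (FD (S x2) v a) + (2 * q x1 u) *\<^sub>R FD (S x2) v a) \<bullet> a
      - (FD (P x2) v a / 2) * (v \<bullet> a) * grad2 x1 + (q x1 u)\<^sup>2" .
  have qG: "q x1 (fst (spray_vec L (x1, x2) (u, v))) = (df x1 (Gam x1 u u) / \<phi> x1 - P x2 v * grad2 x1) / 2"
    using \<phi>_pos[OF x1]
    by (simp add: spray_vec_L[OF x1 x2 v] q_def linear_scale[OF linear_df[OF x1]]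
        linear_diff[OF linear_df[OF x1]] grad2_eq[OF x1] field_simps)
  have sG: "FD (\<lambda>v. FD (S x2) v a) v (snd (spray_vec L (x1, x2) (u, v)))
      = FD (\<lambda>v. FD (S x2) v a) v (S x2 v) + q x1 u *\<^sub>R FD (S x2) v a"
    by (simp add: spray_vec_L[OF x1 x2 v] q_def linear_add[OF linear_DDS[OF x2 v]]
        linear_scale[OF linear_DDS[OF x2 v]] euler_DS[OF x2 v])
  show ?thesis
    unfolding Riem_def[of L] 1 2 3 s2 s3 s4 qG sG Riem_F2[OF x2 v a]
    by (simp add: Hess_def inner_simps algebra_simps diff_divide_distrib q_def power2_eq_square)
qed

text \<open>In the fiber trace Euler's relation sums the terms
  \<open>FD (P x2) v a * (v \<bullet> a) / 2\<close> to \<open>P x2 v\<close>, which turns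
  \<open>DIM('d)\<close> into \<open>DIM('d) - 1\<close> in front of \<open>grad2\<close>.\<close>

lemma ricci_formula:
  "Ricci L (x1, x2) (u, v) = Ricci F2 x2 v + Ric x1 u u - DIM('d) / \<phi> x1 * Hess x1 u u
    - (\<phi> x1 * Lap x1 + (real DIM('d) - 1) * grad2 x1) * P x2 v"
proof -
  have "Ricci L (x1, x2) (u, v) = (\<Sum>a\<in>Basis. Riem L (a, 0) (a, 0) (x1, x2) (u, v))
      + (\<Sum>a\<in>Basis. Riem L (0, a) (0, a) (x1, x2) (u, v))"
    unfolding Ricci_def by (rule sum_Basis_prod)
  also have "(\<Sum>a\<in>Basis. Riem L (a, 0) (a, 0) (x1, x2) (u, v)) = Ric x1 u u - \<phi> x1 * P x2 v * Lap x1"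
    by (simp add: Riem_base Ric_def div_grad[OF x1, symmetric] inner_diff_left sum_subtractf sum_distrib_left)
  also have "(\<Sum>a\<in>Basis. Riem L (0, a) (0, a) (x1, x2) (u, v))
      = Ricci F2 x2 v - DIM('d) * (Hess x1 u u / \<phi> x1) - DIM('d) * (P x2 v * grad2 x1) + P x2 v * grad2 x1"
  proof -
    have "(\<Sum>a\<in>Basis. FD (P x2) v a * (v \<bullet> a) / 2 * grad2 x1) = FD (P x2) v v / 2 * grad2 x1"
      unfolding linear_sum_Basis[OF linear_DP[OF x2 v], of v]
      by (simp add: sum_distrib_right sum_distrib_left sum_divide_distrib mult_ac)
    then show ?thesis
      by (simp add: Riem_fiber Ricci_def sum.distrib sum_subtractf euler_P[OF x2 v])
  qed
  finally show ?thesis by (simp add: algebra_simps)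
qed

end

text \<open>The divergence of the spray is a linear function of \<open>u\<close> plus the divergence
  of the fiber spray: the term with \<open>P\<close> in the base part has no derivative in base
  directions, and the radial term contributes \<open>DIM('d) * q x1 u\<close>. Second derivatives in
  the direction variables therefore see only the fiber.\<close>

lemma E_curv_L:
  assumes x1: "x1 \<in> U" and x2: "x2 \<in> V" and v: "v \<noteq> 0" and ij: "i \<in> Basis" "j \<in> Basis"
    and E: "\<And>a b. a \<in> Basis \<Longrightarrow> b \<in> Basis \<Longrightarrow> E_curv F2 a b x2 v = 0"
  shows "E_curv L i j (x1, x2) (u, v) = 0"
proof -
  have pt: "(u, v) \<in> Y" using v by (auto simp: Y_def)
  define T where "T = (\<lambda>v. \<Sum>s\<in>Basis. FD (S x2) v s \<bullet> s)"
  define C where "C = (\<lambda>u. (\<Sum>a\<in>Basis. Gam x1 u a \<bullet> a) + DIM('d) * q x1 u)"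
  have T: "smooth_on T (- {0})"
    unfolding T_def by (intro smooth_intros P.open_Y DS.slice_y x2)
  have C: "linear C"
    by (rule linearI) (simp_all add: C_def Gam_lin[OF x1] inner_simps sum.distrib sum_distrib_left
        linear_add[OF linear_q[OF x1]] linear_scale[OF linear_q[OF x1]] algebra_simps)
  have div: "(\<Sum>s\<in>Basis. dy s (spray L s) (x1, x2) (w, z)) = C w + T z" if "z \<noteq> 0" for w z
  proof -
    have b: "(a, 0) \<in> Basis" if "a \<in> Basis" for a :: 'e using that by (simp add: Basis_prod_def)
    have f: "(0, a) \<in> Basis" if "a \<in> Basis" for a :: 'd using that by (simp add: Basis_prod_def)
    show ?thesis
      unfolding sum_Basis_prod
      using that by (simp add: dy_spray_L x1 x2 b f C_def T_def inner_simps sum.distrib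
          linear_0[OF linear_DP] linear_0[OF linear_q])
  qed
  have 1: "dy j (\<lambda>x y. \<Sum>s\<in>Basis. dy s (spray L s) x y) (x1, x2) (w, z) = C (fst j) + FD T z (snd j)"
    if z: "z \<noteq> 0" for w z
  proof -
    have "((\<lambda>y. C (fst y) + T (snd y)) has_derivative (\<lambda>k. C (fst k) + FD T z (snd k))) (at (w, z))"
      by (intro has_derivative_add has_derivative_fst_comp[of C] has_derivative_snd_comp[of T]
          linear_has_derivative C) (use smooth_on_has_derivative[OF T] z in auto)
    moreover have "(w, z) \<in> Y" using z by (auto simp: Y_def)
    ultimately show ?thesis
      by (intro dy_eqI[OF open_Y, where B = "\<lambda>y. C (fst y) + T (snd y)"]) (auto elim!: Y_cases simp: div)
  qed
  have "((\<lambda>y. C (fst j) + FD T (snd y) (snd j)) has_derivative (\<lambda>k. 0 + FD (\<lambda>v. FD T v (snd j)) v (snd k))) (at (u, v))"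
    by (intro has_derivative_add has_derivative_const has_derivative_snd_comp[of "\<lambda>v. FD T v (snd j)"])
      (use smooth_on_has_derivative[OF smooth_on_FD[OF T]] v in auto)
  then have "dy i (dy j (\<lambda>x y. \<Sum>s\<in>Basis. dy s (spray L s) x y)) (x1, x2) (u, v)
      = 0 + FD (\<lambda>v. FD T v (snd j)) v (snd i)"
    by (rule dy_eqI[OF open_Y pt, rotated]) (auto elim!: Y_cases simp: 1)
  also have "\<dots> = 0"
  proof (cases "snd i = 0 \<or> snd j = 0")
    case True
    have "FD (\<lambda>v. FD T v 0) v = FD (\<lambda>v. 0) v"
      by (rule FD_cong_open[OF P.open_Y]) (use v linear_0[OF smooth_on_linear_FD[OF T]] in auto)
    then show ?thesis
      using True v linear_0[OF smooth_on_linear_FD[OF smooth_on_FD[OF T]]] by auto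
  next
    case False
    then have "snd i \<in> Basis" "snd j \<in> Basis" using ij by (auto simp: Basis_prod_def)
    from E[OF this] show ?thesis by (simp add: E_curv_F2[OF x2 v] T_def)
  qed
  finally show ?thesis by (simp add: E_curv_def)
qed

end

section \<open>Extrema of a function in a Riemannian chart\<close>

context riem_fun
begin

text \<open>At a minimum \<open>df\<close> vanishes, so the Christoffel term drops out of
  \<open>Hess\<close>, and the second-order condition for \<open>- \<phi>\<close> with
  \<open>H = sharp\<close> gives the sign.\<close>

lemma Lap_min:
  assumes x: "x \<in> U" and min: "\<And>y. y \<in> U \<Longrightarrow> \<phi> x \<le> \<phi> y"
  shows "Lap x \<ge> 0" "grad2 x = 0"
proof -
  have d1: "((\<lambda>x. - \<phi> x) has_derivative (\<lambda>k. - df y k)) (at y)" if "y \<in> U" for y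
    using smooth_on_has_derivative[OF smooth_\<phi> that] by (simp add: df_def[abs_def] has_derivative_minus)
  have d2: "((\<lambda>y. - df y b) has_derivative (\<lambda>w. - ddf x b w)) (at x)" for b
    using smooth_on_has_derivative[OF smooth_df x] by (simp add: ddf_def[abs_def] has_derivative_minus)
  have sp: "sharp x u \<bullet> u \<ge> 0" for u
    using sharp_pos[of u x] by (cases "u = 0") (auto simp: less_imp_le)
  note M = elliptic_at_max[OF open_U x d1 d2 _ linear_sharp sharp_sym sp]
  have df0: "df x v = 0" for v
    using M(1)[of v] min by simp
  then show "grad2 x = 0" by (simp add: grad2_def)
  have "(\<Sum>b\<in>Basis. - ddf x b (sharp x b)) \<le> 0"
    using M(2) min by simp
  then show "Lap x \<ge> 0"
    by (simp add: Lap_def Hess_def df0 sum_negf)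
qed

text \<open>The quadratic term becomes linear by writing \<open>grad2 x = df x (grad x)\<close> and
  regarding \<open>grad\<close> as a known field: \<open>k grad\<close>, together with the
  Christoffel part of the Laplacian, forms the drift \<beta>.\<close>

lemma strong_maximum_Lap:
  assumes pos_\<phi>: "\<And>x. x \<in> U \<Longrightarrow> \<phi> x > 0"
    and sub: "\<And>x. x \<in> U \<Longrightarrow> \<phi> x * Lap x + k * grad2 x \<ge> 0"
    and x0: "x0 \<in> U" and max: "\<And>x. x \<in> U \<Longrightarrow> \<phi> x \<le> \<phi> x0"
  shows "\<exists>e>0. ball x0 e \<subseteq> U \<and> (\<forall>x\<in>ball x0 e. \<phi> x = \<phi> x0)"
proof (rule strong_maximum_principle[OF open_U smooth_\<phi>])
  let ?H = "\<lambda>x b. \<phi> x *\<^sub>R sharp x b"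
  let ?\<beta> = "\<lambda>x. k *\<^sub>R grad x - \<phi> x *\<^sub>R (\<Sum>b\<in>Basis. Gam x b (sharp x b))"
  show "linear (?H x)" if "x \<in> U" for x
    by (rule linearI) (simp_all add: linear_add[OF linear_sharp] linear_scale[OF linear_sharp] algebra_simps)
  show "?H x u \<bullet> w = u \<bullet> ?H x w" if "x \<in> U" for x u w
    by (simp add: sharp_sym)
  show "?H x u \<bullet> u > 0" if "x \<in> U" "u \<noteq> 0" for x u
    using sharp_pos[OF that(2)] pos_\<phi>[OF that(1)] by simp
  show "continuous_on U (\<lambda>x. ?H x b)" for b
    by (intro smooth_on_continuous_on smooth_intros open_U smooth_\<phi> smooth_sharp)
  show "continuous_on U ?\<beta>"
    by (intro smooth_on_continuous_on smooth_intros open_U smooth_\<phi> smooth_grad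
        smooth_Gam' smooth_sharp)
  show "(\<Sum>b\<in>Basis. FD (\<lambda>y. FD \<phi> y b) x (?H x b)) + FD \<phi> x (?\<beta> x) \<ge> 0" if x: "x \<in> U" for x
  proof -
    have "(\<Sum>b\<in>Basis. FD (\<lambda>y. FD \<phi> y b) x (?H x b)) = \<phi> x * (\<Sum>b\<in>Basis. ddf x b (sharp x b))"
      using linear_scale[OF linear_ddf2[OF x]] by (simp add: ddf_def df_def sum_distrib_left)
    moreover have "FD \<phi> x (?\<beta> x) = k * grad2 x - \<phi> x * (\<Sum>b\<in>Basis. df x (Gam x b (sharp x b)))"
      unfolding df_def[symmetric] grad2_eq[OF x]
      by (simp add: linear_diff[OF linear_df[OF x]] linear_scale[OF linear_df[OF x]] linear_sum[OF linear_df[OF x]])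
    ultimately show ?thesis
      using sub[OF x] by (simp add: Lap_def Hess_def sum_subtractf algebra_simps)
  qed
qed (use x0 max in auto)

end


section \<open>Charts and tangent vectors\<close>

lemma chartD:
  assumes "is_chart c"
  shows open_chart_domain: "open (fst c)" and open_chart_image: "open (chart_image c)"
    and chart_inv_left: "p \<in> fst c \<Longrightarrow> chart_inv c (snd c p) = p"
    and chart_inv_right: "x \<in> chart_image c \<Longrightarrow> snd c (chart_inv c x) = x"
    and chart_inv_in: "x \<in> chart_image c \<Longrightarrow> chart_inv c x \<in> fst c"
    and continuous_chart: "continuous_on (fst c) (snd c)"
    and chart_in: "p \<in> fst c \<Longrightarrow> snd c p \<in> chart_image c"
  using assms unfolding is_chart_def homeomorphism_def chart_image_def by auto

lemma tangent_vec_apply: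
  "tangent_vec c p y h = (if (h \<circ> chart_inv c) differentiable (at (snd c p))
     then FD (h \<circ> chart_inv c) (snd c p) y else 0)"
  by (simp add: tangent_vec_def)

lemma tangent_vec_scale: "tangent_vec c p (t *\<^sub>R y) = (\<lambda>h. t * tangent_vec c p y h)"
proof
  fix h
  show "tangent_vec c p (t *\<^sub>R y) h = t * tangent_vec c p y h"
    by (simp add: tangent_vec_apply linear_scale[OF linear_frechet_derivative])
qed

lemma tangent_vec_0: "tangent_vec c p 0 = (\<lambda>h. 0)"
  using tangent_vec_scale[of c p 0 0] by simp

text \<open>The test function \<open>p \<mapsto> snd c p \<bullet> y\<close> distinguishes the
  vector from zero: its derivative is \<open>y \<bullet> y\<close>.\<close>

lemma tangent_vec_nonzero:
  assumes "is_chart c" "p \<in> fst c" "y \<noteq> 0"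
  shows "tangent_vec c p y \<noteq> (\<lambda>h. 0)"
proof -
  let ?h = "\<lambda>p. snd c p \<bullet> y"
  have "((\<lambda>x. x \<bullet> y) has_derivative (\<lambda>w. w \<bullet> y)) (at (snd c p))"
    by (auto intro!: derivative_eq_intros)
  then have D: "((?h \<circ> chart_inv c) has_derivative (\<lambda>w. w \<bullet> y)) (at (snd c p))"
    by (rule has_derivative_transform_within_open[OF _ open_chart_image[OF assms(1)] chart_in[OF assms(1,2)]])
      (simp add: chart_inv_right[OF assms(1)])
  then have "(?h \<circ> chart_inv c) differentiable (at (snd c p))"
    by (rule differentiableI)
  then have "tangent_vec c p y ?h = y \<bullet> y"
    using FD_eqI[OF D] by (simp add: tangent_vec_apply)
  then show ?thesis using assms(3) by (metis inner_eq_zero_iff)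
qed

section \<open>Product charts and push-forwards under the projections\<close>

definition prod_chart :: "('a, 'e) chart \<Rightarrow> ('b, 'd) chart \<Rightarrow> ('a \<times> 'b, 'e \<times> 'd) chart" where
  "prod_chart c1 c2 = (fst c1 \<times> fst c2, map_prod (snd c1) (snd c2))"

lemma prod_chart_simps [simp]:
  "fst (prod_chart c1 c2) = fst c1 \<times> fst c2" "snd (prod_chart c1 c2) (p1, p2) = (snd c1 p1, snd c2 p2)"
  by (simp_all add: prod_chart_def)

lemma product_atlas_eq: "product_atlas A1 A2 = {prod_chart c1 c2 | c1 c2. c1 \<in> A1 \<and> c2 \<in> A2}"
  by (simp add: product_atlas_def prod_chart_def)

lemma chart_inv_prod:
  assumes "is_chart c1" "is_chart c2" "x1 \<in> chart_image c1" "x2 \<in> chart_image c2"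
  shows "chart_inv (prod_chart c1 c2) (x1, x2) = (chart_inv c1 x1, chart_inv c2 x2)"
proof -
  have "inj_on (snd c1) (fst c1)" "inj_on (snd c2) (fst c2)"
    using chart_inv_left[OF assms(1)] chart_inv_left[OF assms(2)] by (metis inj_onI)+
  then have inj: "inj_on (snd (prod_chart c1 c2)) (fst (prod_chart c1 c2))"
    by (auto simp: inj_on_def)
  show ?thesis
    unfolding chart_inv_def[of "prod_chart c1 c2"]
    by (rule inv_into_f_eq[OF inj]) (simp_all add: assms chart_inv_in chart_inv_right)
qed

text \<open>\<open>tangent_vec\<close> is zero on functions that are not differentiable, so
  differentiability has to pass in both directions. The converse uses the section \<open>s\<close>
  of \<pi> through \<open>z\<close>: \<open>k\<close> is the composition of
  \<open>k \<circ> \<pi>\<close> with \<open>s\<close>.\<close>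

lemma
  assumes \<pi>: "bounded_linear \<pi>" and s: "(s has_derivative s') (at (\<pi> z))" "s (\<pi> z) = z"
    and \<pi>s: "\<And>x. \<pi> (s x) = x"
  shows differentiable_comp_proj_iff: "(\<lambda>x. k (\<pi> x)) differentiable (at z) \<longleftrightarrow> k differentiable (at (\<pi> z))"
    and FD_comp_proj: "k differentiable (at (\<pi> z)) \<Longrightarrow> FD (\<lambda>x. k (\<pi> x)) z w = FD k (\<pi> z) (\<pi> w)"
proof -
  have D: "((\<lambda>x. k (\<pi> x)) has_derivative (\<lambda>w. FD k (\<pi> z) (\<pi> w))) (at z)" if "k differentiable (at (\<pi> z))"
    using has_derivative_compose[OF bounded_linear_imp_has_derivative[OF \<pi>]] that
    by (simp add: frechet_derivative_works)
  then show "k differentiable (at (\<pi> z)) \<Longrightarrow> FD (\<lambda>x. k (\<pi> x)) z w = FD k (\<pi> z) (\<pi> w)"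
    by (simp add: FD_eqI)
  have "k differentiable (at (\<pi> z))" if "(\<lambda>x. k (\<pi> x)) differentiable (at z)"
  proof -
    have "((\<lambda>x. k (\<pi> x)) has_derivative FD (\<lambda>x. k (\<pi> x)) z) (at (s (\<pi> z)))"
      using that by (simp add: s(2) frechet_derivative_works)
    from has_derivative_compose[OF s(1) this] show ?thesis
      by (auto simp: \<pi>s intro: differentiableI)
  qed
  then show "(\<lambda>x. k (\<pi> x)) differentiable (at z) \<longleftrightarrow> k differentiable (at (\<pi> z))"
    using D differentiableI by blast
qed

lemma pushforward_tangent_vec:
  assumes W: "open W" "snd c p \<in> W" and \<Phi>: "\<And>x. x \<in> W \<Longrightarrow> \<Phi> (chart_inv c x) = chart_inv d (\<pi> x)"
    and eq: "snd d (\<Phi> p) = \<pi> (snd c p)"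
    and \<pi>: "bounded_linear \<pi>" and s: "(s has_derivative s') (at (\<pi> (snd c p)))" "s (\<pi> (snd c p)) = snd c p"
    and \<pi>s: "\<And>x. \<pi> (s x) = x"
  shows "pushforward \<Phi> (tangent_vec c p y) = tangent_vec d (\<Phi> p) (\<pi> y)"
proof
  fix h :: "_ \<Rightarrow> real"
  let ?k = "h \<circ> chart_inv d"
  have h: "((h \<circ> \<Phi>) \<circ> chart_inv c) x = ?k (\<pi> x)" if "x \<in> W" for x
    using \<Phi>[OF that] by simp
  show "pushforward \<Phi> (tangent_vec c p y) h = tangent_vec d (\<Phi> p) (\<pi> y) h"
    using differentiable_cong_iff[OF W h] FD_cong_open[OF W h]
      differentiable_comp_proj_iff[OF \<pi> s \<pi>s, of ?k] FD_comp_proj[OF \<pi> s \<pi>s, of ?k]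
    by (simp add: pushforward_def tangent_vec_apply eq del: o_apply)
qed

lemma
  assumes c: "is_chart c1" "is_chart c2" and p: "p1 \<in> fst c1" "p2 \<in> fst c2"
  shows pushforward_fst: "pushforward fst (tangent_vec (prod_chart c1 c2) (p1, p2) (u, v)) = tangent_vec c1 p1 u"
    and pushforward_snd: "pushforward snd (tangent_vec (prod_chart c1 c2) (p1, p2) (u, v)) = tangent_vec c2 p2 v"
proof -
  let ?W = "chart_image c1 \<times> chart_image c2"
  have W: "open ?W" "snd (prod_chart c1 c2) (p1, p2) \<in> ?W"
    by (auto intro!: open_Times open_chart_image chart_in c p)
  have "((\<lambda>x. (x, snd c2 p2)) has_derivative (\<lambda>w. (w, 0))) (at (snd c1 p1))"
    "((\<lambda>x. (snd c1 p1, x)) has_derivative (\<lambda>w. (0, w))) (at (snd c2 p2))"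
    by (auto intro!: derivative_eq_intros)
  then show "pushforward fst (tangent_vec (prod_chart c1 c2) (p1, p2) (u, v)) = tangent_vec c1 p1 u"
    "pushforward snd (tangent_vec (prod_chart c1 c2) (p1, p2) (u, v)) = tangent_vec c2 p2 v"
    using pushforward_tangent_vec[OF W, of fst c1 fst "\<lambda>x. (x, snd c2 p2)" "\<lambda>w. (w, 0)" "(u, v)"]
      pushforward_tangent_vec[OF W, of snd c2 snd "\<lambda>x. (snd c1 p1, x)" "\<lambda>w. (0, w)" "(u, v)"]
    by (auto simp: chart_inv_prod[OF c] bounded_linear_fst bounded_linear_snd)
qed

lemma slit_tangent_bundleI:
  "c \<in> A \<Longrightarrow> is_chart c \<Longrightarrow> p \<in> fst c \<Longrightarrow> y \<noteq> 0 \<Longrightarrow> (p, tangent_vec c p y) \<in> slit_tangent_bundle A"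
  unfolding slit_tangent_bundle_def tangent_bundle_def
  using tangent_vec_nonzero[of c p y] by blast

lemma product_slit_bundleI:
  assumes "c1 \<in> A1" "c2 \<in> A2" "is_chart c1" "is_chart c2" "p1 \<in> fst c1" "p2 \<in> fst c2" "u \<noteq> 0" "v \<noteq> 0"
  shows "((p1, p2), tangent_vec (prod_chart c1 c2) (p1, p2) (u, v)) \<in> product_slit_bundle A1 A2"
proof -
  have "((p1, p2), tangent_vec (prod_chart c1 c2) (p1, p2) (u, v)) \<in> tangent_bundle (product_atlas A1 A2)"
    unfolding tangent_bundle_def product_atlas_eq using assms(1,2,5,6) prod_chart_simps(1) by blast
  then show ?thesis
    using assms by (simp add: product_slit_bundle_def pushforward_fst pushforward_snd slit_tangent_bundleI)
qed

lemma product_slit_bundle_snd_nonzero: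
  assumes "is_chart c1" "is_chart c2" "p1 \<in> fst c1" "p2 \<in> fst c2"
    and "((p1, p2), tangent_vec (prod_chart c1 c2) (p1, p2) (u, v)) \<in> product_slit_bundle A1 A2"
  shows "v \<noteq> 0"
  using assms by (auto simp: product_slit_bundle_def pushforward_snd slit_tangent_bundle_def tangent_vec_0)

text \<open>The dot product off the chart image is a dummy value; it makes the form an inner product
  at every point, as \<open>riem_chart\<close> demands.\<close>

definition chart_metric ::
  "('a, 'e::euclidean_space) chart \<Rightarrow> ('a \<Rightarrow> 'a tangent \<Rightarrow> 'a tangent \<Rightarrow> real) \<Rightarrow> 'e \<Rightarrow> 'e \<Rightarrow> 'e \<Rightarrow> real" where
  "chart_metric c g1 x u w = (if x \<in> chart_image c
     then g1 (chart_inv c x) (tangent_vec c (chart_inv c x) u) (tangent_vec c (chart_inv c x) w) else u \<bullet> w)"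

lemma smooth_atlas_chart: "smooth_atlas A \<Longrightarrow> c \<in> A \<Longrightarrow> is_chart c"
  by (simp add: smooth_atlas_def)

lemma smooth_atlas_cover: "smooth_atlas A \<Longrightarrow> \<exists>c\<in>A. p \<in> fst c"
  unfolding smooth_atlas_def by blast

lemma riem_chart_metric:
  assumes A: "smooth_atlas A" and g1: "riemannian_metric A g1" and c: "c \<in> A"
  shows "riem_chart (chart_image c) (chart_metric c g1)"
proof -
  have ch: "is_chart c" by (rule smooth_atlas_chart[OF A c])
  have o: "open (chart_image c)" by (rule open_chart_image[OF ch])
  have P: "bilinear (\<lambda>u w. g1 p (tangent_vec c p u) (tangent_vec c p w))"
    "g1 p (tangent_vec c p u) (tangent_vec c p w) = g1 p (tangent_vec c p w) (tangent_vec c p u)"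
    "u \<noteq> 0 \<Longrightarrow> g1 p (tangent_vec c p u) (tangent_vec c p u) > 0"
    if "p \<in> fst c" for p u w
    using g1 c that unfolding riemannian_metric_def by blast+
  have bil: "bilinear (chart_metric c g1 x)" for x
  proof (cases "x \<in> chart_image c")
    case True
    then show ?thesis
      using P(1)[OF chart_inv_in[OF ch True]] by (simp add: chart_metric_def[abs_def])
  next
    case False
    then show ?thesis
      using bounded_bilinear_inner by (simp add: chart_metric_def[abs_def] bilinear_conv_bounded_bilinear)
  qed
  show ?thesis
  proof
    show "open (chart_image c)" by (rule o)
    show "bilinear (chart_metric c g1 x)" for x by (rule bil)
    show "chart_metric c g1 x u w = chart_metric c g1 x w u" for x u w
      using P(2)[OF chart_inv_in[OF ch], of x u w] by (simp add: chart_metric_def inner_commute)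
    show "chart_metric c g1 x u u > 0" if "u \<noteq> 0" for x u
      using P(3)[OF chart_inv_in[OF ch] that] that by (simp add: chart_metric_def)
    have sm: "smooth_on (\<lambda>x. chart_metric c g1 x i j) (chart_image c)" if "i \<in> Basis" "j \<in> Basis" for i j
      by (rule smooth_on_cong[OF o, of "\<lambda>x. g1 (chart_inv c x) (tangent_vec c (chart_inv c x) i)
          (tangent_vec c (chart_inv c x) j)"])
        (use g1 c that in \<open>auto simp: chart_metric_def riemannian_metric_def\<close>)
    \<comment> \<open>\<open>riemannian_metric\<close> grants smoothness for pairs of basis vectors;
      bilinear expansion extends it to all vectors.\<close>
    show "smooth_on (\<lambda>x. chart_metric c g1 x u w) (chart_image c)" for u w
    proof (rule smooth_on_cong[OF o])
      show "smooth_on (\<lambda>x. \<Sum>i\<in>Basis. (u \<bullet> i) * (\<Sum>j\<in>Basis. (w \<bullet> j) * chart_metric c g1 x i j)) (chart_image c)"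
        by (intro smooth_intros o sm)
      show "(\<Sum>i\<in>Basis. (u \<bullet> i) * (\<Sum>j\<in>Basis. (w \<bullet> j) * chart_metric c g1 x i j)) = chart_metric c g1 x u w" for x
      proof -
        have l1: "linear (\<lambda>u. chart_metric c g1 x u w)" and l2: "linear (chart_metric c g1 x u)" for u w
          using bil[of x] by (auto simp: bilinear_def)
        show ?thesis
          using linear_sum_Basis[OF l1, of u w] linear_sum_Basis[OF l2, of _ w] by simp
      qed
    qed
  qed
qed

lemma riemannian_norm_local:
  assumes A: "smooth_atlas A" and g1: "riemannian_metric A g1" and c: "c \<in> A" and p: "p \<in> fst c"
  shows "riemannian_norm g1 p (tangent_vec c p u) = sqrt (chart_metric c g1 (snd c p) u u)"
    and "(riemannian_norm g1 p (tangent_vec c p u))\<^sup>2 = chart_metric c g1 (snd c p) u u"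
proof -
  have ch: "is_chart c" by (rule smooth_atlas_chart[OF A c])
  interpret riem_chart "chart_image c" "chart_metric c g1"
    by (rule riem_chart_metric[OF A g1 c])
  show "riemannian_norm g1 p (tangent_vec c p u) = sqrt (chart_metric c g1 (snd c p) u u)"
    using chart_in[OF ch p] chart_inv_left[OF ch p] by (simp add: riemannian_norm_def chart_metric_def)
  moreover have "chart_metric c g1 (snd c p) u u \<ge> 0" by (rule g_nonneg)
  ultimately show "(riemannian_norm g1 p (tangent_vec c p u))\<^sup>2 = chart_metric c g1 (snd c p) u u"
    by simp
qed

text \<open>\<open>riemannian_product\<close> asks for Finsler factors, so the base norm must
  qualify as one. Its square is quadratic in the direction, hence its fundamental tensor is the
  metric itself.\<close>

lemma finsler_riemannian_norm:
  assumes A: "smooth_atlas A" and g1: "riemannian_metric A g1"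
  shows "finsler_metric A (riemannian_norm g1)"
  unfolding finsler_metric_def
proof (intro conjI ballI allI impI; clarify?)
  fix p v assume "(p, v) \<in> tangent_bundle A"
  then obtain c y where c: "c \<in> A" "p \<in> fst c" and v: "v = tangent_vec c p y"
    by (auto simp: tangent_bundle_def)
  interpret riem_chart "chart_image c" "chart_metric c g1"
    by (rule riem_chart_metric[OF A g1 c(1)])
  show "riemannian_norm g1 p v \<ge> 0 \<and> (\<forall>t>0. riemannian_norm g1 p (\<lambda>h. t * v h) = t * riemannian_norm g1 p v)"
    unfolding v tangent_vec_scale[symmetric] riemannian_norm_local(1)[OF A g1 c]
    by (simp add: g_nonneg g_simps real_sqrt_mult)
next
  fix c assume c: "c \<in> A"
  have ch: "is_chart c" by (rule smooth_atlas_chart[OF A c])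
  interpret riem_chart "chart_image c" "chart_metric c g1"
    by (rule riem_chart_metric[OF A g1 c])
  have loc: "local_rep c (riemannian_norm g1) x y = sqrt (chart_metric c g1 x y y)" if "x \<in> chart_image c" for x y
    using riemannian_norm_local(1)[OF A g1 c chart_inv_in[OF ch that]] chart_inv_right[OF ch that]
    by (simp add: local_rep_def)
  have fsq: "fsq (local_rep c (riemannian_norm g1)) x y = chart_metric c g1 x y y" if "x \<in> chart_image c" for x y
    using loc[OF that, of y] by (simp add: fsq_def g_nonneg)
  have joint: "smooth_on (\<lambda>(x, y). chart_metric c g1 x y y) (chart_image c \<times> T)" if "open T" for T
  proof -
    have o: "open (chart_image c \<times> T)" by (intro open_Times open_U that)
    have s: "smooth_on (\<lambda>z. chart_metric c g1 (fst z) i j) (chart_image c \<times> T)" for i j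
      using smooth_on_affine_comp[OF smooth_g o bounded_linear_fst, of 0 i j] by auto
    have sn: "smooth_on snd (chart_image c \<times> T)"
      by (intro smooth_on_bounded_linear o bounded_linear_snd)
    show ?thesis
    proof (rule smooth_on_cong[OF o])
      show "smooth_on (\<lambda>z. \<Sum>i\<in>Basis. (snd z \<bullet> i) * (\<Sum>j\<in>Basis. (snd z \<bullet> j) * chart_metric c g1 (fst z) i j))
          (chart_image c \<times> T)"
        by (intro smooth_intros o s sn)
      show "(\<Sum>i\<in>Basis. (snd z \<bullet> i) * (\<Sum>j\<in>Basis. (snd z \<bullet> j) * chart_metric c g1 (fst z) i j))
          = (case z of (x, y) \<Rightarrow> chart_metric c g1 x y y)" for z
        using linear_sum_Basis[OF linear_g1, of "fst z" "snd z" "snd z"]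
          linear_sum_Basis[OF linear_g2, of "fst z" _ "snd z"] by (simp add: case_prod_unfold)
    qed
  qed
  show "continuous_on (chart_image c \<times> UNIV) (\<lambda>(x, y). local_rep c (riemannian_norm g1) x y)"
  proof (rule continuous_on_cong[THEN iffD1, OF refl])
    show "continuous_on (chart_image c \<times> UNIV) (\<lambda>z. sqrt (case z of (x, y) \<Rightarrow> chart_metric c g1 x y y))"
      by (intro continuous_on_real_sqrt smooth_on_continuous_on joint open_UNIV)
  qed (auto simp: loc)
  show "smooth_on (\<lambda>(x, y). local_rep c (riemannian_norm g1) x y) (chart_image c \<times> - {0})"
  proof (rule smooth_on_cong)
    show o: "open (chart_image c \<times> - {0::'b})" by (intro open_Times open_U open_Compl) auto
    show "smooth_on (\<lambda>z. sqrt (case z of (x, y) \<Rightarrow> chart_metric c g1 x y y)) (chart_image c \<times> - {0})"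
      by (rule smooth_on_sqrt[OF o joint]) (use pos in \<open>auto intro: open_Compl\<close>)
  qed (auto simp: loc)
  fix x u y :: 'b
  assume x: "x \<in> chart_image c" and "u \<noteq> 0"
  let ?F = "local_rep c (riemannian_norm g1)"
  have 1: "dy j (fsq ?F) x y = 2 * chart_metric c g1 x y j" for j y
    by (rule trans[OF dy_eqI[OF open_UNIV UNIV_I _ bilinear_has_derivative[OF bil[of x]]]])
      (simp_all add: fsq[OF x] sym[of x j])
  have 2: "fund ?F i j x y = chart_metric c g1 x i j" for i j
  proof -
    have "((\<lambda>y. 2 * chart_metric c g1 x y j) has_derivative (\<lambda>k. 2 * chart_metric c g1 x k j)) (at y)"
      by (intro has_derivative_mult_right linear_has_derivative linear_g1)
    from dy_eqI[OF open_UNIV UNIV_I _ this, of "dy j (fsq ?F)" x i] show ?thesis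
      by (simp add: fund_def 1)
  qed
  have "(\<Sum>i\<in>Basis. \<Sum>j\<in>Basis. fund ?F i j x y * (u \<bullet> i) * (u \<bullet> j)) = chart_metric c g1 x u u"
    using linear_sum_Basis[OF linear_g1, of x u u] linear_sum_Basis[OF linear_g2, of x _ u]
    by (simp add: 2 sum_distrib_left mult_ac)
  then show "(\<Sum>i\<in>Basis. \<Sum>j\<in>Basis. fund ?F i j x y * (u \<bullet> i) * (u \<bullet> j)) > 0"
    using pos[OF \<open>u \<noteq> 0\<close>, of x] by simp
qed

lemma finsler_chart_local:
  assumes A: "smooth_atlas A" and F: "finsler_metric A F" and c: "c \<in> A"
  shows "finsler_chart (chart_image c) (local_rep c F)"
proof
  have ch: "is_chart c" by (rule smooth_atlas_chart[OF A c])
  show o: "open (chart_image c)" by (rule open_chart_image[OF ch])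
  have "smooth_on (\<lambda>z. (case z of (x, y) \<Rightarrow> local_rep c F x y) ^ 2) (chart_image c \<times> - {0})"
    by (intro smooth_intros open_Times o) (use F c in \<open>auto simp: finsler_metric_def intro: open_Compl\<close>)
  then show "smooth_on (\<lambda>(x, y). fsq (local_rep c F) x y) (chart_image c \<times> - {0})"
    by (simp add: case_prod_unfold fsq_def)
  fix x and y :: 'b assume x: "x \<in> chart_image c"
  have "(chart_inv c x, tangent_vec c (chart_inv c x) y) \<in> tangent_bundle A"
    using c chart_inv_in[OF ch x] unfolding tangent_bundle_def by blast
  then show "fsq (local_rep c F) x (t *\<^sub>R y) = t\<^sup>2 * fsq (local_rep c F) x y" if "t > 0" for t
    using F that unfolding finsler_metric_def fsq_def local_rep_def tangent_vec_scale
    by (fastforce simp: power_mult_distrib)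
  show "fund_pos (local_rep c F) x y" if "y \<noteq> 0"
    using F c x that by (simp add: finsler_metric_def fund_pos_def)
qed


section \<open>Einstein warped products\<close>

locale einstein_warped =
  fixes A1 :: "('a::{t2_space, second_countable_topology}, 'e::euclidean_space) chart set"
    and A2 :: "('b::{t2_space, second_countable_topology}, 'd::euclidean_space) chart set"
    and g1 :: "'a \<Rightarrow> 'a tangent \<Rightarrow> 'a tangent \<Rightarrow> real"
    and f :: "'a \<Rightarrow> real"
    and F2 :: "'b \<Rightarrow> 'b tangent \<Rightarrow> real"
    and lam :: "'a \<times> 'b \<Rightarrow> real"
  assumes A1: "smooth_atlas A1" and A2: "smooth_atlas A2"
    and g1: "riemannian_metric A1 g1"
    and f: "smooth_function A1 f" and f_pos: "f p > 0"
    and F2: "finsler_metric A2 F2"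
    and einstein: "einstein_with (product_atlas A1 A2) (product_slit_bundle A1 A2)
      (warped_product (riemannian_norm g1) f F2) lam"
begin

abbreviation "F \<equiv> warped_product (riemannian_norm g1) f F2"
abbreviation "\<phi> c \<equiv> f \<circ> chart_inv c"
abbreviation "gc c \<equiv> chart_metric c g1"

lemmas chart1 = smooth_atlas_chart[OF A1] and chart2 = smooth_atlas_chart[OF A2]

lemma riem_fun_chart: "c \<in> A1 \<Longrightarrow> riem_fun (chart_image c) (gc c) (\<phi> c)"
  using riem_chart_metric[OF A1 g1] f
  by (auto simp: riem_fun_def riem_fun_axioms_def smooth_function_def)

lemma F_tangent:
  assumes "c1 \<in> A1" "c2 \<in> A2" "p1 \<in> fst c1" "p2 \<in> fst c2"
  shows "(F (p1, p2) (tangent_vec (prod_chart c1 c2) (p1, p2) (u, v)))\<^sup>2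
    = gc c1 (snd c1 p1) u u + (f p1)\<^sup>2 * (F2 p2 (tangent_vec c2 p2 v))\<^sup>2"
proof -
  interpret riem_chart "chart_image c1" "gc c1"
    by (rule riem_chart_metric[OF A1 g1 assms(1)])
  show ?thesis
    using assms chart1 chart2
    by (simp add: g_nonneg warped_product_def pushforward_fst pushforward_snd riemannian_norm_local(2)[OF A1 g1])
qed

lemma warped_chart_prod:
  assumes c: "c1 \<in> A1" "c2 \<in> A2"
  shows "warped_chart (chart_image c1) (gc c1) (\<phi> c1) (chart_image c2) (local_rep c2 F2)
    (local_rep (prod_chart c1 c2) F)"
proof -
  note ch = chart1[OF c(1)] chart2[OF c(2)]
  have "fsq (local_rep (prod_chart c1 c2) F) (x1, x2) (u, v)
      = gc c1 x1 u u + (\<phi> c1 x1)\<^sup>2 * fsq (local_rep c2 F2) x2 v"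
    if "x1 \<in> chart_image c1" "x2 \<in> chart_image c2" for x1 x2 u v
    using F_tangent[OF c chart_inv_in[OF ch(1) that(1)] chart_inv_in[OF ch(2) that(2)], of u v]
    by (simp add: fsq_def local_rep_def chart_inv_prod[OF ch that] chart_inv_right[OF ch(1) that(1)])
  then show ?thesis
    using riem_fun_chart[OF c(1)] finsler_chart_local[OF A2 F2 c(2)] f_pos
    by (simp add: warped_chart_def warped_chart_axioms_def)
qed

text \<open>Separation of variables. The right side of the second equation involves fiber data only,
  so the left side takes the same value at all base points over a fixed fiber vector.\<close>

lemma base_fiber_equations:
  assumes c: "c1 \<in> A1" "c2 \<in> A2" and p: "p1 \<in> fst c1" "p2 \<in> fst c2"
  defines "x1 \<equiv> snd c1 p1" and "x2 \<equiv> snd c2 p2"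
  shows "riem_chart.Ric (gc c1) x1 u u - DIM('d) / f p1 * riem_fun.Hess (gc c1) (\<phi> c1) x1 u u
      = lam (p1, p2) * gc c1 x1 u u" (is ?base)
    and "v \<noteq> 0 \<Longrightarrow> f p1 * riem_fun.Lap (gc c1) (\<phi> c1) x1
        + (real DIM('d) - 1) * riem_fun.grad2 (gc c1) (\<phi> c1) x1 + lam (p1, p2) * (f p1)\<^sup>2
      = Ricci (local_rep c2 F2) x2 v / fsq (local_rep c2 F2) x2 v" (is "_ \<Longrightarrow> ?fiber")
proof -
  note ch = chart1[OF c(1)] chart2[OF c(2)]
  interpret warped_chart "chart_image c1" "gc c1" "\<phi> c1" "chart_image c2" "local_rep c2 F2"
    "local_rep (prod_chart c1 c2) F"
    by (rule warped_chart_prod[OF c])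
  have x: "x1 \<in> chart_image c1" "x2 \<in> chart_image c2"
    unfolding x1_def x2_def by (intro chart_in ch p)+
  have inv: "chart_inv c1 x1 = p1" "chart_inv c2 x2 = p2"
    unfolding x1_def x2_def by (intro chart_inv_left ch p)+
  have main: "Ricci (local_rep c2 F2) x2 v + Ric x1 u u - DIM('d) / f p1 * Hess x1 u u
      - (f p1 * Lap x1 + (real DIM('d) - 1) * grad2 x1) * P x2 v
      = lam (p1, p2) * (gc c1 x1 u u + (f p1)\<^sup>2 * P x2 v)" if "u \<noteq> 0" "v \<noteq> 0" for u v
  proof -
    have "Ricci (local_rep (prod_chart c1 c2) F) (x1, x2) (u, v)
        = lam (p1, p2) * (F (p1, p2) (tangent_vec (prod_chart c1 c2) (p1, p2) (u, v)))\<^sup>2"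
    proof -
      have "prod_chart c1 c2 \<in> product_atlas A1 A2" using c unfolding product_atlas_eq by blast
      moreover have "(p1, p2) \<in> fst (prod_chart c1 c2)" using p by simp
      ultimately show ?thesis
        using einstein product_slit_bundleI[OF c ch p that] unfolding einstein_with_def x1_def x2_def
        by (metis prod_chart_simps(2))
    qed
    then show ?thesis
      using ricci_formula[OF x that(2), of u] F_tangent[OF c p, of u v] inv
      by (simp add: fsq_def local_rep_def x1_def[symmetric])
  qed
  obtain u0 :: 'e where u0: "u0 \<noteq> 0" using nonempty_Basis nonzero_Basis by blast
  obtain v0 :: 'd where v0: "v0 \<noteq> 0" using nonempty_Basis nonzero_Basis by blast
  have sep: "Ric x1 u u - DIM('d) / f p1 * Hess x1 u u = lam (p1, p2) * gc c1 x1 u u"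
    if "u \<noteq> 0" for u
  proof -
    define D where "D = DIM('d) / f p1"
    have "2 *\<^sub>R u \<noteq> 0" using that by simp
    \<comment> \<open>The difference of the equations at \<open>2 u\<close> and at \<open>u\<close>
      is three times the part quadratic in \<open>u\<close>.\<close>
    from main[OF this v0] main[OF that v0] show ?thesis
      unfolding D_def[symmetric]
      by (simp add: g_simps linear_scale[OF linear_Ric1[OF x(1)]] linear_scale[OF linear_Ric2[OF x(1)]]
        linear_scale[OF linear_Hess1[OF x(1)]] linear_scale[OF linear_Hess2[OF x(1)]] algebra_simps)
  qed
  show ?base
    using sep[of u] linear_0[OF linear_Ric1[OF x(1)]] linear_0[OF linear_Hess1[OF x(1)]]
    by (cases "u = 0") (auto simp: g_simps)
  show ?fiber if "v \<noteq> 0"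
    using main[OF u0 that] sep[OF u0] P_pos[OF x(2) that]
    by (simp add: field_simps)
qed

end

section \<open>From charts to the whole base: constancy of the warping function\<close>

lemma continuous_smooth_function:
  assumes A: "smooth_atlas A" and f: "smooth_function A f"
  shows "continuous_on UNIV f"
proof -
  have "continuous_on (\<Union>c\<in>A. fst c) f"
  proof (rule continuous_on_open_UN)
    fix c assume c: "c \<in> A"
    have ch: "is_chart c" by (rule smooth_atlas_chart[OF A c])
    show "open (fst c)" by (rule open_chart_domain[OF ch])
    have "continuous_on (chart_image c) (f \<circ> chart_inv c)"
      using f c smooth_on_continuous_on unfolding smooth_function_def by blast
    then have "continuous_on (fst c) (\<lambda>p. (f \<circ> chart_inv c) (snd c p))"
      by (rule continuous_on_compose2[OF _ continuous_chart[OF ch]]) (use chart_in[OF ch] in auto)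
    then show "continuous_on (fst c) f"
      by (rule continuous_on_cong[THEN iffD1, OF refl, rotated]) (simp add: chart_inv_left[OF ch])
  qed
  then show ?thesis using A by (simp add: smooth_atlas_def)
qed

lemma chart_ball_nhd:
  assumes ch: "is_chart c" and p: "p \<in> fst c" and e: "e > 0" "ball (snd c p) e \<subseteq> chart_image c"
  shows "\<exists>T. open T \<and> p \<in> T \<and> T \<subseteq> fst c \<and> (\<forall>q\<in>T. snd c q \<in> ball (snd c p) e)"
proof -
  have "open (fst c \<inter> snd c -` ball (snd c p) e)"
    by (rule continuous_open_preimage[OF continuous_chart[OF ch] open_chart_domain[OF ch] open_ball])
  then show ?thesis using p e(1)
    by (intro exI[of _ "fst c \<inter> snd c -` ball (snd c p) e"]) auto
qed

context einstein_warped
begin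

text \<open>The strong maximum principle makes the set where \<open>f\<close> attains its maximum open.\<close>

lemma constant_if_subharmonic:
  assumes "compact (UNIV :: 'a set)" "connected (UNIV :: 'a set)"
    and sub: "\<And>c p. c \<in> A1 \<Longrightarrow> p \<in> fst c \<Longrightarrow>
      f p * riem_fun.Lap (gc c) (\<phi> c) (snd c p) + k * riem_fun.grad2 (gc c) (\<phi> c) (snd c p) \<ge> 0"
  shows "f constant_on UNIV"
proof -
  have cont: "continuous_on UNIV f" by (rule continuous_smooth_function[OF A1 f])
  obtain pm where pm: "\<And>p. f p \<le> f pm"
    using continuous_attains_sup[OF assms(1) UNIV_not_empty cont] by blast
  define T where "T = {p. f p = f pm}"
  have "closed T"
    unfolding T_def using continuous_closed_preimage_constant[OF cont closed_UNIV, of "f pm"] by simp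
  moreover have "open T"
  proof (subst open_subopen, intro ballI)
    fix p assume "p \<in> T"
    then have fp: "f p = f pm" by (simp add: T_def)
    obtain c where c: "c \<in> A1" "p \<in> fst c" using smooth_atlas_cover[OF A1] by blast
    have ch: "is_chart c" by (rule chart1[OF c(1)])
    interpret riem_fun "chart_image c" "gc c" "\<phi> c" by (rule riem_fun_chart[OF c(1)])
    have "\<exists>e>0. ball (snd c p) e \<subseteq> chart_image c \<and> (\<forall>x\<in>ball (snd c p) e. \<phi> c x = \<phi> c (snd c p))"
    proof (rule strong_maximum_Lap)
      show "\<phi> c x > 0" for x by (simp add: f_pos)
      show "\<phi> c x * Lap x + k * grad2 x \<ge> 0" if "x \<in> chart_image c" for x
        using sub[OF c(1) chart_inv_in[OF ch that]] chart_inv_right[OF ch that] by simp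
      show "snd c p \<in> chart_image c" by (rule chart_in[OF ch c(2)])
      show "\<phi> c x \<le> \<phi> c (snd c p)" for x
        using pm fp by (simp add: chart_inv_left[OF ch c(2)])
    qed
    then obtain e where e: "e > 0" "ball (snd c p) e \<subseteq> chart_image c"
      "\<And>x. x \<in> ball (snd c p) e \<Longrightarrow> \<phi> c x = \<phi> c (snd c p)" by blast
    obtain V where V: "open V" "p \<in> V" "V \<subseteq> fst c" "\<And>q. q \<in> V \<Longrightarrow> snd c q \<in> ball (snd c p) e"
      using chart_ball_nhd[OF ch c(2) e(1,2)] by blast
    have "f q = f pm" if "q \<in> V" for q
      using e(3)[OF V(4)[OF that]] chart_inv_left[OF ch] c(2) V(3) that fp by auto
    then show "\<exists>V. open V \<and> p \<in> V \<and> V \<subseteq> T"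
      using V by (auto simp: T_def)
  qed
  ultimately have "T = {} \<or> T = UNIV"
    using assms(2)[unfolded connected_clopen] by simp
  then have "T = UNIV" by (auto simp: T_def)
  then show ?thesis by (auto simp: constant_on_def T_def)
qed

lemma warped_einstein_base_chart:
  assumes "c \<in> A1" "c2 \<in> A2" "q \<in> fst c2" "v \<noteq> 0"
  shows "warped_einstein_base (chart_image c) (gc c) (\<phi> c) ((\<lambda>p. lam (p, q)) \<circ> chart_inv c) DIM('d)
    (Ricci (local_rep c2 F2) (snd c2 q) v / fsq (local_rep c2 F2) (snd c2 q) v)"
proof -
  have ch: "is_chart c" by (rule chart1[OF assms(1)])
  interpret riem_fun "chart_image c" "gc c" "\<phi> c" by (rule riem_fun_chart[OF assms(1)])
  show ?thesis
  proof
    show "\<phi> c x > 0" for x by (simp add: f_pos)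
    show "0 < real DIM('d)" by simp
    fix x assume x: "x \<in> chart_image c"
    note E = base_fiber_equations[OF assms(1,2) chart_inv_in[OF ch x] assms(3), unfolded chart_inv_right[OF ch x]]
    show "Ric x u u - DIM('d) / \<phi> c x * Hess x u u = ((\<lambda>p. lam (p, q)) \<circ> chart_inv c) x * gc c x u u" for u
      using E(1) by simp
    show "\<phi> c x * Lap x + (real DIM('d) - 1) * grad2 x + ((\<lambda>p. lam (p, q)) \<circ> chart_inv c) x * (\<phi> c x)\<^sup>2
        = Ricci (local_rep c2 F2) (snd c2 q) v / fsq (local_rep c2 F2) (snd c2 q) v"
      using E(2)[OF assms(4)] by simp
  qed
qed

lemma f_constant:
  assumes "compact (UNIV :: 'a set)" "connected (UNIV :: 'a set)" and lam: "\<And>p. lam p \<le> 0"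
  shows "f constant_on UNIV"
proof -
  obtain q :: 'b and c2 where c2: "c2 \<in> A2" "q \<in> fst c2" using smooth_atlas_cover[OF A2] by blast
  obtain v :: 'd where v: "v \<noteq> 0" using nonempty_Basis nonzero_Basis by blast
  \<comment> \<open>One fiber point and one fiber vector suffice: \<open>l\<close> is
    \<open>lam\<close> on the slice through \<open>q\<close>, and \<mu> the fiber side of the second
    equation at \<open>v\<close>, the same for all base points.\<close>
  define l where "l = (\<lambda>p. lam (p, q))"
  define \<mu> where "\<mu> = Ricci (local_rep c2 F2) (snd c2 q) v / fsq (local_rep c2 F2) (snd c2 q) v"
  have base: "warped_einstein_base (chart_image c) (gc c) (\<phi> c) (l \<circ> chart_inv c) DIM('d) \<mu>" if "c \<in> A1" for c
    unfolding l_def \<mu>_def by (rule warped_einstein_base_chart[OF that c2 v])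
  have fiber: "f p * riem_fun.Lap (gc c) (\<phi> c) (snd c p)
      + (real DIM('d) - 1) * riem_fun.grad2 (gc c) (\<phi> c) (snd c p) + l p * (f p)\<^sup>2 = \<mu>"
    if "c \<in> A1" "p \<in> fst c" for c p
    unfolding l_def \<mu>_def using base_fiber_equations(2)[OF that(1) c2(1) that(2) c2(2) v] .
  have l0: "l p \<le> 0" for p by (simp add: l_def lam)
  show ?thesis
  proof (cases "DIM('e) + DIM('d) = 2")
    \<comment> \<open>The coefficient in \<open>schur\<close> is zero here. Instead the base has no
      Ricci curvature, and the traced base equation expresses the Laplacian through
      \<open>l\<close>.\<close>
    case True
    then have d: "DIM('e) = 1" "DIM('d) = 1"
      using DIM_positive[where 'a = 'e] DIM_positive[where 'a = 'd] by linarith+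
    show ?thesis
    proof (rule constant_if_subharmonic[OF assms(1,2), where k = 0])
      fix c p assume c: "c \<in> A1" "p \<in> fst c"
      have ch: "is_chart c" by (rule chart1[OF c(1)])
      interpret warped_einstein_base "chart_image c" "gc c" "\<phi> c" "l \<circ> chart_inv c" "DIM('d)" \<mu>
        by (rule base[OF c(1)])
      have x: "snd c p \<in> chart_image c" by (rule chart_in[OF ch c(2)])
      have "l p * DIM('e) + DIM('d) / f p * Lap (snd c p) = 0"
        using trace_einstein[OF x] by (simp add: Ric_dim1[OF x d(1)] chart_inv_left[OF ch c(2)])
      then have "Lap (snd c p) = - (f p * l p)"
        using f_pos[of p] d by (simp add: field_simps)
      then have "f p * Lap (snd c p) = - l p * (f p)\<^sup>2"
        by (simp add: power2_eq_square)
      then show "f p * Lap (snd c p) + 0 * grad2 (snd c p) \<ge> 0"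
        using l0[of p] by (simp add: mult_nonpos_nonneg)
    qed
  next
    case False
    have "l constant_on UNIV"
    proof (rule locally_constant_imp_constant[OF assms(2)])
      fix p
      obtain c where c: "c \<in> A1" "p \<in> fst c" using smooth_atlas_cover[OF A1] by blast
      have ch: "is_chart c" by (rule chart1[OF c(1)])
      interpret warped_einstein_base "chart_image c" "gc c" "\<phi> c" "l \<circ> chart_inv c" "DIM('d)" \<mu>
        by (rule base[OF c(1)])
      obtain e where e: "e > 0" "ball (snd c p) e \<subseteq> chart_image c"
        using open_contains_ball open_U chart_in[OF ch c(2)] by blast
      \<comment> \<open>A vanishing derivative on a ball in the chart gives local constancy of
        \<open>l\<close>; connectedness of the base makes it global.\<close>
      have "((l \<circ> chart_inv c) has_derivative (\<lambda>h. 0)) (at x within ball (snd c p) e)"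
        if "x \<in> ball (snd c p) e" for x
      proof -
        have x: "x \<in> chart_image c" using that e by blast
        have "FD (l \<circ> chart_inv c) x = (\<lambda>h. 0)"
          using schur[OF x] False by (auto simp: fun_eq_iff)
        then show ?thesis
          using smooth_on_has_derivative[OF smooth_lam x] by (auto intro: has_derivative_at_withinI)
      qed
      then obtain k where k: "\<And>x. x \<in> ball (snd c p) e \<Longrightarrow> (l \<circ> chart_inv c) x = k"
        using has_derivative_zero_constant[OF convex_ball, of "snd c p" e "l \<circ> chart_inv c"] by metis
      obtain V where V: "open V" "p \<in> V" "V \<subseteq> fst c" "\<And>q. q \<in> V \<Longrightarrow> snd c q \<in> ball (snd c p) e"
        using chart_ball_nhd[OF ch c(2) e] by blast
      have "l q = k" if "q \<in> V" for q
        using k[OF V(4)[OF that]] chart_inv_left[OF ch] V(3) that by auto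
      then show "\<exists>T. openin (top_of_set UNIV) T \<and> p \<in> T \<and> (\<forall>x\<in>T. l x = l p)"
        using V by (intro exI[of _ V]) auto
    qed
    then obtain L where L: "\<And>p. l p = L" by (auto simp: constant_on_def)
    have L0: "L \<le> 0" using l0 L by metis
    obtain pm where pm: "\<And>p. f pm \<le> f p"
      using continuous_attains_inf[OF assms(1) UNIV_not_empty continuous_smooth_function[OF A1 f]] by blast
    obtain cm where cm: "cm \<in> A1" "pm \<in> fst cm" using smooth_atlas_cover[OF A1] by blast
    have "\<mu> - L * (f pm)\<^sup>2 \<ge> 0"
    proof -
      have ch: "is_chart cm" by (rule chart1[OF cm(1)])
      interpret riem_fun "chart_image cm" "gc cm" "\<phi> cm" by (rule riem_fun_chart[OF cm(1)])
      have "\<phi> cm (snd cm pm) \<le> \<phi> cm y" for y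
        using pm by (simp add: chart_inv_left[OF ch cm(2)])
      from Lap_min[OF chart_in[OF ch cm(2)] this]
      have "Lap (snd cm pm) \<ge> 0" "grad2 (snd cm pm) = 0" by auto
      then show ?thesis
        using fiber[OF cm] f_pos[of pm] by (simp add: L) (smt (verit) mult_nonneg_nonneg)
    qed
    show ?thesis
    proof (rule constant_if_subharmonic[OF assms(1,2), where k = "real DIM('d) - 1"])
      fix c p assume c: "c \<in> A1" "p \<in> fst c"
      have "(f pm)\<^sup>2 \<le> (f p)\<^sup>2" using pm[of p] f_pos[of pm] by (intro power_mono) auto
      then have "L * (f p)\<^sup>2 \<le> L * (f pm)\<^sup>2" using L0 by (rule mult_left_mono_neg)
      then show "f p * riem_fun.Lap (gc c) (\<phi> c) (snd c p)
          + (real DIM('d) - 1) * riem_fun.grad2 (gc c) (\<phi> c) (snd c p) \<ge> 0"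
        using fiber[OF c] \<open>\<mu> - L * (f pm)\<^sup>2 \<ge> 0\<close> by (simp add: L)
    qed
  qed
qed

text \<open>Vectors in \<open>product_slit_bundle\<close> have a nonzero fiber component, so the
  hypothesis on \<open>F2\<close> applies at that component and \<open>E_curv_L\<close> transfers it
  in each product chart.\<close>

lemma weakly_berwald_warped:
  assumes wb: "weakly_berwald A2 (slit_tangent_bundle A2) F2"
  shows "weakly_berwald (product_atlas A1 A2) (product_slit_bundle A1 A2) F"
  unfolding weakly_berwald_def
proof (intro ballI allI impI)
  fix c p y and i j :: "'e \<times> 'd"
  assume "c \<in> product_atlas A1 A2" "p \<in> fst c" and D: "(p, tangent_vec c p y) \<in> product_slit_bundle A1 A2"
    and ij: "i \<in> Basis" "j \<in> Basis"
  then obtain c1 c2 p1 p2 u v where c: "c1 \<in> A1" "c2 \<in> A2" "c = prod_chart c1 c2"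
    and p: "p1 \<in> fst c1" "p2 \<in> fst c2" "p = (p1, p2)" and y: "y = (u, v)"
    by (cases y) (auto simp: product_atlas_eq)
  have ch: "is_chart c1" "is_chart c2" using chart1 chart2 c by auto
  have v: "v \<noteq> 0"
    using product_slit_bundle_snd_nonzero[OF ch p(1,2)] D by (simp add: c p y)
  interpret warped_chart "chart_image c1" "gc c1" "\<phi> c1" "chart_image c2" "local_rep c2 F2"
    "local_rep (prod_chart c1 c2) F"
    by (rule warped_chart_prod[OF c(1,2)])
  have "E_curv (local_rep c2 F2) a b (snd c2 p2) v = 0" if "a \<in> Basis" "b \<in> Basis" for a b
    using wb slit_tangent_bundleI[OF c(2) ch(2) p(2) v] c p that unfolding weakly_berwald_def by blast
  then show "E_curv (local_rep c F) i j (snd c p) y = 0"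
    using E_curv_L[OF chart_in[OF ch(1) p(1)] chart_in[OF ch(2) p(2)] v ij] by (simp add: c p y)
qed

end

theorem theorem11:
  fixes A1 :: "('a::{t2_space, second_countable_topology}, 'e::euclidean_space) chart set"
    and A2 :: "('b::{t2_space, second_countable_topology}, 'd::euclidean_space) chart set"
    and g1 :: "'a \<Rightarrow> 'a tangent \<Rightarrow> 'a tangent \<Rightarrow> real"
    and f :: "'a \<Rightarrow> real"
    and F2 :: "'b \<Rightarrow> 'b tangent \<Rightarrow> real"
    and lam :: "'a \<times> 'b \<Rightarrow> real"
  defines "F \<equiv> warped_product (riemannian_norm g1) f F2"
  assumes "smooth_atlas A1" and "compact (UNIV :: 'a set)" and "connected (UNIV :: 'a set)"
    and "riemannian_metric A1 g1"
    and "smooth_function A1 f" and "\<forall>p. f p > 0"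
    and "smooth_atlas A2" and "finsler_metric A2 F2"
    and "weakly_berwald A2 (slit_tangent_bundle A2) F2"
    and "einstein_with (product_atlas A1 A2) (product_slit_bundle A1 A2) F lam"
    and "\<forall>p. lam p \<le> 0"
  shows "f constant_on UNIV \<and>
    riemannian_product A1 A2 F \<and>
    weakly_berwald (product_atlas A1 A2) (product_slit_bundle A1 A2) F"
proof -
  interpret einstein_warped A1 A2 g1 f F2 lam
    by unfold_locales (use assms in auto)
  have const: "f constant_on UNIV"
    using f_constant assms by blast
  then obtain k where k: "\<And>p. f p = k" by (auto simp: constant_on_def)
  have "k > 0" using f_pos k by metis
  then have "riemannian_product A1 A2 F"
    unfolding riemannian_product_def F_def
    using finsler_riemannian_norm[OF A1 g1] \<open>finsler_metric A2 F2\<close>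
    by (intro exI[of _ "riemannian_norm g1"] exI[of _ F2] exI[of _ k]) (auto simp: warped_product_def k)
  then show ?thesis
    using const weakly_berwald_warped[OF assms(10)] by (simp add: F_def)
qed

end
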